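(* Let $\Delta$ be an irreducible reduced root system and $S\subset\Pi_l$; let $\langle S\rangle$ be the smallest subset of $\Pi_l$ containing $S$ that is connected in the Dynkin diagram. Then (i) $\bigcap_{\alpha\in S}I(\alpha)_{\sf min}=\bigcap_{\alpha\in\langle S\rangle}I(\alpha)_{\sf min}$; (ii) if $\Delta$ is not of type $A_n$, then $\bigcup_{\alpha\in S}I(\alpha)_{\sf max}=\bigcup_{\alpha\in\langle S\rangle}I(\alpha)_{\sf max}$.
   Context: $\Delta^+$, $\Pi$, $\theta$: positive roots, simple roots, highest root; $W$ the Weyl group, $(\ ,\ )$ a $W$-invariant inner product. $\Delta^+_l$ is the set of long positive roots and $\Pi_l=\Pi\cap\Delta^+_l$. $\mathcal H=\{\gamma\in\Delta^+\mid(\gamma,\theta)>0\}$. An upper ideal of $\Delta^+$ is $I\subset\Delta^+$ with $\gamma\in I,\nu\in\Delta^+,\nu+\gamma\in\Delta^+\Rightarrow\nu+\gamma\in I$; it is abelian if $\gamma'+\gamma''\notin\Delta^+$ for all $\gamma',\gamma''\in I$. For $w\in W$, $N(w)=\{\gamma\in\Delta^+\mid w(\gamma)\in-\Delta^+\}$. For $\mu\in\Delta^+_l$, let $w_\mu$ be the unique minimal-length element of $W$ with $w_\mu(\theta)=\mu$ and $I(\mu)_{\sf min}=\{\theta\}\cup\{\theta-\gamma\mid\gamma\in N(w_\mu)\}$ (an abelian upper ideal contained in $\mathcal H$). It is known that among nonempty abelian upper ideals $I$ with $I\cap\mathcal H=I(\mu)_{\sf min}$ there is a unique maximal one, denoted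 $I(\mu)_{\sf max}$. *)

theory Defs
  imports "HOL-Analysis.Analysis"
begin

section \<open>Root systems in a Euclidean space (standard inner product)\<close>

definition refl :: "'a::euclidean_space \<Rightarrow> 'a \<Rightarrow> 'a" where
  "refl \<alpha> v = v - (2 * (v \<bullet> \<alpha>) / (\<alpha> \<bullet> \<alpha>)) *\<^sub>R \<alpha>"

text \<open>A reduced (crystallographic) root system spanning the space.\<close>
definition reduced_root_system :: "'a::euclidean_space set \<Rightarrow> bool" where
  "reduced_root_system R \<longleftrightarrow>
     finite R \<and> 0 \<notin> R \<and> span R = UNIV \<and>
     (\<forall>\<alpha>\<in>R. \<forall>c::real. c *\<^sub>R \<alpha> \<in> R \<longrightarrow> c = 1 \<or> c = -1) \<and>
     (\<forall>\<alpha>\<in>R. \<forall>\<beta>\<in>R. refl \<alpha> \<beta> \<in> R) \<and>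
     (\<forall>\<alpha>\<in>R. \<forall>\<beta>\<in>R. 2 * (\<beta> \<bullet> \<alpha>) / (\<alpha> \<bullet> \<alpha>) \<in> \<int>)"

definition irreducible_rs :: "'a::euclidean_space set \<Rightarrow> bool" where
  "irreducible_rs R \<longleftrightarrow> R \<noteq> {} \<and>
     \<not> (\<exists>R1 R2. R1 \<noteq> {} \<and> R2 \<noteq> {} \<and> R1 \<union> R2 = R \<and>
              (\<forall>\<alpha>\<in>R1. \<forall>\<beta>\<in>R2. \<alpha> \<bullet> \<beta> = 0))"

text \<open>Nonnegative integer combinations of the simple roots.\<close>
definition nonneg_comb :: "'a::euclidean_space set \<Rightarrow> 'a \<Rightarrow> bool" where
  "nonneg_comb P v \<longleftrightarrow> (\<exists>c::'a \<Rightarrow> int. (\<forall>\<beta>\<in>P. c \<beta> \<ge> 0) \<and> v = (\<Sum>\<beta>\<in>P. of_int (c \<beta>) *\<^sub>R \<beta>))"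

text \<open>\<open>P\<close> is a set of simple roots (a base) of \<open>R\<close>.\<close>
definition simple_system :: "'a::euclidean_space set \<Rightarrow> 'a set \<Rightarrow> bool" where
  "simple_system R P \<longleftrightarrow> P \<subseteq> R \<and> independent P \<and>
     (\<forall>\<alpha>\<in>R. nonneg_comb P \<alpha> \<or> nonneg_comb P (- \<alpha>))"

definition pos_roots :: "'a::euclidean_space set \<Rightarrow> 'a set \<Rightarrow> 'a set" where
  "pos_roots R P = {\<alpha>\<in>R. nonneg_comb P \<alpha>}"

definition highest_root :: "'a::euclidean_space set \<Rightarrow> 'a set \<Rightarrow> 'a" where
  "highest_root R P = (THE \<theta>. \<theta> \<in> pos_roots R P \<and> (\<forall>\<alpha>\<in>pos_roots R P. nonneg_comb P (\<theta> - \<alpha>)))"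

definition long_roots :: "'a::euclidean_space set \<Rightarrow> 'a set \<Rightarrow> 'a set" where
  "long_roots R P = {\<alpha>\<in>pos_roots R P. \<forall>\<beta>\<in>R. \<beta> \<bullet> \<beta> \<le> \<alpha> \<bullet> \<alpha>}"

definition long_simple :: "'a::euclidean_space set \<Rightarrow> 'a set \<Rightarrow> 'a set" where
  "long_simple R P = P \<inter> long_roots R P"

section \<open>Weyl group and length\<close>

definition refl_prod :: "'a::euclidean_space list \<Rightarrow> 'a \<Rightarrow> 'a" where
  "refl_prod xs = foldr (\<lambda>\<alpha> f. refl \<alpha> \<circ> f) xs id"

text \<open>The Weyl group: the group generated by all reflections \<open>s_\<alpha>\<close>, \<open>\<alpha> \<in> R\<close>.\<close>
definition weyl :: "'a::euclidean_space set \<Rightarrow> ('a \<Rightarrow> 'a) set" where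
  "weyl R = {refl_prod xs | xs. set xs \<subseteq> R}"

text \<open>Length with respect to the simple reflections.\<close>
definition wlen :: "'a::euclidean_space set \<Rightarrow> ('a \<Rightarrow> 'a) \<Rightarrow> nat" where
  "wlen P w = (LEAST n. \<exists>xs. length xs = n \<and> set xs \<subseteq> P \<and> w = refl_prod xs)"

definition inv_set :: "'a::euclidean_space set \<Rightarrow> 'a set \<Rightarrow> ('a \<Rightarrow> 'a) \<Rightarrow> 'a set" where
  "inv_set R P w = {\<gamma>\<in>pos_roots R P. - w \<gamma> \<in> pos_roots R P}"

definition w_mu :: "'a::euclidean_space set \<Rightarrow> 'a set \<Rightarrow> 'a \<Rightarrow> ('a \<Rightarrow> 'a)" where
  "w_mu R P \<mu> = (THE w. w \<in> weyl R \<and> w (highest_root R P) = \<mu> \<and>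
      (\<forall>w'\<in>weyl R. w' (highest_root R P) = \<mu> \<longrightarrow> wlen P w \<le> wlen P w'))"

section \<open>Ideals\<close>

definition upper_ideal :: "'a::euclidean_space set \<Rightarrow> 'a set \<Rightarrow> 'a set \<Rightarrow> bool" where
  "upper_ideal R P I \<longleftrightarrow> I \<subseteq> pos_roots R P \<and>
     (\<forall>\<gamma>\<in>I. \<forall>\<nu>\<in>pos_roots R P. \<nu> + \<gamma> \<in> pos_roots R P \<longrightarrow> \<nu> + \<gamma> \<in> I)"

definition abelian_ideal :: "'a::euclidean_space set \<Rightarrow> 'a set \<Rightarrow> 'a set \<Rightarrow> bool" where
  "abelian_ideal R P I \<longleftrightarrow> upper_ideal R P I \<and>
     (\<forall>\<gamma>1\<in>I. \<forall>\<gamma>2\<in>I. \<gamma>1 + \<gamma>2 \<notin> pos_roots R P)"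

definition heis :: "'a::euclidean_space set \<Rightarrow> 'a set \<Rightarrow> 'a set" where
  "heis R P = {\<gamma>\<in>pos_roots R P. \<gamma> \<bullet> highest_root R P > 0}"

definition I_min :: "'a::euclidean_space set \<Rightarrow> 'a set \<Rightarrow> 'a \<Rightarrow> 'a set" where
  "I_min R P \<mu> = insert (highest_root R P)
      {highest_root R P - \<gamma> | \<gamma>. \<gamma> \<in> inv_set R P (w_mu R P \<mu>)}"

definition I_max_cand :: "'a::euclidean_space set \<Rightarrow> 'a set \<Rightarrow> 'a \<Rightarrow> 'a set \<Rightarrow> bool" where
  "I_max_cand R P \<mu> I \<longleftrightarrow> I \<noteq> {} \<and> abelian_ideal R P I \<and> I \<inter> heis R P = I_min R P \<mu>"

definition I_max :: "'a::euclidean_space set \<Rightarrow> 'a set \<Rightarrow> 'a \<Rightarrow> 'a set" where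
  "I_max R P \<mu> = (THE I. I_max_cand R P \<mu> I \<and> (\<forall>J. I_max_cand R P \<mu> J \<and> I \<subseteq> J \<longrightarrow> J = I))"

section \<open>Dynkin diagram\<close>

text \<open>Two distinct simple roots are joined in the Dynkin diagram iff they are not orthogonal.\<close>
definition dynkin_connected :: "'a::euclidean_space set \<Rightarrow> bool" where
  "dynkin_connected T \<longleftrightarrow>
     (\<forall>a\<in>T. \<forall>b\<in>T. (a, b) \<in> {(x, y). x \<in> T \<and> y \<in> T \<and> x \<noteq> y \<and> x \<bullet> y \<noteq> 0}\<^sup>*)"

definition conn_hull :: "'a::euclidean_space set \<Rightarrow> 'a set \<Rightarrow> 'a set \<Rightarrow> 'a set" where
  "conn_hull R P S = (THE T. S \<subseteq> T \<and> T \<subseteq> long_simple R P \<and> dynkin_connected T \<and>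
      (\<forall>T'. S \<subseteq> T' \<and> T' \<subseteq> long_simple R P \<and> dynkin_connected T' \<longrightarrow> T \<subseteq> T'))"

text \<open>Type \<open>A_n\<close>: the Cartan matrix w.r.t. some ordering of the simple roots is that of \<open>A_n\<close>.\<close>
definition cartan :: "'a::euclidean_space \<Rightarrow> 'a \<Rightarrow> real" where
  "cartan \<alpha> \<beta> = 2 * (\<alpha> \<bullet> \<beta>) / (\<beta> \<bullet> \<beta>)"

definition type_A :: "'a::euclidean_space set \<Rightarrow> bool" where
  "type_A P \<longleftrightarrow> (\<exists>n\<ge>1. \<exists>f. bij_betw f {1..n::nat} P \<and>
     (\<forall>i\<in>{1..n}. \<forall>j\<in>{1..n}. cartan (f i) (f j) =
        (if i = j then 2 else if i = j + 1 \<or> j = i + 1 then -1 else 0)))"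

end

theory Submission
  imports Defs
begin

text \<open>
  The set \<open>conn_hull R P S\<close> is contained in every connected set of long simple roots that contains \<open>S\<close>,
  so (i) says that \<open>{\<alpha>. \<eta> \<in> I_min R P \<alpha>}\<close> is connected for every \<open>\<eta>\<close>, and (ii) that
  \<open>{\<alpha>. \<nu> \<notin> I_max R P \<alpha>}\<close> is connected for every \<open>\<nu>\<close>.

  For a root \<open>\<eta> \<noteq> \<theta>\<close> with \<open>\<eta> \<bullet> \<theta> > 0\<close> exactly one of \<open>\<eta>\<close>, \<open>\<theta> - \<eta>\<close> lies in \<open>I_min R P \<alpha>\<close>, and \<open>\<eta>\<close> does
  iff \<open>w_mu R P \<alpha>\<close> keeps it positive. For adjacent long simple \<open>x\<close>, \<open>y\<close> the elements \<open>w_mu R P x\<close> and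
  \<open>w_mu R P y\<close> differ by the factor \<open>refl x \<circ> refl y\<close>. Following \<open>\<eta>\<close> along an induced path, the image of \<open>\<eta>\<close> at
  the first vertex where it is negative is minus the preceding vertex, and from then on minus the sum of a
  segment of the path; hence the path never returns to \<open>{\<alpha>. \<eta> \<in> I_min R P \<alpha>}\<close>.

  The maximal ideal \<open>I_max R P \<alpha>\<close> consists of \<open>I_min R P \<alpha>\<close> and the positive roots \<open>\<nu>\<close> orthogonal to \<open>\<theta>\<close> such that
  \<open>\<nu> + \<eta>\<close> is no root for \<open>\<eta> \<in> I_min R P \<alpha>\<close>. Outside type A only one simple root is not orthogonal to \<open>\<theta>\<close>.
  Then the roots \<open>\<eta>\<close> with \<open>\<eta> \<bullet> \<theta> > 0\<close> and \<open>\<nu> + \<eta>\<close> a root have a least element, and the involution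
  \<open>\<eta> \<mapsto> \<theta> - \<nu> - \<eta>\<close> turns it into a greatest element \<open>\<mu>\<close>; so \<open>{\<alpha>. \<nu> \<notin> I_max R P \<alpha>}\<close> equals the connected set
  \<open>{\<alpha>. \<mu> \<in> I_min R P \<alpha>}\<close>.
\<close>

section \<open>Root systems and bases\<close>

lemma refl_cartan: "refl a v = v - cartan v a *\<^sub>R a"
  by (simp add: refl_def cartan_def)

lemma refl_refl [simp]: "refl a (refl a v) = v"
  by (cases "a = 0") (simp_all add: refl_def inner_diff_left)

lemma refl_uminus_left: "refl (- a) = refl a"
  by (auto simp: refl_def)

lemma refl_self: "a \<noteq> 0 \<Longrightarrow> refl a a = - a"
  by (simp add: refl_def scaleR_2)

lemma refl_orthogonal_vec: "v \<bullet> a = 0 \<Longrightarrow> refl a v = v"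
  by (simp add: refl_def)

lemma orthogonal_transformation_refl: "orthogonal_transformation (refl a)"
proof -
  have "linear (refl a)"
    unfolding linear_iff
    by (simp add: refl_def inner_add_left add_divide_distrib distrib_left scaleR_add_left scaleR_diff_right)
  moreover have "refl a u \<bullet> refl a v = u \<bullet> v" for u v
    by (cases "a = 0")
      (simp_all add: refl_def inner_diff_left inner_diff_right inner_commute field_simps)
  ultimately show ?thesis by (simp add: orthogonal_transformation_def)
qed

text \<open>Conjugation by \<open>w\<close> carries the reflection in \<open>a\<close> to the
  reflection in \<open>w a\<close>; with \<open>w\<close> on both sides no inverse has to be
  named.\<close>

lemma refl_conj:
  assumes "orthogonal_transformation w"
  shows "refl (w a) (w v) = w (refl a v)"
  using assms by (simp add: refl_def orthogonal_transformation_def linear_diff linear_scale)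

lemma refl_prod_Nil [simp]: "refl_prod [] = id"
  and refl_prod_Cons [simp]: "refl_prod (x # xs) = refl x \<circ> refl_prod xs"
  by (simp_all add: refl_prod_def)

lemma refl_prod_append: "refl_prod (xs @ ys) = refl_prod xs \<circ> refl_prod ys"
  by (induction xs) (simp_all add: comp_assoc)

lemma orthogonal_transformation_refl_prod: "orthogonal_transformation (refl_prod xs)"
proof (induction xs)
  case (Cons x xs)
  then show ?case
    using orthogonal_transformation_compose[OF orthogonal_transformation_refl, of "refl_prod xs" x] by (simp add: comp_def)
qed (simp add: id_def orthogonal_transformation_id)

lemma refl_prod_rev: "refl_prod (rev xs) (refl_prod xs v) = v"
  by (induction xs arbitrary: v) (simp_all add: refl_prod_append)

lemma nonneg_comb_add: "nonneg_comb B u \<Longrightarrow> nonneg_comb B v \<Longrightarrow> nonneg_comb B (u + v)"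
  unfolding nonneg_comb_def
proof (elim exE conjE)
  fix c d :: "'a \<Rightarrow> int"
  assume *: "\<forall>\<beta>\<in>B. 0 \<le> c \<beta>" "\<forall>\<beta>\<in>B. 0 \<le> d \<beta>"
    "u = (\<Sum>\<beta>\<in>B. of_int (c \<beta>) *\<^sub>R \<beta>)" "v = (\<Sum>\<beta>\<in>B. of_int (d \<beta>) *\<^sub>R \<beta>)"
  show "\<exists>c::'a \<Rightarrow> int. (\<forall>\<beta>\<in>B. 0 \<le> c \<beta>) \<and> u + v = (\<Sum>\<beta>\<in>B. of_int (c \<beta>) *\<^sub>R \<beta>)"
    using * by (intro exI[of _ "\<lambda>b. c b + d b"]) (auto simp: sum.distrib scaleR_add_left)
qed

section \<open>Coordinates in the basis of simple roots\<close>

locale based_root_system =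
  fixes R P :: "'a::euclidean_space set"
  assumes rrs: "reduced_root_system R" and ssys: "simple_system R P"
begin

abbreviation Rpos ("\<Phi>") where "\<Phi> \<equiv> pos_roots R P"
text \<open>Real coordinates turn \<open>nonneg_comb\<close> into a condition on each coefficient
  and make linearity available to the simplifier; \<open>representation\<close> is 0 outside
  \<open>P\<close>, so the linearity rules carry no side condition.\<close>

abbreviation cf :: "'a \<Rightarrow> 'a \<Rightarrow> real" where "cf \<equiv> representation P"

lemma finite_R: "finite R" and zero_notin_R: "0 \<notin> R" and span_R: "span R = UNIV"
  and refl_closed: "\<alpha> \<in> R \<Longrightarrow> \<beta> \<in> R \<Longrightarrow> refl \<alpha> \<beta> \<in> R"
  and cartan_Ints: "\<alpha> \<in> R \<Longrightarrow> \<beta> \<in> R \<Longrightarrow> cartan \<beta> \<alpha> \<in> \<int>"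
  and scale_root: "\<alpha> \<in> R \<Longrightarrow> c *\<^sub>R \<alpha> \<in> R \<Longrightarrow> c = 1 \<or> c = -1"
  using rrs unfolding reduced_root_system_def cartan_def by auto

lemma P_subset: "P \<subseteq> R" and indep: "independent P"
  and root_cases': "\<alpha> \<in> R \<Longrightarrow> nonneg_comb P \<alpha> \<or> nonneg_comb P (- \<alpha>)"
  using ssys unfolding simple_system_def by auto

lemma finite_P: "finite P"
  using P_subset finite_R finite_subset by blast

lemma inner_pos: "\<alpha> \<in> R \<Longrightarrow> \<alpha> \<bullet> \<alpha> > 0"
  using zero_notin_R by (metis inner_gt_zero_iff)

lemma uminus_root: "\<alpha> \<in> R \<Longrightarrow> - \<alpha> \<in> R"
  by (metis refl_closed refl_self zero_notin_R)

lemma span_P: "span P = UNIV"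
proof -
  have "nonneg_comb P v \<Longrightarrow> v \<in> span P" for v
    unfolding nonneg_comb_def by (auto intro!: span_sum span_scale intro: span_base)
  then have "R \<subseteq> span P" using root_cases' span_neg by fastforce
  then show ?thesis using span_R span_minimal[OF _ subspace_span, of R P] by auto
qed

lemma cf_add [simp]: "cf (u + v) b = cf u b + cf v b"
  and cf_diff [simp]: "cf (u - v) b = cf u b - cf v b"
  and cf_uminus [simp]: "cf (- v) b = - cf v b"
  and cf_scale [simp]: "cf (r *\<^sub>R v) b = r * cf v b"
  using indep span_P by (simp_all add: representation_add representation_diff representation_neg representation_scale)

lemma cf_zero [simp]: "cf 0 b = 0"
  by (simp add: representation_zero)

lemma cf_sum: "cf (sum f A) b = (\<Sum>i\<in>A. cf (f i) b)"
  using indep span_P by (simp add: representation_sum)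

lemma cf_basis: "a \<in> P \<Longrightarrow> cf a b = (if b = a then 1 else 0)"
  using indep by (simp add: representation_basis)

lemma cf_outside: "b \<notin> P \<Longrightarrow> cf v b = 0"
  using representation_ne_zero by metis

lemma cf_expand: "v = (\<Sum>b\<in>P. cf v b *\<^sub>R b)"
  using sum_representation_eq[OF indep _ finite_P order_refl, of v] span_P by simp

lemma inner_expand: "v \<bullet> x = (\<Sum>b\<in>P. cf v b * (b \<bullet> x))"
  by (subst cf_expand[of v]) (simp add: inner_sum_left)

lemma cf_eqI: "(\<And>b. b \<in> P \<Longrightarrow> cf u b = cf v b) \<Longrightarrow> u = v"
  by (subst cf_expand[of v], subst cf_expand[of u]) auto

lemma nonneg_iff: "nonneg_comb P v \<longleftrightarrow> (\<forall>b\<in>P. cf v b \<in> \<int> \<and> cf v b \<ge> 0)"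
proof
  assume "nonneg_comb P v"
  then obtain c :: "'a \<Rightarrow> int" where c: "\<forall>\<beta>\<in>P. c \<beta> \<ge> 0" "v = (\<Sum>\<beta>\<in>P. of_int (c \<beta>) *\<^sub>R \<beta>)"
    unfolding nonneg_comb_def by blast
  have "cf v b = of_int (c b)" if "b \<in> P" for b
  proof -
    have "cf v b = (\<Sum>\<beta>\<in>P. of_int (c \<beta>) * (if b = \<beta> then 1 else 0))"
      using c(2) by (simp add: cf_sum cf_basis cong: sum.cong)
    also have "\<dots> = of_int (c b)"
      using that finite_P by (simp add: sum.delta' if_distrib cong: if_cong)
    finally show ?thesis .
  qed
  then show "\<forall>b\<in>P. cf v b \<in> \<int> \<and> cf v b \<ge> 0" using c(1) by auto
next
  assume *: "\<forall>b\<in>P. cf v b \<in> \<int> \<and> cf v b \<ge> 0"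
  then have "\<forall>b\<in>P. of_int \<lfloor>cf v b\<rfloor> = cf v b" by (metis Ints_cases floor_of_int)
  then have "v = (\<Sum>\<beta>\<in>P. of_int \<lfloor>cf v \<beta>\<rfloor> *\<^sub>R \<beta>)"
    using cf_expand[of v] by (metis (mono_tags, lifting) sum.cong)
  then show "nonneg_comb P v" unfolding nonneg_comb_def
    using * by (intro exI[of _ "\<lambda>b. \<lfloor>cf v b\<rfloor>"]) auto
qed

lemma root_cf_Ints: "\<alpha> \<in> R \<Longrightarrow> cf \<alpha> b \<in> \<int>"
  using root_cases'[of \<alpha>] cf_outside[of b \<alpha>] unfolding nonneg_iff
  by (cases "b \<in> P") (auto simp: minus_in_Ints_iff)

lemma pos_R: "\<gamma> \<in> \<Phi> \<Longrightarrow> \<gamma> \<in> R" and pos_nonneg: "\<gamma> \<in> \<Phi> \<Longrightarrow> nonneg_comb P \<gamma>"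
  by (auto simp: pos_roots_def)

lemma pos_cf: "\<gamma> \<in> \<Phi> \<Longrightarrow> cf \<gamma> b \<ge> 0"
  using nonneg_iff[of \<gamma>] cf_outside[of b \<gamma>] unfolding pos_roots_def by force

lemma pos_ne_0: "\<gamma> \<in> \<Phi> \<Longrightarrow> \<gamma> \<noteq> 0"
  using pos_R zero_notin_R by blast

lemma pos_ex_cf: "\<gamma> \<in> \<Phi> \<Longrightarrow> \<exists>b\<in>P. cf \<gamma> b > 0"
  using cf_eqI[of \<gamma> 0] pos_cf pos_ne_0 by (force simp: less_le)

lemma root_cases: "\<alpha> \<in> R \<Longrightarrow> \<alpha> \<in> \<Phi> \<or> - \<alpha> \<in> \<Phi>"
  using root_cases' uminus_root by (auto simp: pos_roots_def)

text \<open>The coefficients of a root never have mixed signs, so one positive coefficient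
  decides.\<close>

lemma pos_if_cf: "\<alpha> \<in> R \<Longrightarrow> cf \<alpha> b > 0 \<Longrightarrow> \<alpha> \<in> \<Phi>"
  using root_cases[of \<alpha>] pos_cf[of "- \<alpha>" b] by auto

lemma pos_not_neg: "\<gamma> \<in> \<Phi> \<Longrightarrow> - \<gamma> \<notin> \<Phi>"
  using pos_ex_cf[of \<gamma>] pos_cf[of "- \<gamma>"] by (metis cf_uminus leD neg_0_le_iff_le)

lemma P_pos: "P \<subseteq> \<Phi>"
  using P_subset by (auto simp: cf_basis intro!: pos_if_cf[where b = "_"])

lemma pos_sum: "\<alpha> \<in> \<Phi> \<Longrightarrow> nonneg_comb P v \<Longrightarrow> \<alpha> + v \<in> R \<Longrightarrow> \<alpha> + v \<in> \<Phi>"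
  by (simp add: pos_roots_def nonneg_comb_add)

lemma pos_add: "\<alpha> \<in> \<Phi> \<Longrightarrow> \<beta> \<in> \<Phi> \<Longrightarrow> \<alpha> + \<beta> \<in> R \<Longrightarrow> \<alpha> + \<beta> \<in> \<Phi>"
  using pos_sum pos_nonneg by blast

lemma pos_add_ne_0: "\<alpha> \<in> \<Phi> \<Longrightarrow> \<beta> \<in> \<Phi> \<Longrightarrow> \<alpha> + \<beta> \<noteq> 0"
  using pos_not_neg by (metis add_eq_0_iff2)

text \<open>Away from \<open>\<sigma>\<close> both summands would have coefficient 0, so each would
  have an integral coefficient of at least 1 at \<open>\<sigma>\<close>, too much for a sum equal to
  \<open>\<sigma>\<close>. This indecomposability later separates \<open>\<eta>\<close> from
  \<open>\<theta> - \<eta>\<close> in the minimal ideals.\<close>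

lemma simple_not_sum:
  assumes "\<sigma> \<in> P" "\<alpha> \<in> \<Phi>" "\<beta> \<in> \<Phi>"
  shows "\<sigma> \<noteq> \<alpha> + \<beta>"
proof
  assume s: "\<sigma> = \<alpha> + \<beta>"
  have *: "cf \<alpha> b = 0 \<and> cf \<beta> b = 0" if "b \<noteq> \<sigma>" for b
    using cf_basis[OF assms(1), of b] that pos_cf[OF assms(2), of b] pos_cf[OF assms(3), of b] by (simp add: s)
  obtain a b where "a \<in> P" "cf \<alpha> a > 0" "b \<in> P" "cf \<beta> b > 0" using pos_ex_cf assms by blast
  with * have "cf \<alpha> \<sigma> > 0" "cf \<beta> \<sigma> > 0" by force+
  moreover have "cf \<alpha> \<sigma> \<in> \<int>" "cf \<beta> \<sigma> \<in> \<int>" using assms pos_R root_cf_Ints by auto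
  ultimately have "cf \<alpha> \<sigma> \<ge> 1" "cf \<beta> \<sigma> \<ge> 1"
    by (metis Ints_cases int_one_le_iff_zero_less of_int_0_less_iff of_int_1_le_iff)+
  then show False using cf_basis[OF assms(1), of \<sigma>] s cf_add[of \<alpha> \<beta> \<sigma>] by simp
qed

section \<open>Sums and differences of roots\<close>

lemma parallel_roots:
  assumes "\<alpha> \<in> R" "\<beta> \<in> R" "(\<alpha> \<bullet> \<beta>)\<^sup>2 = (\<alpha> \<bullet> \<alpha>) * (\<beta> \<bullet> \<beta>)"
  shows "\<alpha> = \<beta> \<or> \<alpha> = - \<beta>"
proof -
  have "\<alpha> = ((\<alpha> \<bullet> \<beta>) / (\<beta> \<bullet> \<beta>)) *\<^sub>R \<beta>" (is "_ = ?c *\<^sub>R _")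
  proof -
    have "(\<alpha> - ?c *\<^sub>R \<beta>) \<bullet> (\<alpha> - ?c *\<^sub>R \<beta>) = \<alpha> \<bullet> \<alpha> - (\<alpha> \<bullet> \<beta>)\<^sup>2 / (\<beta> \<bullet> \<beta>)"
      using inner_pos[OF assms(2)]
      by (simp add: inner_diff_left inner_diff_right inner_commute power2_eq_square field_simps)
    also have "\<dots> = 0" using inner_pos[OF assms(2)] assms(3) by simp
    finally show ?thesis by simp
  qed
  then show ?thesis using scale_root[OF assms(2), of ?c] assms(1) by (metis scaleR_minus1_left scaleR_one)
qed

lemma inner_sq_less:
  assumes "\<alpha> \<in> R" "\<beta> \<in> R" "\<alpha> \<noteq> \<beta>" "\<alpha> \<noteq> - \<beta>"
  shows "(\<alpha> \<bullet> \<beta>)\<^sup>2 < (\<alpha> \<bullet> \<alpha>) * (\<beta> \<bullet> \<beta>)"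
  using parallel_roots[OF assms(1,2)] assms(3,4) Cauchy_Schwarz_ineq[of \<alpha> \<beta>] by fastforce

lemma cartan_prod_less:
  assumes "\<alpha> \<in> R" "\<beta> \<in> R" "\<alpha> \<noteq> \<beta>" "\<alpha> \<noteq> - \<beta>"
  shows "cartan \<alpha> \<beta> * cartan \<beta> \<alpha> < 4"
  using inner_sq_less[OF assms] inner_pos[OF assms(1)] inner_pos[OF assms(2)]
  by (simp add: cartan_def inner_commute power2_eq_square divide_simps mult.commute)

text \<open>The two Cartan integers are negative with product below 4, so one of them is -1, and the
  corresponding reflection yields the sum.\<close>

lemma root_add:
  assumes "\<alpha> \<in> R" "\<beta> \<in> R" "\<alpha> \<bullet> \<beta> < 0" "\<alpha> + \<beta> \<noteq> 0"
  shows "\<alpha> + \<beta> \<in> R"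
proof -
  have "\<alpha> \<noteq> \<beta>" using assms(3) inner_ge_zero[of \<beta>] by force
  moreover have "\<alpha> \<noteq> - \<beta>" using assms(4) by (simp add: eq_neg_iff_add_eq_0)
  ultimately have ne: "\<alpha> \<noteq> \<beta>" "\<alpha> \<noteq> - \<beta>" .
  obtain m n :: int where mn: "cartan \<alpha> \<beta> = of_int m" "cartan \<beta> \<alpha> = of_int n"
    using cartan_Ints assms by (metis Ints_cases)
  have "real_of_int m < 0" "real_of_int n < 0" unfolding mn[symmetric] cartan_def
    using assms(3) inner_pos[OF assms(1)] inner_pos[OF assms(2)] by (simp_all add: inner_commute divide_less_0_iff)
  then have "m < 0" "n < 0" by simp_all
  moreover have "m * n < 4"
    using cartan_prod_less[OF assms(1,2) ne] mn by (metis of_int_less_iff of_int_mult of_int_numeral)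
  moreover have "m \<le> -2 \<Longrightarrow> n \<le> -2 \<Longrightarrow> m * n \<ge> 4"
    using mult_mono[of 2 "-m" 2 "-n"] by simp
  ultimately have "m = -1 \<or> n = -1" by linarith
  then show ?thesis
  proof
    assume "m = -1"
    then show ?thesis using refl_closed[OF assms(2,1)] mn by (simp add: refl_cartan)
  next
    assume "n = -1"
    then show ?thesis using refl_closed[OF assms(1,2)] mn by (simp add: refl_cartan add.commute)
  qed
qed

lemma root_diff:
  assumes "\<alpha> \<in> R" "\<beta> \<in> R" "\<alpha> \<bullet> \<beta> > 0" "\<alpha> \<noteq> \<beta>"
  shows "\<alpha> - \<beta> \<in> R"
  using root_add[of \<alpha> "- \<beta>"] assms uminus_root by auto

text \<open>A substitute for the Jacobi identity. If both sums failed to be roots, \<open>c\<close>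
  would pair nonnegatively with \<open>a\<close> and \<open>b\<close>, while the total would pair
  nonpositively with both; its product with \<open>a + b\<close> would then be nonpositive and yet
  at least \<open>(a + b) \<bullet> (a + b)\<close>.\<close>

lemma root_triple:
  assumes "a \<in> R" "b \<in> R" "c \<in> R" "a + b \<in> R" "a + b + c \<in> R" "a + c \<noteq> 0" "b + c \<noteq> 0"
  shows "a + c \<in> R \<or> b + c \<in> R"
proof (rule ccontr)
  assume no: "\<not> ?thesis"
  let ?s = "a + b + c"
  have ac: "a \<bullet> c \<ge> 0" "b \<bullet> c \<ge> 0"
    using root_add[of a c] root_add[of b c] assms no by force+
  have "?s \<bullet> a \<le> 0"
  proof (rule ccontr)
    assume "\<not> ?s \<bullet> a \<le> 0"
    moreover have "?s - a = b + c" by simp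
    ultimately show False using root_diff[of ?s a] assms no by force
  qed
  moreover have "?s \<bullet> b \<le> 0"
  proof (rule ccontr)
    assume "\<not> ?s \<bullet> b \<le> 0"
    moreover have "?s - b = a + c" by simp
    ultimately show False using root_diff[of ?s b] assms no by force
  qed
  ultimately have "?s \<bullet> (a + b) \<le> 0" by (simp add: inner_add_right)
  moreover have "?s \<bullet> (a + b) = (a + b) \<bullet> (a + b) + a \<bullet> c + b \<bullet> c"
    by (simp add: inner_add_left inner_add_right inner_commute)
  ultimately show False using ac inner_pos[OF assms(4)] by linarith
qed

text \<open>Otherwise \<open>x - y\<close> would be a root with coefficients of both signs.\<close>

lemma simple_inner_le_0:
  assumes "x \<in> P" "y \<in> P" "x \<noteq> y"
  shows "x \<bullet> y \<le> 0"
proof (rule ccontr)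
  assume "\<not> x \<bullet> y \<le> 0"
  then have r: "x - y \<in> R" using root_diff[of x y] assms P_subset by auto
  have "cf (x - y) x > 0" "cf (y - x) y > 0" using assms by (auto simp: cf_basis)
  moreover have "y - x \<in> R" using uminus_root[OF r] by simp
  ultimately show False using pos_if_cf[OF r] pos_if_cf[of "y - x"] pos_not_neg[of "x - y"] by simp
qed

section \<open>Height and descent along simple roots\<close>

definition ht :: "'a \<Rightarrow> real" where "ht v = (\<Sum>b\<in>P. cf v b)"

lemma ht_add [simp]: "ht (u + v) = ht u + ht v" and ht_diff [simp]: "ht (u - v) = ht u - ht v"
  and ht_uminus [simp]: "ht (- v) = - ht v" and ht_scale [simp]: "ht (r *\<^sub>R v) = r * ht v"
  by (simp_all add: ht_def sum.distrib sum_subtractf sum_negf sum_distrib_left)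

lemma ht_simple: "\<sigma> \<in> P \<Longrightarrow> ht \<sigma> = 1"
  using finite_P by (simp add: ht_def cf_basis)

lemma nonneg_ht: "nonneg_comb P v \<Longrightarrow> ht v \<ge> 0"
  by (simp add: ht_def nonneg_iff sum_nonneg)

lemma nonneg_ht_0: "nonneg_comb P v \<Longrightarrow> ht v = 0 \<Longrightarrow> v = 0"
  using finite_P by (intro cf_eqI) (auto simp: ht_def nonneg_iff sum_nonneg_eq_0_iff)

lemma pos_ht: "\<gamma> \<in> \<Phi> \<Longrightarrow> ht \<gamma> > 0"
  using nonneg_ht[of \<gamma>] nonneg_ht_0[of \<gamma>] pos_nonneg pos_ne_0 by fastforce

lemma nonneg_ht_Nats: "nonneg_comb P v \<Longrightarrow> of_int \<lfloor>ht v\<rfloor> = ht v"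
proof -
  assume "nonneg_comb P v"
  then have "ht v \<in> \<int>" unfolding ht_def nonneg_iff by (intro Ints_sum) auto
  then show ?thesis by (metis Ints_cases floor_of_int)
qed

text \<open>Heights are defined as real numbers but are integers on positive roots, so the floor
  supplies a well-founded measure.\<close>

lemma pos_ht_induct [consumes 1, case_names less]:
  assumes "\<gamma> \<in> \<Phi>"
    and step: "\<And>\<gamma>. \<gamma> \<in> \<Phi> \<Longrightarrow> (\<And>\<gamma>'. \<gamma>' \<in> \<Phi> \<Longrightarrow> ht \<gamma>' < ht \<gamma> \<Longrightarrow> Q \<gamma>') \<Longrightarrow> Q \<gamma>"
  shows "Q \<gamma>"
  using assms(1)
proof (induction "nat \<lfloor>ht \<gamma>\<rfloor>" arbitrary: \<gamma> rule: less_induct)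
  case less
  show ?case
  proof (rule step[OF less.prems])
    fix \<gamma>' assume g: "\<gamma>' \<in> \<Phi>" "ht \<gamma>' < ht \<gamma>"
    have "nat \<lfloor>ht \<gamma>'\<rfloor> < nat \<lfloor>ht \<gamma>\<rfloor>"
      using g(2) nonneg_ht_Nats[OF pos_nonneg[OF g(1)]] nonneg_ht_Nats[OF pos_nonneg[OF less.prems]]
        pos_ht[OF g(1)] pos_ht[OF less.prems] by linarith
    then show "Q \<gamma>'" using less.hyps g(1) by blast
  qed
qed

text \<open>Some summand in the expansion of \<open>\<gamma> \<bullet> \<gamma>\<close> over the
  simple roots must be positive.\<close>

lemma pos_ex_simple:
  assumes "\<gamma> \<in> \<Phi>"
  shows "\<exists>\<sigma>\<in>P. \<gamma> \<bullet> \<sigma> > 0 \<and> cf \<gamma> \<sigma> > 0"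
proof (rule ccontr)
  assume "\<not> ?thesis"
  then have "cf \<gamma> b * (b \<bullet> \<gamma>) \<le> 0" if "b \<in> P" for b
    using that pos_cf[OF assms, of b] by (cases "cf \<gamma> b = 0") (force simp: inner_commute mult_le_0_iff)+
  then have "\<gamma> \<bullet> \<gamma> \<le> 0" by (subst inner_expand) (rule sum_nonpos)
  then show False using inner_pos[OF pos_R[OF assms]] by simp
qed

lemma pos_diff_simple:
  assumes "\<gamma> \<in> \<Phi>" "\<sigma> \<in> P" "\<gamma> \<noteq> \<sigma>" "\<gamma> - \<sigma> \<in> R"
  shows "\<gamma> - \<sigma> \<in> \<Phi>"
proof (rule ccontr)
  assume "\<gamma> - \<sigma> \<notin> \<Phi>"
  then have "\<sigma> - \<gamma> \<in> \<Phi>" using root_cases[OF assms(4)] by simp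
  then show False using simple_not_sum[OF assms(2) assms(1), of "\<sigma> - \<gamma>"] by simp
qed

lemma pos_other_cf:
  assumes "\<gamma> \<in> \<Phi>" "\<sigma> \<in> P" "\<gamma> \<noteq> \<sigma>"
  shows "\<exists>b\<in>P. b \<noteq> \<sigma> \<and> cf \<gamma> b > 0"
proof (rule ccontr)
  assume "\<not> ?thesis"
  then have "\<And>b. b \<in> P \<Longrightarrow> b \<noteq> \<sigma> \<Longrightarrow> cf \<gamma> b = 0" using pos_cf[OF assms(1)] by (metis less_eq_real_def)
  then have "\<gamma> = cf \<gamma> \<sigma> *\<^sub>R \<sigma>" using assms(2) by (intro cf_eqI) (simp add: cf_basis)
  then have "cf \<gamma> \<sigma> = 1 \<or> cf \<gamma> \<sigma> = -1"
    using scale_root[of \<sigma> "cf \<gamma> \<sigma>"] assms P_subset pos_R by auto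
  then show False using \<open>\<gamma> = _\<close> pos_cf[OF assms(1), of \<sigma>] assms(3) by auto
qed

text \<open>Only the coefficient at \<open>\<sigma>\<close> changes, and some other coefficient is
  positive because the system is reduced.\<close>

lemma refl_simple_pos:
  assumes "\<gamma> \<in> \<Phi>" "\<sigma> \<in> P" "\<gamma> \<noteq> \<sigma>"
  shows "refl \<sigma> \<gamma> \<in> \<Phi>"
proof -
  obtain b where b: "b \<in> P" "b \<noteq> \<sigma>" "cf \<gamma> b > 0" using pos_other_cf[OF assms] by blast
  then have "cf (refl \<sigma> \<gamma>) b > 0" using assms(2) by (simp add: refl_cartan cf_basis)
  then show ?thesis using pos_if_cf refl_closed assms P_subset pos_R by blast
qed

lemma refl_simple_neg:
  assumes "\<gamma> \<in> \<Phi>" "\<sigma> \<in> P" "refl \<sigma> \<gamma> \<notin> \<Phi>"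
  shows "\<gamma> = \<sigma>"
  using refl_simple_pos assms by blast

lemma pos_descend:
  assumes "\<gamma> \<in> \<Phi>" "\<gamma> \<notin> P"
  obtains \<sigma> where "\<sigma> \<in> P" "\<gamma> \<bullet> \<sigma> > 0" "\<gamma> - \<sigma> \<in> \<Phi>" "ht (\<gamma> - \<sigma>) < ht \<gamma>"
proof -
  obtain \<sigma> where s: "\<sigma> \<in> P" "\<gamma> \<bullet> \<sigma> > 0" using pos_ex_simple assms(1) by blast
  then have "\<gamma> - \<sigma> \<in> \<Phi>" using pos_diff_simple[OF assms(1) s(1)] root_diff[of \<gamma> \<sigma>] assms P_subset pos_R by blast
  then show ?thesis using that s ht_simple by simp
qed

text \<open>Any two comparable positive roots are joined by a chain of positive roots in which
  consecutive members differ by a simple root.\<close>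
lemma upper_ideal_mono:
  assumes I: "upper_ideal R P I" and "\<eta> \<in> I" "\<eta>' \<in> \<Phi>" "nonneg_comb P (\<eta>' - \<eta>)"
  shows "\<eta>' \<in> I"
  using assms(2-)
proof (induction "nat \<lfloor>ht (\<eta>' - \<eta>)\<rfloor>" arbitrary: \<eta> \<eta>' rule: less_induct)
  case less
  have eta: "\<eta> \<in> \<Phi>" using I less.prems(1) by (auto simp: upper_ideal_def)
  let ?d = "\<eta>' - \<eta>"
  show ?case
  proof (cases "?d = 0")
    case False
    \<comment> \<open>The expansion of \<open>?d \<bullet> ?d\<close> provides a simple root that
      can be taken away from the gap.\<close>
    have "\<exists>\<sigma>\<in>P. ?d \<bullet> \<sigma> > 0 \<and> cf ?d \<sigma> > 0"
    proof (rule ccontr)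
      assume no: "\<not> ?thesis"
      have "cf ?d b * (b \<bullet> ?d) \<le> 0" if "b \<in> P" for b
      proof (cases "cf ?d b = 0")
        case False
        then have "cf ?d b > 0" using less.prems(3) that unfolding nonneg_iff by (auto simp: less_le)
        then show ?thesis using no that by (metis inner_commute linorder_not_le mult_le_0_iff less_eq_real_def)
      qed simp
      then have "?d \<bullet> ?d \<le> 0" by (subst inner_expand) (rule sum_nonpos)
      then show False using False by (metis inner_gt_zero_iff linorder_not_le)
    qed
    then obtain \<sigma> where s: "\<sigma> \<in> P" "?d \<bullet> \<sigma> > 0" "cf ?d \<sigma> > 0" by blast
    have sub: "nonneg_comb P (?d - \<sigma>)"
      unfolding nonneg_iff
    proof
      fix b assume b: "b \<in> P"
      have db: "cf ?d b \<in> \<int>" "cf ?d b \<ge> 0" using less.prems(3) b unfolding nonneg_iff by blast+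
      have "cf ?d \<sigma> \<in> \<int>" using less.prems(3) s(1) unfolding nonneg_iff by blast
      then have "cf ?d \<sigma> \<ge> 1" using s(3)
        by (metis Ints_cases int_one_le_iff_zero_less of_int_0_less_iff of_int_1_le_iff)
      then show "cf (?d - \<sigma>) b \<in> \<int> \<and> cf (?d - \<sigma>) b \<ge> 0"
        using db s(1) cf_diff[of ?d \<sigma> b] by (auto simp: cf_basis simp del: cf_diff)
    qed
    have dec: "nat \<lfloor>ht (?d - \<sigma>)\<rfloor> < nat \<lfloor>ht ?d\<rfloor>"
      using nonneg_ht_Nats[OF less.prems(3)] nonneg_ht_Nats[OF sub] nonneg_ht[OF sub] ht_simple[OF s(1)]
        ht_diff[of ?d \<sigma>] by linarith
    \<comment> \<open>According to the sign, the gap shrinks by lowering its upper end or by raising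
      its lower end.\<close>
    have "\<eta>' \<bullet> \<sigma> > 0 \<or> \<eta> \<bullet> \<sigma> < 0" using s(2) by (auto simp: inner_diff_left)
    then show ?thesis
    proof
      assume a: "\<eta>' \<bullet> \<sigma> > 0"
      have "\<eta>' \<noteq> \<sigma>"
      proof
        assume "\<eta>' = \<sigma>"
        then have n: "nonneg_comb P (- \<eta>)" using sub by simp
        then show False using pos_not_neg[OF eta] pos_R[OF eta] by (simp add: pos_roots_def uminus_root)
      qed
      then have p: "\<eta>' - \<sigma> \<in> \<Phi>"
        using pos_diff_simple less.prems(2) s(1) root_diff[of \<eta>' \<sigma>] a P_subset pos_R by blast
      have e: "\<eta>' - \<sigma> - \<eta> = ?d - \<sigma>" by simp
      have "\<eta>' - \<sigma> \<in> I" using less.hyps[of "\<eta>' - \<sigma>" \<eta>] less.prems(1) p dec sub unfolding e by blast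
      then show ?thesis using I less.prems(2) s(1) P_pos unfolding upper_ideal_def
        by (metis add_diff_cancel_left' add_diff_eq subsetD)
    next
      assume a: "\<eta> \<bullet> \<sigma> < 0"
      have p: "\<sigma> + \<eta> \<in> \<Phi>"
        using pos_add[of \<sigma> \<eta>] root_add[of \<sigma> \<eta>] a s(1) eta P_pos pos_R pos_add_ne_0 by (metis inner_commute subsetD)
      then have i: "\<sigma> + \<eta> \<in> I" using I less.prems(1) s(1) P_pos unfolding upper_ideal_def by blast
      have e: "\<eta>' - (\<sigma> + \<eta>) = ?d - \<sigma>" by simp
      show ?thesis using less.hyps[of \<eta>' "\<sigma> + \<eta>"] i less.prems(2) dec sub unfolding e by blast
    qed
  qed (use less.prems in simp)
qed

end

section \<open>Dynkin diagrams\<close>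

lemma finite_arg_max:
  fixes f :: "'b \<Rightarrow> 'c::linorder"
  assumes "finite A" "a \<in> A"
  obtains x where "x \<in> A" "\<And>y. y \<in> A \<Longrightarrow> f y \<le> f x"
proof -
  have "Max (f ` A) \<in> f ` A" using assms by (intro Max_in) auto
  then obtain x where "x \<in> A" "f x = Max (f ` A)" by auto
  then show ?thesis using that[of x] assms(1) by simp
qed

text \<open>The set of vertices reachable from one vertex is a cut without edges across unless it is
  everything. The form by cuts suits unions, intersections and supports better than reachability
  does.\<close>

lemma dynkin_connected_iff:
  "dynkin_connected T \<longleftrightarrow> (\<forall>A\<subseteq>T. A \<noteq> {} \<longrightarrow> A \<noteq> T \<longrightarrow> (\<exists>x\<in>A. \<exists>y\<in>T - A. x \<bullet> y \<noteq> 0))"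
  (is "_ \<longleftrightarrow> ?cut")
proof -
  let ?E = "{(x, y). x \<in> T \<and> y \<in> T \<and> x \<noteq> y \<and> x \<bullet> y \<noteq> 0}"
  show ?thesis
  proof
    assume conn: "dynkin_connected T"
    show ?cut
    proof (intro allI impI, rule ccontr)
      fix A assume A: "A \<subseteq> T" "A \<noteq> {}" "A \<noteq> T" and no: "\<not> (\<exists>x\<in>A. \<exists>y\<in>T - A. x \<bullet> y \<noteq> 0)"
      obtain a b where ab: "a \<in> A" "b \<in> T" "b \<notin> A" using A by blast
      then have "(a, b) \<in> ?E\<^sup>*" using conn A unfolding dynkin_connected_def by blast
      then have "b \<in> A"
        by (induction rule: rtrancl_induct) (use ab no in blast)+
      then show False using ab by blast
    qed
  next
    assume cut: ?cut
    show "dynkin_connected T"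
      unfolding dynkin_connected_def
    proof (intro ballI)
      fix a b assume ab: "a \<in> T" "b \<in> T"
      let ?A = "{x \<in> T. (a, x) \<in> ?E\<^sup>*}"
      have "?A = T"
      proof (rule ccontr)
        assume "?A \<noteq> T"
        moreover have "?A \<noteq> {}" using ab by blast
        ultimately obtain x y where xy: "x \<in> ?A" "y \<in> T - ?A" "x \<bullet> y \<noteq> 0"
          using cut[rule_format, of ?A] by blast
        then have "(x, y) \<in> ?E" by auto
        then have "y \<in> ?A" using xy by (auto intro: rtrancl_into_rtrancl)
        then show False using xy by blast
      qed
      then show "(a, b) \<in> ?E\<^sup>*" using ab by blast
    qed
  qed
qed

lemma dynkin_connected_cut:
  assumes "dynkin_connected T" "A \<subseteq> T" "a \<in> A" "b \<in> T" "b \<notin> A"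
  obtains x y where "x \<in> A" "y \<in> T" "y \<notin> A" "x \<bullet> y \<noteq> 0"
  using assms unfolding dynkin_connected_iff by (metis DiffE equals0D)

lemma dynkin_connected_empty [simp]: "dynkin_connected {}"
  and dynkin_connected_singleton [simp]: "dynkin_connected {x}"
  by (auto simp: dynkin_connected_def)

lemma dynkin_connected_Un:
  assumes "dynkin_connected A" "dynkin_connected B" "a \<in> A" "b \<in> B" "a = b \<or> a \<bullet> b \<noteq> 0"
  shows "dynkin_connected (A \<union> B)"
  unfolding dynkin_connected_iff
proof (intro allI impI)
  fix X assume X: "X \<subseteq> A \<union> B" "X \<noteq> {}" "X \<noteq> A \<union> B"
  have *: "\<exists>x\<in>X. \<exists>y\<in>A \<union> B - X. x \<bullet> y \<noteq> 0"
    if U: "dynkin_connected U" "U \<subseteq> A \<union> B" "X \<inter> U \<noteq> {}" "\<not> U \<subseteq> X" for U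
  proof -
    obtain p q where "p \<in> X \<inter> U" "q \<in> U" "q \<notin> X \<inter> U" using U by blast
    then obtain x y where "x \<in> X \<inter> U" "y \<in> U" "y \<notin> X \<inter> U" "x \<bullet> y \<noteq> 0"
      using dynkin_connected_cut[OF U(1), of "X \<inter> U"] by blast
    then show ?thesis using U(2) by blast
  qed
  \<comment> \<open>Either the cut separates \<open>A\<close> from \<open>B\<close>, and the edge
    from \<open>a\<close> to \<open>b\<close> crosses it, or it splits one of the two connected
    sets.\<close>
  consider "A \<subseteq> X" "X \<inter> B = {}" | "B \<subseteq> X" "X \<inter> A = {}"
    | "X \<inter> A \<noteq> {}" "\<not> A \<subseteq> X" | "X \<inter> B \<noteq> {}" "\<not> B \<subseteq> X"
    using X by blast
  then show "\<exists>x\<in>X. \<exists>y\<in>A \<union> B - X. x \<bullet> y \<noteq> 0"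
  proof cases
    case 1
    then show ?thesis using assms(3-5) by blast
  next
    case 2
    then show ?thesis using assms(3-5) by (metis Diff_iff IntI UnI1 disjoint_iff inner_commute subsetD)
  qed (use * assms(1,2) in auto)
qed

section \<open>Connected sets of simple roots and supports of roots\<close>

context based_root_system
begin

lemma cf_sum_set: "C \<subseteq> P \<Longrightarrow> cf (\<Sum>C) b = (if b \<in> C then 1 else 0)"
proof -
  assume C: "C \<subseteq> P"
  have "cf (\<Sum>C) b = (\<Sum>c\<in>C. if b = c then 1 else 0)"
    using C by (simp add: cf_sum cf_basis subset_iff)
  then show ?thesis using finite_subset[OF C finite_P] by simp
qed

lemma sum_inner_neg:
  assumes "\<And>b. b \<in> P \<Longrightarrow> cf v b \<ge> 0" "\<And>b. b \<in> P \<Longrightarrow> cf v b \<noteq> 0 \<Longrightarrow> b \<bullet> x \<le> 0"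
    and "b \<in> P" "cf v b \<noteq> 0" "b \<bullet> x \<noteq> 0"
  shows "v \<bullet> x < 0"
proof -
  have le: "cf v b * (b \<bullet> x) \<le> 0" if "b \<in> P" for b
    using assms(1,2)[OF that] by (cases "cf v b = 0") (auto simp: mult_le_0_iff)
  have "cf v b * (b \<bullet> x) < 0"
    using assms(1)[OF assms(3)] assms(2)[OF assms(3,4)] assms(4,5) by (auto simp: mult_less_0_iff)
  then show ?thesis
    unfolding inner_expand[of v] using sum_strict_mono_ex1[of P "\<lambda>b. cf v b * (b \<bullet> x)" "\<lambda>_. 0"] le finite_P assms(3)
    by auto
qed

text \<open>A largest subset \<open>D\<close> of \<open>C\<close> whose sum is a root is all of
  \<open>C\<close>: otherwise some \<open>y\<close> in \<open>C\<close> outside \<open>D\<close> is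
  adjacent to \<open>D\<close>, pairs negatively with \<open>\<Sum>D\<close>, and can be
  added.\<close>

lemma sum_connected_root:
  assumes "C \<subseteq> P" "dynkin_connected C" "C \<noteq> {}"
  shows "\<Sum>C \<in> \<Phi>"
proof -
  have finC: "finite C" using assms(1) finite_P finite_subset by blast
  let ?F = "{D. D \<subseteq> C \<and> D \<noteq> {} \<and> \<Sum>D \<in> R}"
  obtain a where a: "a \<in> C" using assms by blast
  then have aF: "{a} \<in> ?F" using assms(1) P_subset by auto
  have finF: "finite ?F" using finC by simp
  obtain D where D: "D \<in> ?F" "\<And>D'. D' \<in> ?F \<Longrightarrow> card D' \<le> card D"
    by (rule finite_arg_max[OF finF aF, of card]) blast
  have "D = C"
  proof (rule ccontr)
    assume "D \<noteq> C"
    then obtain x y where xy: "x \<in> D" "y \<in> C" "y \<notin> D" "x \<bullet> y \<noteq> 0"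
      using dynkin_connected_cut[OF assms(2), of D] D(1) by blast
    have DP: "D \<subseteq> P" using D(1) assms(1) by blast
    have "\<Sum>D \<bullet> y < 0"
    proof (rule sum_inner_neg)
      show "b \<bullet> y \<le> 0" if "cf (\<Sum>D) b \<noteq> 0" for b
        using that simple_inner_le_0[of b y] xy DP assms(1) by (auto simp: cf_sum_set split: if_splits)
    qed (use xy DP in \<open>auto simp: cf_sum_set\<close>)
    moreover have "cf (\<Sum>D + y) y > 0"
      using DP xy assms(1) by (auto simp: cf_sum_set cf_basis)
    then have "\<Sum>D + y \<noteq> 0" using cf_zero[of y] by (metis less_irrefl)
    ultimately have "\<Sum>D + y \<in> R" using root_add[of "\<Sum>D" y] D(1) xy assms(1) P_subset by blast
    then have "insert y D \<in> ?F" using xy D(1) finite_subset[OF _ finC, of D] by (simp add: add.commute)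
    then show False using D(2)[of "insert y D"] xy D(1) finite_subset[OF _ finC, of D] by auto
  qed
  then have "\<Sum>C \<in> R" using D(1) by simp
  moreover have "cf (\<Sum>C) a > 0" using a assms(1) by (simp add: cf_sum_set)
  ultimately show ?thesis using pos_if_cf by blast
qed

text \<open>Two adjacent simple roots form an angle of at least 120 degrees, so the sum of the unit
  vectors of a set of simple roots in which each root has two neighbours would have norm zero.\<close>
lemma forest:
  assumes "C \<subseteq> P" "C \<noteq> {}"
  shows "\<exists>x\<in>C. \<forall>y\<in>C - {x}. \<forall>z\<in>C - {x}. x \<bullet> y \<noteq> 0 \<longrightarrow> x \<bullet> z \<noteq> 0 \<longrightarrow> y = z"
proof (rule ccontr)
  assume no: "\<not> ?thesis"
  have finC: "finite C" using assms(1) finite_P finite_subset by blast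
  define u where "u x = (1 / norm x) *\<^sub>R x" for x :: 'a
  have norm_pos: "norm x > 0" if "x \<in> C" for x using that assms(1) P_subset zero_notin_R by auto
  have uu: "u x \<bullet> u x = 1" if "x \<in> C" for x
    using norm_pos[OF that] by (simp add: u_def dot_square_norm power2_eq_square)
  have uxy: "u x \<bullet> u y \<le> 0" "x \<bullet> y \<noteq> 0 \<Longrightarrow> u x \<bullet> u y \<le> -1/2"
    if xy: "x \<in> C" "y \<in> C" "x \<noteq> y" for x y
  proof -
    have le: "x \<bullet> y \<le> 0" using simple_inner_le_0 xy assms(1) by blast
    then show le': "u x \<bullet> u y \<le> 0" by (simp add: u_def divide_nonpos_nonneg)
    assume ne: "x \<bullet> y \<noteq> 0"
    have R: "x \<in> R" "y \<in> R" using xy assms(1) P_subset by auto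
    obtain m n :: int where mn: "cartan x y = of_int m" "cartan y x = of_int n"
      using cartan_Ints R by (metis Ints_cases)
    have "real_of_int m < 0" "real_of_int n < 0" unfolding mn[symmetric] cartan_def
      using le ne inner_pos[OF R(1)] inner_pos[OF R(2)] by (auto simp: inner_commute divide_less_0_iff)
    then have "m \<le> -1" "n \<le> -1" by linarith+
    then have "m * n \<ge> 1" using mult_mono[of 1 "-m" 1 "-n"] by simp
    then have "cartan x y * cartan y x \<ge> 1" unfolding mn by (metis of_int_1_le_iff of_int_mult)
    \<comment> \<open>The product of the two Cartan integers is four times the squared cosine, so
      the cosine is at most -1/2.\<close>
    moreover have "cartan x y * cartan y x = 4 * (u x \<bullet> u y)\<^sup>2"
      using norm_pos[OF xy(1)] norm_pos[OF xy(2)]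
      by (simp add: cartan_def u_def dot_square_norm inner_commute power2_eq_square)
    ultimately have "(1/2)\<^sup>2 \<le> (- (u x \<bullet> u y))\<^sup>2" by (simp add: power2_eq_square)
    then have "1/2 \<le> - (u x \<bullet> u y)" by (rule power2_le_imp_le) (use le' in simp)
    then show "u x \<bullet> u y \<le> -1/2" by simp
  qed
  let ?v = "\<Sum>x\<in>C. u x"
  have "u x \<bullet> ?v \<le> 0" if x: "x \<in> C" for x
  proof -
    obtain y z where yz: "y \<in> C - {x}" "z \<in> C - {x}" "x \<bullet> y \<noteq> 0" "x \<bullet> z \<noteq> 0" "y \<noteq> z" using no x by blast
    have "u x \<bullet> ?v = (\<Sum>w\<in>C. u x \<bullet> u w)" by (rule inner_sum_right)
    also have "\<dots> = (\<Sum>w\<in>{x,y,z}. u x \<bullet> u w) + (\<Sum>w\<in>C - {x,y,z}. u x \<bullet> u w)"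
      by (rule sum.subset_diff[THEN trans, OF _ finC add.commute]) (use yz x in auto)
    also have "\<dots> \<le> 0 + 0"
    proof (rule add_mono)
      \<comment> \<open>The two neighbours together contribute at most -1 and cancel
        \<open>u x \<bullet> u x\<close>.\<close>
      show "(\<Sum>w\<in>{x,y,z}. u x \<bullet> u w) \<le> 0"
        using yz uu[OF x] uxy(2)[of x y] uxy(2)[of x z] x by auto
      show "(\<Sum>w\<in>C - {x,y,z}. u x \<bullet> u w) \<le> 0"
        using uxy(1) x by (intro sum_nonpos) auto
    qed
    finally show ?thesis by simp
  qed
  then have "?v \<bullet> ?v \<le> 0" by (simp add: inner_sum_left sum_nonpos)
  then have v0: "?v = 0" by (metis inner_gt_zero_iff linorder_not_le)
  obtain a where a: "a \<in> C" using assms by blast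
  have "cf ?v a = (\<Sum>x\<in>C. (1 / norm x) * (if a = x then 1 else 0))"
    using assms(1) by (auto simp: cf_sum u_def cf_basis intro!: sum.cong)
  also have "\<dots> = 1 / norm a" using a finC by (simp add: if_distrib cong: if_cong)
  finally show False using v0 norm_pos[OF a] by simp
qed

text \<open>The diagram is a forest, so \<open>A \<union> B\<close> has a vertex \<open>x\<close>
  with at most one neighbour in it, and the induction applies after removing \<open>x\<close>. If
  \<open>x\<close> lies in the intersection together with another vertex, its only neighbour lies in
  both sets and ties \<open>x\<close> to the rest.\<close>

lemma dynkin_connected_Int:
  assumes "A \<subseteq> P" "B \<subseteq> P" "dynkin_connected A" "dynkin_connected B"
  shows "dynkin_connected (A \<inter> B)"
  using assms
proof (induction "card (A \<union> B)" arbitrary: A B rule: less_induct)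
  case less
  let ?U = "A \<union> B"
  have finU: "finite ?U" using less.prems finite_P by (meson finite_subset finite_UnI)
  show ?case
  proof (cases "?U = {}")
    case False
    then obtain x where x: "x \<in> ?U"
      and leaf: "\<And>y z. y \<in> ?U - {x} \<Longrightarrow> z \<in> ?U - {x} \<Longrightarrow> x \<bullet> y \<noteq> 0 \<Longrightarrow> x \<bullet> z \<noteq> 0 \<Longrightarrow> y = z"
      using forest[of ?U] less.prems by blast
    \<comment> \<open>A cut of \<open>T - {x}\<close> without edges across would leave
      \<open>x\<close> adjacent to both sides, hence with two neighbours.\<close>
    have del: "dynkin_connected (T - {x})" if T: "T \<subseteq> ?U" "dynkin_connected T" for T
      unfolding dynkin_connected_iff
    proof (intro allI impI, rule ccontr)
      fix X assume X: "X \<subseteq> T - {x}" "X \<noteq> {}" "X \<noteq> T - {x}"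
        and no: "\<not> (\<exists>p\<in>X. \<exists>q\<in>T - {x} - X. p \<bullet> q \<noteq> 0)"
      obtain a b where ab: "a \<in> X" "b \<in> T - {x}" "b \<notin> X" using X by blast
      obtain p q where pq: "p \<in> X" "q \<in> T" "q \<notin> X" "p \<bullet> q \<noteq> 0"
        using dynkin_connected_cut[OF T(2), of X a b] ab X by blast
      then have "q = x" using no by blast
      obtain r s where rs: "r \<in> insert x X" "s \<in> T" "s \<notin> insert x X" "r \<bullet> s \<noteq> 0"
        using dynkin_connected_cut[OF T(2), of "insert x X" a b] ab X pq \<open>q = x\<close> by blast
      then have "r = x" using no by blast
      have "p = s" using leaf[of p s] pq rs X T \<open>q = x\<close> \<open>r = x\<close> by (auto simp: inner_commute)
      then show False using pq rs by blast
    qed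
    have "card (A - {x} \<union> (B - {x})) < card ?U"
      using x finU by (intro psubset_card_mono) auto
    then have "dynkin_connected ((A - {x}) \<inter> (B - {x}))"
      using less.hyps[of "A - {x}" "B - {x}"] del less.prems by blast
    moreover have "(A - {x}) \<inter> (B - {x}) = A \<inter> B - {x}" by blast
    ultimately have d: "dynkin_connected (A \<inter> B - {x})" by simp
    show ?thesis
    proof (cases "x \<in> A \<inter> B \<and> A \<inter> B \<noteq> {x}")
      case True
      then obtain w where w: "w \<in> A \<inter> B" "w \<noteq> x" by blast
      obtain y where y: "y \<in> A" "y \<noteq> x" "x \<bullet> y \<noteq> 0"
        using dynkin_connected_cut[OF less.prems(3), of "{x}" x w] True w by auto
      obtain z where z: "z \<in> B" "z \<noteq> x" "x \<bullet> z \<noteq> 0"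
        using dynkin_connected_cut[OF less.prems(4), of "{x}" x w] True w by auto
      have "y = z" using leaf[of y z] y z by blast
      then have "dynkin_connected ({x} \<union> (A \<inter> B - {x}))"
        using dynkin_connected_Un[OF _ d, of "{x}" x y] y z by simp
      moreover have "{x} \<union> (A \<inter> B - {x}) = A \<inter> B" using True by blast
      ultimately show ?thesis by simp
    next
      case False
      then have "A \<inter> B = {x} \<or> A \<inter> B - {x} = A \<inter> B" by blast
      then show ?thesis using d by (metis dynkin_connected_singleton)
    qed
  qed simp
qed

definition supp :: "'a \<Rightarrow> 'a set" where "supp v = {b \<in> P. cf v b \<noteq> 0}"

lemma supp_subset: "supp v \<subseteq> P" by (auto simp: supp_def)

lemma supp_simple: "\<sigma> \<in> P \<Longrightarrow> supp \<sigma> = {\<sigma>}" by (auto simp: supp_def cf_basis)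

lemma supp_pos_ne: "\<gamma> \<in> \<Phi> \<Longrightarrow> supp \<gamma> \<noteq> {}"
  using pos_ex_cf by (force simp: supp_def)

lemma supp_add:
  assumes "\<alpha> \<in> \<Phi>" "\<beta> \<in> \<Phi>"
  shows "supp (\<alpha> + \<beta>) = supp \<alpha> \<union> supp \<beta>"
  using pos_cf[OF assms(1)] pos_cf[OF assms(2)] by (auto simp: supp_def add_nonneg_eq_0_iff)

text \<open>The root is built by adding one simple root at a time. A new \<open>\<sigma>\<close>
  orthogonal to the support of \<open>\<gamma> - \<sigma>\<close> is impossible, because
  \<open>refl \<sigma> \<gamma>\<close> would be a positive root with coefficient -1 at
  \<open>\<sigma>\<close>.\<close>

lemma supp_connected: "\<gamma> \<in> \<Phi> \<Longrightarrow> dynkin_connected (supp \<gamma>)"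
proof (induction rule: pos_ht_induct)
  case (less \<gamma>)
  show ?case
  proof (cases "\<gamma> \<in> P")
    case False
    then obtain \<sigma> where s: "\<sigma> \<in> P" "\<gamma> - \<sigma> \<in> \<Phi>" "ht (\<gamma> - \<sigma>) < ht \<gamma>" using pos_descend less.hyps by blast
    let ?g = "\<gamma> - \<sigma>"
    have c: "dynkin_connected (supp ?g)" using less.IH s by blast
    have sp: "supp \<gamma> = supp ?g \<union> {\<sigma>}" using supp_add[of ?g \<sigma>] s P_pos supp_simple by auto
    show ?thesis
    proof (cases "\<sigma> \<in> supp ?g")
      case True
      then show ?thesis using c sp by (simp add: insert_absorb)
    next
      case False
      have "\<exists>a\<in>supp ?g. a \<bullet> \<sigma> \<noteq> 0"
      proof (rule ccontr)
        assume no: "\<not> ?thesis"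
        then have "?g \<bullet> \<sigma> = 0" unfolding inner_expand[of ?g] by (intro sum.neutral) (auto simp: supp_def)
        then have "\<gamma> \<bullet> \<sigma> = \<sigma> \<bullet> \<sigma>" by (simp add: inner_diff_left)
        then have "refl \<sigma> \<gamma> = \<gamma> - 2 *\<^sub>R \<sigma>" using inner_pos[of \<sigma>] s P_subset by (auto simp: refl_def)
        moreover have "refl \<sigma> \<gamma> \<in> \<Phi>" using refl_simple_pos[OF less.hyps s(1)] \<open>\<gamma> \<notin> P\<close> s(1) by blast
        ultimately have "cf (\<gamma> - 2 *\<^sub>R \<sigma>) \<sigma> \<ge> 0" using pos_cf by metis
        moreover have "cf ?g \<sigma> = 0" using False s by (simp add: supp_def)
        ultimately show False using s by (simp add: cf_basis)
      qed
      then show ?thesis using dynkin_connected_Un[OF c dynkin_connected_singleton[of \<sigma>]] sp by auto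
    qed
  qed (simp add: supp_simple)
qed

lemma supp_root_connected: "\<gamma> \<in> R \<Longrightarrow> dynkin_connected (supp \<gamma>)"
  using root_cases[of \<gamma>] supp_connected[of \<gamma>] supp_connected[of "- \<gamma>"] by (auto simp: supp_def)

end

section \<open>The highest root\<close>

locale irreducible_based_root_system = based_root_system R P
  for R P :: "'a::euclidean_space set" +
  assumes irr: "irreducible_rs R"
begin

text \<open>Supports are connected, so a cut of \<open>P\<close> without edges across would sort all
  roots by support into two mutually orthogonal classes, contrary to irreducibility.\<close>

lemma P_connected: "dynkin_connected P"
  unfolding dynkin_connected_iff
proof (intro allI impI, rule ccontr)
  fix A assume A: "A \<subseteq> P" "A \<noteq> {}" "A \<noteq> P" and no: "\<not> (\<exists>x\<in>A. \<exists>y\<in>P - A. x \<bullet> y \<noteq> 0)"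
  let ?R1 = "{\<gamma>\<in>R. supp \<gamma> \<subseteq> A}" and ?R2 = "{\<gamma>\<in>R. supp \<gamma> \<subseteq> P - A}"
  have "R \<subseteq> ?R1 \<union> ?R2"
  proof
    fix \<gamma> assume g: "\<gamma> \<in> R"
    show "\<gamma> \<in> ?R1 \<union> ?R2"
    proof (rule ccontr)
      assume "\<gamma> \<notin> ?R1 \<union> ?R2"
      then obtain a b where "a \<in> supp \<gamma> \<inter> A" "b \<in> supp \<gamma>" "b \<notin> supp \<gamma> \<inter> A"
        using g supp_subset[of \<gamma>] by blast
      then obtain x y where "x \<in> supp \<gamma> \<inter> A" "y \<in> supp \<gamma>" "y \<notin> supp \<gamma> \<inter> A" "x \<bullet> y \<noteq> 0"
        using dynkin_connected_cut[OF supp_root_connected[OF g], of "supp \<gamma> \<inter> A"] by blast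
      then show False using no supp_subset[of \<gamma>] by blast
    qed
  qed
  then have un: "?R1 \<union> ?R2 = R" by blast
  have orth: "\<alpha> \<bullet> \<beta> = 0" if "\<alpha> \<in> ?R1" "\<beta> \<in> ?R2" for \<alpha> \<beta>
  proof -
    have "cf \<alpha> a * (a \<bullet> \<beta>) = 0" if a: "a \<in> P" for a
    proof (cases "a \<in> A")
      case True
      have "cf \<beta> b * (b \<bullet> a) = 0" if "b \<in> P" for b
        using True no that \<open>\<beta> \<in> ?R2\<close> unfolding supp_def by (cases "b \<in> A") (auto simp: inner_commute)
      then have "\<beta> \<bullet> a = 0" unfolding inner_expand[of \<beta>] by (intro sum.neutral) blast
      then show ?thesis by (simp add: inner_commute)
    next
      case False
      then show ?thesis using a \<open>\<alpha> \<in> ?R1\<close> by (auto simp: supp_def)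
    qed
    then show ?thesis unfolding inner_expand[of \<alpha>] by (intro sum.neutral) blast
  qed
  obtain a b where "a \<in> A" "b \<in> P - A" using A by blast
  then have "a \<in> ?R1" "b \<in> ?R2" using A P_subset supp_simple by auto
  then have ne: "?R1 \<noteq> {}" "?R2 \<noteq> {}" by blast+
  have "\<exists>R1 R2. R1 \<noteq> {} \<and> R2 \<noteq> {} \<and> R1 \<union> R2 = R \<and> (\<forall>\<alpha>\<in>R1. \<forall>\<beta>\<in>R2. \<alpha> \<bullet> \<beta> = 0)"
    by (intro exI[of _ ?R1] exI[of _ ?R2] conjI ballI ne un orth)
  then show False using irr unfolding irreducible_rs_def by (elim conjE notE)
qed

lemma P_nonempty: "P \<noteq> {}"
proof
  assume "P = {}"
  moreover obtain r where "r \<in> R" using irr unfolding irreducible_rs_def by blast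
  ultimately show False using cf_eqI[of r 0] zero_notin_R by auto
qed

text \<open>A simple root pairing negatively with \<open>\<gamma>\<close> could be added to it. One
  outside the support but adjacent to it would pair negatively, so by connectedness of
  \<open>P\<close> there is none outside.\<close>

lemma dominant_of_max:
  assumes "\<gamma> \<in> \<Phi>" "\<And>\<sigma>. \<sigma> \<in> P \<Longrightarrow> \<gamma> + \<sigma> \<notin> R"
  shows "\<forall>\<sigma>\<in>P. \<gamma> \<bullet> \<sigma> \<ge> 0" "supp \<gamma> = P" "\<exists>\<sigma>\<in>P. \<gamma> \<bullet> \<sigma> > 0"
proof -
  show dom: "\<forall>\<sigma>\<in>P. \<gamma> \<bullet> \<sigma> \<ge> 0"
  proof (intro ballI, rule ccontr)
    fix \<sigma> assume "\<sigma> \<in> P" "\<not> \<gamma> \<bullet> \<sigma> \<ge> 0"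
    moreover then have "\<gamma> + \<sigma> \<noteq> 0" using pos_add_ne_0 assms(1) P_pos by blast
    ultimately show False using root_add[of \<gamma> \<sigma>] assms pos_R P_subset by force
  qed
  show "supp \<gamma> = P"
  proof (rule ccontr)
    assume "supp \<gamma> \<noteq> P"
    moreover obtain a where "a \<in> supp \<gamma>" using supp_pos_ne assms(1) by blast
    ultimately obtain x y where xy: "x \<in> supp \<gamma>" "y \<in> P" "y \<notin> supp \<gamma>" "x \<bullet> y \<noteq> 0"
      using dynkin_connected_cut[OF P_connected, of "supp \<gamma>"] supp_subset[of \<gamma>] by blast
    have "\<gamma> \<bullet> y < 0"
    proof (rule sum_inner_neg)
      show "b \<bullet> y \<le> 0" if "b \<in> P" "cf \<gamma> b \<noteq> 0" for b
        using that simple_inner_le_0[of b y] xy by (auto simp: supp_def)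
    qed (use xy assms pos_cf in \<open>auto simp: supp_def\<close>)
    then show False using dom xy by force
  qed
  show "\<exists>\<sigma>\<in>P. \<gamma> \<bullet> \<sigma> > 0" using pos_ex_simple[OF assms(1)] by blast
qed

text \<open>Maximal roots are dominant with full support, so two of them have positive inner product
  and their difference is 0 or a root; they are comparable, hence equal.\<close>

lemma highest_exists: "\<exists>\<theta>\<in>\<Phi>. \<forall>\<alpha>\<in>\<Phi>. nonneg_comb P (\<theta> - \<alpha>)"
proof -
  have fin: "finite \<Phi>" using finite_R by (simp add: pos_roots_def)
  have max: "\<exists>\<gamma>'\<in>\<Phi>. nonneg_comb P (\<gamma>' - \<gamma>) \<and> (\<forall>\<delta>\<in>\<Phi>. nonneg_comb P (\<delta> - \<gamma>') \<longrightarrow> \<delta> = \<gamma>')"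
    if g: "\<gamma> \<in> \<Phi>" for \<gamma>
  proof -
    let ?A = "{\<delta>\<in>\<Phi>. nonneg_comb P (\<delta> - \<gamma>)}"
    have A: "finite ?A" "\<gamma> \<in> ?A" using fin g by (auto simp: nonneg_iff)
    obtain d where d: "d \<in> ?A" "\<And>e. e \<in> ?A \<Longrightarrow> ht e \<le> ht d"
      by (rule finite_arg_max[OF A, of ht]) blast
    have "e = d" if "e \<in> \<Phi>" "nonneg_comb P (e - d)" for e
    proof -
      have "nonneg_comb P (e - \<gamma>)" using nonneg_comb_add[OF that(2), of "d - \<gamma>"] d(1) by simp
      then have "ht (e - d) = 0" using d(2)[of e] that nonneg_ht[OF that(2)] by auto
      then show ?thesis using nonneg_ht_0[OF that(2)] by simp
    qed
    then show ?thesis using d(1) by blast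
  qed
  have nomax: "\<gamma> + \<sigma> \<notin> R" if "\<gamma> \<in> \<Phi>" "\<forall>\<delta>\<in>\<Phi>. nonneg_comb P (\<delta> - \<gamma>) \<longrightarrow> \<delta> = \<gamma>" "\<sigma> \<in> P" for \<gamma> \<sigma>
  proof
    assume "\<gamma> + \<sigma> \<in> R"
    then have "\<gamma> + \<sigma> \<in> \<Phi>" using pos_add that P_pos by blast
    moreover have "nonneg_comb P (\<gamma> + \<sigma> - \<gamma>)" using that P_pos pos_nonneg by auto
    ultimately have "\<gamma> + \<sigma> = \<gamma>" using that(2) by blast
    then show False using that(3) P_subset zero_notin_R by auto
  qed
  obtain \<sigma> where "\<sigma> \<in> P" using P_nonempty by blast
  then obtain \<theta> where th: "\<theta> \<in> \<Phi>" "\<forall>\<delta>\<in>\<Phi>. nonneg_comb P (\<delta> - \<theta>) \<longrightarrow> \<delta> = \<theta>"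
    using max P_pos by blast
  have "nonneg_comb P (\<theta> - \<gamma>)" if g: "\<gamma> \<in> \<Phi>" for \<gamma>
  proof -
    obtain d where d: "d \<in> \<Phi>" "nonneg_comb P (d - \<gamma>)" "\<forall>\<delta>\<in>\<Phi>. nonneg_comb P (\<delta> - d) \<longrightarrow> \<delta> = d"
      using max g by blast
    note D = dominant_of_max[OF d(1) nomax[OF d(1,3)]] and T = dominant_of_max[OF th(1) nomax[OF th]]
    obtain s where s: "s \<in> P" "\<theta> \<bullet> s > 0" using T(3) by blast
    have "cf d b * (b \<bullet> \<theta>) \<ge> 0" if "b \<in> P" for b
      using that T(1) pos_cf[OF d(1)] by (metis inner_commute mult_nonneg_nonneg)
    moreover have "cf d s * (s \<bullet> \<theta>) > 0"
      using s D(2) pos_cf[OF d(1), of s] by (auto simp: inner_commute supp_def less_le)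
    ultimately have "d \<bullet> \<theta> > 0" unfolding inner_expand[of d]
      using s(1) finite_P by (intro sum_pos2[of P s]) auto
    have "d = \<theta>"
    proof (rule ccontr)
      assume ne: "d \<noteq> \<theta>"
      then have "d - \<theta> \<in> R" using root_diff[of d \<theta>] d(1) th(1) pos_R \<open>d \<bullet> \<theta> > 0\<close> by blast
      then have "nonneg_comb P (d - \<theta>) \<or> nonneg_comb P (\<theta> - d)" using root_cases' by fastforce
      then show False using th(2) d(1,3) th(1) ne by blast
    qed
    then show ?thesis using d by blast
  qed
  then show ?thesis using th by blast
qed

abbreviation \<theta> :: 'a where "\<theta> \<equiv> highest_root R P"

lemma highest_root: "\<theta> \<in> \<Phi>" "\<alpha> \<in> \<Phi> \<Longrightarrow> nonneg_comb P (\<theta> - \<alpha>)"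
proof -
  have "\<exists>!t. t \<in> \<Phi> \<and> (\<forall>\<alpha>\<in>\<Phi>. nonneg_comb P (t - \<alpha>))"
  proof (rule ex_ex1I)
    fix s t assume st: "s \<in> \<Phi> \<and> (\<forall>\<alpha>\<in>\<Phi>. nonneg_comb P (s - \<alpha>))" "t \<in> \<Phi> \<and> (\<forall>\<alpha>\<in>\<Phi>. nonneg_comb P (t - \<alpha>))"
    then have "nonneg_comb P (s - t)" "nonneg_comb P (t - s)" by blast+
    then have "ht (s - t) = 0" using nonneg_ht[of "s - t"] nonneg_ht[of "t - s"] by simp
    then show "s = t" using nonneg_ht_0[OF \<open>nonneg_comb P (s - t)\<close>] by simp
  qed (use highest_exists in blast)
  from theI'[OF this] show "\<theta> \<in> \<Phi>" "\<alpha> \<in> \<Phi> \<Longrightarrow> nonneg_comb P (\<theta> - \<alpha>)"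
    unfolding highest_root_def by blast+
qed

lemma highest_add_notin: "\<gamma> \<in> \<Phi> \<Longrightarrow> \<theta> + \<gamma> \<notin> R"
proof
  assume "\<gamma> \<in> \<Phi>" "\<theta> + \<gamma> \<in> R"
  then have "nonneg_comb P (\<theta> - (\<theta> + \<gamma>))" using pos_add highest_root by blast
  then show False using nonneg_ht pos_ht[OF \<open>\<gamma> \<in> \<Phi>\<close>] by force
qed

lemma highest_dominant: "\<sigma> \<in> P \<Longrightarrow> \<theta> \<bullet> \<sigma> \<ge> 0"
  and highest_ex_simple: "\<exists>\<sigma>\<in>P. \<theta> \<bullet> \<sigma> > 0"
  using dominant_of_max[OF highest_root(1)] highest_add_notin P_pos by blast+

lemma dominant_inner:
  assumes "\<And>\<sigma>. \<sigma> \<in> P \<Longrightarrow> x \<bullet> \<sigma> \<ge> 0" "nonneg_comb P v"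
  shows "v \<bullet> x \<ge> 0"
  unfolding inner_expand[of v] using assms unfolding nonneg_iff
  by (intro sum_nonneg mult_nonneg_nonneg) (auto simp: inner_commute)

lemma highest_inner_nonneg: "\<gamma> \<in> \<Phi> \<Longrightarrow> \<gamma> \<bullet> \<theta> \<ge> 0"
  using dominant_inner[of \<theta>] highest_dominant pos_nonneg by blast

lemma pos_if_highest_inner: "\<gamma> \<in> R \<Longrightarrow> \<gamma> \<bullet> \<theta> > 0 \<Longrightarrow> \<gamma> \<in> \<Phi>"
  using root_cases[of \<gamma>] highest_inner_nonneg[of "- \<gamma>"] by auto

lemma highest_root_ge: "\<alpha> \<in> R \<Longrightarrow> nonneg_comb P (\<theta> - \<alpha>)"
  using root_cases[of \<alpha>] highest_root nonneg_comb_add[OF pos_nonneg[OF highest_root(1)] pos_nonneg[of "- \<alpha>"]]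
  by auto

end

section \<open>The Weyl group\<close>

lemma cartan_orth: "orthogonal_transformation w \<Longrightarrow> cartan (w x) (w y) = cartan x y"
  by (simp add: cartan_def orthogonal_transformation_def)

lemma weyl_orth: "w \<in> weyl R \<Longrightarrow> orthogonal_transformation w"
  using orthogonal_transformation_refl_prod by (auto simp: weyl_def)

lemma weyl_linear: "w \<in> weyl R \<Longrightarrow> linear w"
  using weyl_orth orthogonal_transformation_def by blast

lemma weyl_inner: "w \<in> weyl R \<Longrightarrow> w x \<bullet> w y = x \<bullet> y"
  using weyl_orth orthogonal_transformation_def by blast

lemma weyl_comp: "w \<in> weyl R \<Longrightarrow> w' \<in> weyl R \<Longrightarrow> w \<circ> w' \<in> weyl R"
  unfolding weyl_def by (auto simp: refl_prod_append[symmetric]) (metis Un_least set_append)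

lemma weyl_id: "id \<in> weyl R"
  unfolding weyl_def using refl_prod_Nil by (metis (mono_tags, lifting) empty_subsetI list.set(1) mem_Collect_eq)

lemma weyl_refl: "\<alpha> \<in> R \<Longrightarrow> refl \<alpha> \<in> weyl R"
  unfolding weyl_def by (rule CollectI, rule exI[of _ "[\<alpha>]"]) simp

lemma weyl_inverse:
  assumes "w \<in> weyl R"
  obtains w' where "w' \<in> weyl R" "\<And>v. w' (w v) = v" "\<And>v. w (w' v) = v"
proof -
  obtain xs where "set xs \<subseteq> R" "w = refl_prod xs" using assms by (auto simp: weyl_def)
  moreover then have "refl_prod (rev xs) \<in> weyl R"
    unfolding weyl_def by (intro CollectI exI[of _ "rev xs"]) simp
  ultimately show ?thesis
    using that[of "refl_prod (rev xs)"] refl_prod_rev[of xs] refl_prod_rev[of "rev xs"] by simp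
qed

section \<open>Generation by simple reflections and the exchange condition\<close>

context based_root_system
begin

lemma weyl_root: "w \<in> weyl R \<Longrightarrow> \<alpha> \<in> R \<Longrightarrow> w \<alpha> \<in> R"
proof -
  assume "w \<in> weyl R" "\<alpha> \<in> R"
  then obtain xs where xs: "set xs \<subseteq> R" "w = refl_prod xs" by (auto simp: weyl_def)
  have "refl_prod xs \<alpha> \<in> R" using xs(1) by (induction xs) (use \<open>\<alpha> \<in> R\<close> refl_closed in auto)
  then show ?thesis using xs by simp
qed

lemma cartan_pos_iff: "\<alpha> \<in> R \<Longrightarrow> cartan x \<alpha> > 0 \<longleftrightarrow> x \<bullet> \<alpha> > 0"
  and cartan_neg_iff: "\<alpha> \<in> R \<Longrightarrow> cartan x \<alpha> < 0 \<longleftrightarrow> x \<bullet> \<alpha> < 0"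
  and cartan_0_iff: "\<alpha> \<in> R \<Longrightarrow> cartan x \<alpha> = 0 \<longleftrightarrow> x \<bullet> \<alpha> = 0"
  using inner_pos[of \<alpha>] zero_notin_R
  by (auto simp: cartan_def zero_less_divide_iff divide_less_0_iff not_less_iff_gr_or_eq simp del: inner_gt_zero_iff)

text \<open>Conjugation by a simple reflection that lowers the height of \<open>\<beta>\<close>
  reduces the claim to a smaller root.\<close>

lemma refl_pos_simple:
  assumes "\<beta> \<in> \<Phi>"
  shows "\<exists>xs. set xs \<subseteq> P \<and> refl \<beta> = refl_prod xs"
  using assms
proof (induction rule: pos_ht_induct)
  case (less \<beta>)
  show ?case
  proof (cases "\<beta> \<in> P")
    case True
    then show ?thesis by (intro exI[of _ "[\<beta>]"]) simp
  next
    case False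
    obtain \<sigma> where s: "\<sigma> \<in> P" "\<beta> \<bullet> \<sigma> > 0" using pos_ex_simple less.hyps by blast
    let ?b = "refl \<sigma> \<beta>"
    have "?b \<in> \<Phi>" using refl_simple_pos[OF less.hyps s(1)] False s by blast
    moreover have "ht ?b < ht \<beta>"
      using cartan_pos_iff[of \<sigma> \<beta>] s P_subset by (auto simp: refl_cartan ht_simple)
    ultimately obtain xs where xs: "set xs \<subseteq> P" "refl ?b = refl_prod xs" using less.IH by blast
    have "refl \<beta> = refl \<sigma> \<circ> refl ?b \<circ> refl \<sigma>"
      using refl_conj[OF orthogonal_transformation_refl, of \<sigma> \<beta>] by (intro ext) (metis comp_apply refl_refl)
    also have "\<dots> = refl_prod (\<sigma> # xs @ [\<sigma>])" by (simp add: refl_prod_append xs comp_assoc)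
    finally show ?thesis using xs s by (intro exI[of _ "\<sigma> # xs @ [\<sigma>]"]) auto
  qed
qed

lemma weyl_simple:
  assumes "w \<in> weyl R"
  shows "\<exists>xs. set xs \<subseteq> P \<and> w = refl_prod xs"
proof -
  obtain xs where xs: "set xs \<subseteq> R" "w = refl_prod xs" using assms by (auto simp: weyl_def)
  have "\<exists>ys. set ys \<subseteq> P \<and> refl_prod xs = refl_prod ys" using xs(1)
  proof (induction xs)
    case Nil
    then show ?case by (intro exI[of _ "[]"]) simp
  next
    case (Cons x xs)
    then obtain ys where ys: "set ys \<subseteq> P" "refl_prod xs = refl_prod ys" by auto
    have "x \<in> \<Phi> \<or> - x \<in> \<Phi>" using Cons.prems root_cases by simp
    then obtain zs where "set zs \<subseteq> P" "refl x = refl_prod zs"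
      using refl_pos_simple[of x] refl_pos_simple[of "- x"] by (auto simp: refl_uminus_left)
    then show ?case using ys by (intro exI[of _ "zs @ ys"]) (auto simp: refl_prod_append)
  qed
  then show ?thesis using xs by simp
qed

text \<open>Read from the right, the word first turns \<open>\<sigma>\<close> negative at some
  letter \<open>x\<close>. Just before that the image of \<open>\<sigma>\<close> is \<open>x\<close>
  itself, so conjugation moves \<open>refl \<sigma>\<close> next to this letter and the two
  cancel.\<close>

lemma exchange:
  assumes "set xs \<subseteq> P" "\<sigma> \<in> P" "refl_prod xs \<sigma> \<notin> \<Phi>"
  shows "\<exists>ys. set ys \<subseteq> P \<and> length ys < length xs \<and> refl_prod xs \<circ> refl \<sigma> = refl_prod ys"
  using assms
proof (induction xs)
  case Nil
  then show ?case using P_pos by auto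
next
  case (Cons x xs)
  let ?w = "refl_prod xs"
  show ?case
  proof (cases "?w \<sigma> \<in> \<Phi>")
    case False
    then obtain ys where "set ys \<subseteq> P" "length ys < length xs" "?w \<circ> refl \<sigma> = refl_prod ys"
      using Cons.IH[OF _ Cons.prems(2) False] Cons.prems(1) by (metis list.set_intros(2) subset_eq)
    moreover then have "refl_prod (x # xs) \<circ> refl \<sigma> = refl_prod (x # ys)" by (metis comp_assoc refl_prod_Cons)
    ultimately show ?thesis using Cons.prems(1)
      by (metis insert_subset length_Cons list.simps(15) not_less_eq)
  next
    case True
    then have x: "?w \<sigma> = x" using refl_simple_neg[of "?w \<sigma>" x] Cons.prems by simp
    have "refl_prod (x # xs) \<circ> refl \<sigma> = ?w"
      using refl_conj[OF orthogonal_transformation_refl_prod, of xs \<sigma>] by (intro ext) (simp add: x)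
    then show ?thesis using Cons.prems(1) by (metis insert_subset length_Cons lessI list.simps(15))
  qed
qed

lemma wlen_le: "set xs \<subseteq> P \<Longrightarrow> wlen P (refl_prod xs) \<le> length xs"
  unfolding wlen_def by (rule Least_le) blast

lemma wlen_attained:
  assumes "w \<in> weyl R"
  obtains xs where "set xs \<subseteq> P" "w = refl_prod xs" "length xs = wlen P w"
proof -
  have "\<exists>n xs. length xs = n \<and> set xs \<subseteq> P \<and> w = refl_prod xs" using weyl_simple[OF assms] by blast
  from LeastI_ex[OF this] show ?thesis using that unfolding wlen_def by blast
qed

lemma wlen_refl_less:
  assumes "w \<in> weyl R" "\<sigma> \<in> P" "w \<sigma> \<notin> \<Phi>"
  shows "wlen P (w \<circ> refl \<sigma>) < wlen P w"
proof -
  obtain xs where xs: "set xs \<subseteq> P" "w = refl_prod xs" "length xs = wlen P w" using wlen_attained assms(1) .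
  obtain ys where ys: "set ys \<subseteq> P" "length ys < length xs" "w \<circ> refl \<sigma> = refl_prod ys"
    using exchange[OF xs(1) assms(2)] assms(3) xs(2) by blast
  then show ?thesis using wlen_le[of ys] xs by simp
qed

text \<open>Let a shortest word for \<open>w\<close> end in \<open>\<sigma>\<close>, with
  \<open>?u\<close> the product of the other letters. Since
  \<open>w \<sigma> = - ?u \<sigma>\<close> is positive, \<open>?u\<close> makes
  \<open>\<sigma>\<close> negative, and the exchange condition shortens the word.\<close>

lemma weyl_pos_id:
  assumes "w \<in> weyl R" "\<And>\<gamma>. \<gamma> \<in> \<Phi> \<Longrightarrow> w \<gamma> \<in> \<Phi>"
  shows "w = id"
proof -
  obtain xs where xs: "set xs \<subseteq> P" "w = refl_prod xs" "length xs = wlen P w" using wlen_attained assms(1) .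
  show ?thesis
  proof (cases xs rule: rev_cases)
    case (snoc ys \<sigma>)
    let ?u = "refl_prod ys"
    have s: "\<sigma> \<in> P" "set ys \<subseteq> P" using xs snoc by auto
    have "\<sigma> \<noteq> 0" using s P_subset zero_notin_R by blast
    then have "w \<sigma> = - ?u \<sigma>" using orthogonal_transformation_refl_prod[of ys]
      by (simp add: xs snoc refl_prod_append refl_self orthogonal_transformation_def linear_neg)
    then have "?u \<sigma> \<notin> \<Phi>" using assms(2)[of \<sigma>] s(1) P_pos pos_not_neg[of "?u \<sigma>"] by auto
    then obtain zs where "set zs \<subseteq> P" "length zs < length ys" "?u \<circ> refl \<sigma> = refl_prod zs"
      using exchange s by blast
    moreover have "w = ?u \<circ> refl \<sigma>" by (simp add: xs snoc refl_prod_append)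
    ultimately have "wlen P w < length xs" using wlen_le[of zs] snoc by simp
    then show ?thesis using xs by simp
  qed (use xs in simp)
qed

end

section \<open>The Weyl orbit of the highest root\<close>

context irreducible_based_root_system
begin

text \<open>A conjugate of largest height will do, since reflecting in a simple root with negative
  pairing would raise the height.\<close>

lemma dominant_conjugate:
  assumes "\<alpha> \<in> R"
  obtains w where "w \<in> weyl R" "\<And>\<sigma>. \<sigma> \<in> P \<Longrightarrow> w \<alpha> \<bullet> \<sigma> \<ge> 0"
proof -
  let ?A = "(\<lambda>w. w \<alpha>) ` weyl R"
  have "?A \<subseteq> R" using weyl_root assms by blast
  then have A: "finite ?A" "id \<alpha> \<in> ?A" using finite_R finite_subset weyl_id by blast+
  obtain \<beta> where b: "\<beta> \<in> ?A" "\<And>\<gamma>. \<gamma> \<in> ?A \<Longrightarrow> ht \<gamma> \<le> ht \<beta>"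
    by (rule finite_arg_max[OF A, of ht]) blast
  obtain w where w: "w \<in> weyl R" "\<beta> = w \<alpha>" using b(1) by blast
  have "\<beta> \<bullet> \<sigma> \<ge> 0" if s: "\<sigma> \<in> P" for \<sigma>
  proof (rule ccontr)
    assume "\<not> \<beta> \<bullet> \<sigma> \<ge> 0"
    then have "cartan \<beta> \<sigma> < 0" using cartan_neg_iff s P_subset by auto
    then have "ht (refl \<sigma> \<beta>) > ht \<beta>" using s by (simp add: refl_cartan ht_simple)
    moreover have "refl \<sigma> \<beta> \<in> ?A"
      using weyl_comp[OF weyl_refl w(1), of \<sigma>] s P_subset w(2) by (intro image_eqI[of _ _ "refl \<sigma> \<circ> w"]) auto
    ultimately show False using b(2) by force
  qed
  then show ?thesis using that w by blast
qed

text \<open>The nonnegative combination \<open>\<theta> - \<beta>\<close> pairs nonnegatively with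
  the dominant vectors \<open>\<beta>\<close> and \<open>\<theta>\<close>.\<close>

lemma highest_dominates:
  assumes "\<beta> \<in> R" "\<And>\<sigma>. \<sigma> \<in> P \<Longrightarrow> \<beta> \<bullet> \<sigma> \<ge> 0"
  shows "\<beta> \<bullet> \<beta> \<le> \<theta> \<bullet> \<beta>" "\<theta> \<bullet> \<beta> \<le> \<theta> \<bullet> \<theta>"
proof -
  have "(\<theta> - \<beta>) \<bullet> \<beta> \<ge> 0" "(\<theta> - \<beta>) \<bullet> \<theta> \<ge> 0"
    using dominant_inner highest_root_ge[OF assms(1)] assms(2) highest_dominant by auto
  then show "\<beta> \<bullet> \<beta> \<le> \<theta> \<bullet> \<beta>" "\<theta> \<bullet> \<beta> \<le> \<theta> \<bullet> \<theta>" by (simp_all add: inner_diff_left inner_commute[of \<beta> \<theta>])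
qed

lemma highest_R: "\<theta> \<in> R"
  using highest_root(1) pos_R by blast

lemma highest_long: "\<alpha> \<in> R \<Longrightarrow> \<alpha> \<bullet> \<alpha> \<le> \<theta> \<bullet> \<theta>"
proof -
  assume a: "\<alpha> \<in> R"
  then obtain w where w: "w \<in> weyl R" "\<And>\<sigma>. \<sigma> \<in> P \<Longrightarrow> w \<alpha> \<bullet> \<sigma> \<ge> 0" using dominant_conjugate by blast
  then show ?thesis using highest_dominates[of "w \<alpha>"] weyl_root[OF w(1) a] weyl_inner[OF w(1), of \<alpha> \<alpha>] by simp
qed

text \<open>For a long dominant conjugate the bounds of \<open>highest_dominates\<close> become
  equalities, so its difference from \<open>\<theta>\<close> has norm 0.\<close>

lemma long_conjugate:
  assumes a: "\<alpha> \<in> R" "\<alpha> \<bullet> \<alpha> = \<theta> \<bullet> \<theta>"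
  obtains w where "w \<in> weyl R" "w \<theta> = \<alpha>"
proof -
  obtain w where w: "w \<in> weyl R" "\<And>\<sigma>. \<sigma> \<in> P \<Longrightarrow> w \<alpha> \<bullet> \<sigma> \<ge> 0" using dominant_conjugate a by blast
  let ?b = "w \<alpha>"
  have "?b \<bullet> ?b = \<theta> \<bullet> \<theta>" using weyl_inner[OF w(1)] a by simp
  then have "(\<theta> - ?b) \<bullet> (\<theta> - ?b) = 0"
    using highest_dominates[of ?b] weyl_root[OF w(1) a(1)] w(2)
    by (simp add: inner_diff_left inner_diff_right inner_commute)
  then have "\<theta> = w \<alpha>" by simp
  then show ?thesis using weyl_inverse[OF w(1)] that by metis
qed

text \<open>Minimal length among the \<open>w\<close> with \<open>w \<theta> = \<mu>\<close> amounts to positivity on the positive roots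
  orthogonal to \<open>\<theta>\<close>; the uniqueness of such an element needs no theory of cosets, since the quotient of
  two of them preserves all positive roots.\<close>
definition admissible :: "'a \<Rightarrow> ('a \<Rightarrow> 'a) \<Rightarrow> bool" where
  "admissible \<mu> w \<longleftrightarrow> w \<in> weyl R \<and> w \<theta> = \<mu> \<and> (\<forall>\<gamma>\<in>\<Phi>. \<gamma> \<bullet> \<theta> = 0 \<longrightarrow> w \<gamma> \<in> \<Phi>)"

lemma admissible_pos_iff:
  assumes "admissible \<mu> w" "\<gamma> \<in> R" "\<gamma> \<bullet> \<theta> = 0"
  shows "w \<gamma> \<in> \<Phi> \<longleftrightarrow> \<gamma> \<in> \<Phi>"
proof
  assume p: "w \<gamma> \<in> \<Phi>"
  show "\<gamma> \<in> \<Phi>"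
  proof (rule ccontr)
    assume "\<gamma> \<notin> \<Phi>"
    then have "- \<gamma> \<in> \<Phi>" using root_cases assms(2) by blast
    then have "w (- \<gamma>) \<in> \<Phi>" using assms unfolding admissible_def by auto
    then have "- w \<gamma> \<in> \<Phi>" using assms(1) weyl_linear[of w R] by (simp add: admissible_def linear_neg)
    then show False using p pos_not_neg by blast
  qed
qed (use assms in \<open>auto simp: admissible_def\<close>)

text \<open>The quotient fixes \<open>\<theta>\<close> and so preserves
  \<open>\<gamma> \<bullet> \<theta>\<close>. A root with positive pairing is positive for that
  reason alone; on the roots orthogonal to \<open>\<theta>\<close> the admissibility of both
  elements gives the sign.\<close>

lemma admissible_unique:
  assumes w: "admissible \<mu> w" and w': "admissible \<mu> w'"
  shows "w = w'"
proof -
  have W: "w \<in> weyl R" "w' \<in> weyl R" "w \<theta> = \<mu>" "w' \<theta> = \<mu>" using w w' by (auto simp: admissible_def)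
  obtain v where v: "v \<in> weyl R" "\<And>x. v (w x) = x" "\<And>x. w (v x) = x" using weyl_inverse W(1) by blast
  have "v \<circ> w' = id"
  proof (rule weyl_pos_id)
    show "v \<circ> w' \<in> weyl R" using weyl_comp v(1) W(2) .
    fix \<gamma> assume g: "\<gamma> \<in> \<Phi>"
    let ?g = "v (w' \<gamma>)"
    have gR: "?g \<in> R" using weyl_root v(1) W(2) g pos_R by blast
    have "?g \<bullet> \<theta> = w ?g \<bullet> w \<theta>" using weyl_inner[OF W(1)] by simp
    also have "\<dots> = w' \<gamma> \<bullet> w' \<theta>" using v(3) W by simp
    also have "\<dots> = \<gamma> \<bullet> \<theta>" using weyl_inner[OF W(2)] by simp
    finally have eq: "?g \<bullet> \<theta> = \<gamma> \<bullet> \<theta>" .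
    show "(v \<circ> w') \<gamma> \<in> \<Phi>"
    proof (cases "\<gamma> \<bullet> \<theta> = 0")
      case True
      then have "w' \<gamma> \<in> \<Phi>" using w' g by (auto simp: admissible_def)
      then show ?thesis using admissible_pos_iff[OF w gR] eq True v(3) by simp
    next
      case False
      then show ?thesis using pos_if_highest_inner[OF gR] eq highest_inner_nonneg[OF g] by simp
    qed
  qed
  then have "v (w' x) = x" for x by (metis comp_apply id_apply)
  then show ?thesis using v(3) by (intro ext) metis
qed

text \<open>If a simple \<open>\<sigma>\<close> orthogonal to \<open>\<theta>\<close> became
  negative, \<open>w \<circ> refl \<sigma>\<close> would be shorter with the same value at
  \<open>\<theta>\<close>. Since \<open>\<theta>\<close> is dominant, only such
  \<open>\<sigma>\<close> occur in a positive root orthogonal to \<open>\<theta>\<close>.\<close>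

lemma minimal_admissible:
  assumes "w \<in> weyl R" "w \<theta> = \<mu>" "\<And>w'. w' \<in> weyl R \<Longrightarrow> w' \<theta> = \<mu> \<Longrightarrow> wlen P w \<le> wlen P w'"
  shows "admissible \<mu> w"
proof -
  have simple: "w \<sigma> \<in> \<Phi>" if s: "\<sigma> \<in> P" "\<sigma> \<bullet> \<theta> = 0" for \<sigma>
  proof (rule ccontr)
    assume "w \<sigma> \<notin> \<Phi>"
    then have "wlen P (w \<circ> refl \<sigma>) < wlen P w" using wlen_refl_less assms(1) s(1) by blast
    moreover have "w \<circ> refl \<sigma> \<in> weyl R" using weyl_comp[OF assms(1) weyl_refl] s P_subset by blast
    moreover have "(w \<circ> refl \<sigma>) \<theta> = \<mu>" using s assms(2) by (simp add: refl_orthogonal_vec inner_commute)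
    ultimately show False using assms(3) by force
  qed
  have "w \<gamma> \<in> \<Phi>" if g: "\<gamma> \<in> \<Phi>" "\<gamma> \<bullet> \<theta> = 0" for \<gamma>
  proof -
    have orth: "b \<bullet> \<theta> = 0" if b: "b \<in> P" "cf \<gamma> b \<noteq> 0" for b
    proof -
      have sum: "(\<Sum>b\<in>P. cf \<gamma> b * (b \<bullet> \<theta>)) = 0" using g(2) inner_expand by metis
      have nonneg: "\<And>b. b \<in> P \<Longrightarrow> cf \<gamma> b * (b \<bullet> \<theta>) \<ge> 0"
        using pos_cf[OF g(1)] highest_dominant by (metis inner_commute mult_nonneg_nonneg)
      have "cf \<gamma> b * (b \<bullet> \<theta>) = 0" by (rule sum_nonneg_0[OF finite_P nonneg sum b(1)])
      then show ?thesis using b by simp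
    qed
    have lin: "linear w" using weyl_linear assms(1) .
    have "w \<gamma> = w (\<Sum>b\<in>P. cf \<gamma> b *\<^sub>R b)" by (rule arg_cong[OF cf_expand])
    also have "\<dots> = (\<Sum>b\<in>P. cf \<gamma> b *\<^sub>R w b)" using lin by (simp add: linear_sum linear_scale)
    finally have exp: "w \<gamma> = (\<Sum>b\<in>P. cf \<gamma> b *\<^sub>R w b)" .
    have "cf (w \<gamma>) c \<ge> 0" for c
      unfolding exp cf_sum
    proof (rule sum_nonneg)
      fix b assume b: "b \<in> P"
      show "cf (cf \<gamma> b *\<^sub>R w b) c \<ge> 0"
        using pos_cf[OF g(1), of b] pos_cf[OF simple[OF b orth[OF b]], of c] by (cases "cf \<gamma> b = 0") auto
    qed
    moreover have "w \<gamma> \<in> R" using weyl_root assms(1) g(1) pos_R by blast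
    ultimately show ?thesis using root_cases pos_ex_cf[of "- w \<gamma>"] by (metis cf_uminus leD neg_0_less_iff_less neg_less_0_iff_less)
  qed
  then show ?thesis using assms by (simp add: admissible_def)
qed

text \<open>Minimal elements are admissible and admissible elements are unique, so the definite
  description denotes one. From here on lengths are replaced by \<open>admissible\<close>.\<close>

lemma w_mu_admissible:
  assumes "\<mu> \<in> R" "\<mu> \<bullet> \<mu> = \<theta> \<bullet> \<theta>"
  shows "admissible \<mu> (w_mu R P \<mu>)"
proof -
  let ?Q = "\<lambda>w. w \<in> weyl R \<and> w \<theta> = \<mu>"
  obtain w0 where "?Q w0" using long_conjugate assms by blast
  then obtain w where w: "?Q w" "\<And>w'. ?Q w' \<Longrightarrow> wlen P w \<le> wlen P w'"
    using ex_has_least_nat[of ?Q w0 "wlen P"] by blast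
  have "w_mu R P \<mu> = w"
    unfolding w_mu_def using w by (intro the_equality) (auto intro: admissible_unique minimal_admissible)
  then show ?thesis using minimal_admissible w by blast
qed

lemma w_mu_eq: "\<mu> \<in> R \<Longrightarrow> \<mu> \<bullet> \<mu> = \<theta> \<bullet> \<theta> \<Longrightarrow> admissible \<mu> w \<Longrightarrow> w_mu R P \<mu> = w"
  using admissible_unique w_mu_admissible by blast

text \<open>Strict Cauchy-Schwarz, with \<open>\<beta>\<close> no longer than \<open>\<mu>\<close>,
  keeps the Cartan integer below 2 in absolute value.\<close>

lemma cartan_long:
  assumes "\<mu> \<in> R" "\<mu> \<bullet> \<mu> = \<theta> \<bullet> \<theta>" "\<beta> \<in> R" "\<beta> \<noteq> \<mu>" "\<beta> \<noteq> - \<mu>"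
  shows "cartan \<beta> \<mu> = -1 \<or> cartan \<beta> \<mu> = 0 \<or> cartan \<beta> \<mu> = 1"
proof -
  have m: "\<mu> \<bullet> \<mu> > 0" using inner_pos assms(1) .
  have "(\<beta> \<bullet> \<mu>)\<^sup>2 < (\<beta> \<bullet> \<beta>) * (\<mu> \<bullet> \<mu>)" using inner_sq_less assms by blast
  also have "\<dots> \<le> (\<mu> \<bullet> \<mu>) * (\<mu> \<bullet> \<mu>)" using highest_long[OF assms(3)] assms(2) m by (intro mult_right_mono) auto
  finally have "\<bar>\<beta> \<bullet> \<mu>\<bar> < \<mu> \<bullet> \<mu>"
    using power2_less_imp_less[of "\<bar>\<beta> \<bullet> \<mu>\<bar>" "\<mu> \<bullet> \<mu>"] m by (simp add: power2_eq_square)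
  then have "\<bar>cartan \<beta> \<mu>\<bar> < 2" using m by (simp add: cartan_def abs_mult divide_less_eq)
  moreover obtain n :: int where "cartan \<beta> \<mu> = of_int n" using cartan_Ints assms by (metis Ints_cases)
  moreover then have "-2 < n" "n < 2" using \<open>\<bar>cartan \<beta> \<mu>\<bar> < 2\<close> by simp_all
  then have "n = -1 \<or> n = 0 \<or> n = 1" by linarith
  ultimately show ?thesis by auto
qed

lemma long_simple_iff: "\<alpha> \<in> long_simple R P \<longleftrightarrow> \<alpha> \<in> P \<and> \<alpha> \<bullet> \<alpha> = \<theta> \<bullet> \<theta>"
proof -
  have "\<theta> \<bullet> \<theta> \<le> \<alpha> \<bullet> \<alpha> \<longleftrightarrow> \<alpha> \<bullet> \<alpha> = \<theta> \<bullet> \<theta>" if "\<alpha> \<in> P" using highest_long[of \<alpha>] that P_subset by auto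
  then show ?thesis unfolding long_simple_def long_roots_def
    using highest_long highest_R P_pos by (auto intro: order_trans)
qed

section \<open>The minimal ideals\<close>

lemma heis_iff: "\<eta> \<in> heis R P \<longleftrightarrow> \<eta> \<in> R \<and> \<eta> \<bullet> \<theta> > 0"
  using pos_if_highest_inner pos_R by (auto simp: heis_def)

lemma heis_pos: "\<eta> \<in> heis R P \<Longrightarrow> \<eta> \<in> \<Phi>"
  by (simp add: heis_def)

lemma theta_heis: "\<theta> \<in> heis R P"
  using highest_R inner_pos by (simp add: heis_iff)

lemma heis_cartan:
  assumes "\<eta> \<in> heis R P" "\<eta> \<noteq> \<theta>"
  shows "cartan \<eta> \<theta> = 1"
proof -
  have "\<eta> \<in> R" "cartan \<eta> \<theta> > 0" "\<eta> \<noteq> - \<theta>"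
    using assms highest_R cartan_pos_iff pos_not_neg[OF highest_root(1)] by (auto simp: heis_def pos_R)
  then show ?thesis using cartan_long[OF highest_R refl, of \<eta>] assms by auto
qed

lemma cartan_diff: "cartan (x - y) z = cartan x z - cartan y z"
  and cartan_add: "cartan (x + y) z = cartan x z + cartan y z"
  and cartan_uminus: "cartan (- x) z = - cartan x z"
  by (simp_all add: cartan_def inner_diff_left inner_add_left diff_divide_distrib add_divide_distrib algebra_simps)

lemma cartan_self: "\<alpha> \<in> R \<Longrightarrow> cartan \<alpha> \<alpha> = 2"
  using inner_pos[of \<alpha>] by (simp add: cartan_def)

text \<open>The Cartan integer at \<open>\<theta>\<close> is 2 for \<open>\<theta>\<close> and 1 for
  \<open>\<eta>\<close>, hence again 1 for the difference. This gives the involution that pairs the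
  members of \<open>heis R P\<close> other than \<open>\<theta>\<close>.\<close>

lemma heis_pair:
  assumes "\<eta> \<in> heis R P" "\<eta> \<noteq> \<theta>"
  shows "\<theta> - \<eta> \<in> heis R P" "\<theta> - \<eta> \<noteq> \<theta>"
proof -
  have "cartan (\<theta> - \<eta>) \<theta> = 1" using heis_cartan[OF assms] cartan_self[OF highest_R] by (simp add: cartan_diff)
  moreover have "\<theta> - \<eta> \<in> R" using root_diff[of \<theta> \<eta>] assms highest_R by (auto simp: heis_iff inner_commute)
  ultimately show "\<theta> - \<eta> \<in> heis R P" using cartan_pos_iff[OF highest_R, of "\<theta> - \<eta>"] by (simp add: heis_iff)
  show "\<theta> - \<eta> \<noteq> \<theta>" using assms pos_ne_0 heis_pos by auto
qed

text \<open>The variable \<open>w\<close> is tied to \<open>\<alpha>\<close> by an equation, so that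
  the facts below can be instantiated for several roots, with \<open>refl\<close> discharging the
  equation.\<close>

context
  fixes \<alpha> w
  assumes alpha: "\<alpha> \<in> long_simple R P" and w_def: "w = w_mu R P \<alpha>"
begin

lemma alpha_props: "\<alpha> \<in> P" "\<alpha> \<in> R" "\<alpha> \<in> \<Phi>" "\<alpha> \<bullet> \<alpha> = \<theta> \<bullet> \<theta>"
  using alpha long_simple_iff P_subset P_pos by auto

lemma w_admissible: "admissible \<alpha> w"
  using w_mu_admissible alpha_props by (simp add: w_def)

lemma w_weyl: "w \<in> weyl R" and w_theta: "w \<theta> = \<alpha>"
  and w_pos: "\<gamma> \<in> \<Phi> \<Longrightarrow> \<gamma> \<bullet> \<theta> = 0 \<Longrightarrow> w \<gamma> \<in> \<Phi>"
  using w_admissible by (auto simp: admissible_def)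

lemma w_diff: "w (x - y) = w x - w y" and w_add: "w (x + y) = w x + w y"
  using weyl_linear[OF w_weyl] by (auto simp: linear_diff linear_add)

lemma w_cartan: "cartan (w x) \<alpha> = cartan x \<theta>"
  using cartan_orth[OF weyl_orth[OF w_weyl], of x \<theta>] w_theta by simp

text \<open>The roots \<open>w \<eta>\<close> and \<open>w (\<theta> - \<eta>)\<close> add up to
  \<open>\<alpha>\<close>. They are not both negative because \<open>\<alpha>\<close> is positive,
  and not both positive because \<open>\<alpha>\<close> is simple.\<close>

lemma heis_dichotomy:
  assumes "\<eta> \<in> heis R P" "\<eta> \<noteq> \<theta>"
  shows "w (\<theta> - \<eta>) \<in> \<Phi> \<longleftrightarrow> - w \<eta> \<in> \<Phi>" "w \<eta> \<in> \<Phi> \<longleftrightarrow> w (\<theta> - \<eta>) \<notin> \<Phi>"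
proof -
  have R: "w \<eta> \<in> R" "w (\<theta> - \<eta>) \<in> R"
    using weyl_root[OF w_weyl] heis_pair[OF assms] assms by (auto simp: heis_iff)
  have e: "w (\<theta> - \<eta>) = \<alpha> - w \<eta>" by (simp add: w_diff w_theta)
  have "w (\<theta> - \<eta>) \<in> \<Phi>" if "- w \<eta> \<in> \<Phi>" using pos_add[OF alpha_props(3) that] R e by simp
  moreover have "\<not> (w (\<theta> - \<eta>) \<in> \<Phi> \<and> w \<eta> \<in> \<Phi>)"
    using simple_not_sum[OF alpha_props(1), of "w \<eta>" "\<alpha> - w \<eta>"] e by auto
  ultimately show "w (\<theta> - \<eta>) \<in> \<Phi> \<longleftrightarrow> - w \<eta> \<in> \<Phi>" "w \<eta> \<in> \<Phi> \<longleftrightarrow> w (\<theta> - \<eta>) \<notin> \<Phi>"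
    using root_cases[OF R(1)] by blast+
qed

text \<open>A root in \<open>inv_set R P w\<close> is not orthogonal to \<open>\<theta>\<close>, so
  it lies in \<open>heis R P\<close>; by the dichotomy it becomes negative exactly when its partner
  stays positive.\<close>

lemma mem_I_min_iff: "\<eta> \<in> I_min R P \<alpha> \<longleftrightarrow> \<eta> = \<theta> \<or> (\<eta> \<in> heis R P \<and> w \<eta> \<in> \<Phi>)"
proof (cases "\<eta> = \<theta>")
  case False
  have "(\<exists>\<gamma>. \<eta> = \<theta> - \<gamma> \<and> \<gamma> \<in> inv_set R P w) \<longleftrightarrow> \<eta> \<in> heis R P \<and> w \<eta> \<in> \<Phi>"
  proof
    assume "\<exists>\<gamma>. \<eta> = \<theta> - \<gamma> \<and> \<gamma> \<in> inv_set R P w"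
    then obtain \<gamma> where g: "\<eta> = \<theta> - \<gamma>" "\<gamma> \<in> \<Phi>" "- w \<gamma> \<in> \<Phi>" by (auto simp: inv_set_def)
    have "\<gamma> \<bullet> \<theta> \<noteq> 0" using w_pos[of \<gamma>] g pos_not_neg by blast
    then have h: "\<gamma> \<in> heis R P" using g highest_inner_nonneg[of \<gamma>] by (simp add: heis_def)
    moreover have ne: "\<gamma> \<noteq> \<theta>" using g(3) w_theta pos_not_neg[OF alpha_props(3)] by auto
    ultimately show "\<eta> \<in> heis R P \<and> w \<eta> \<in> \<Phi>" using heis_pair heis_dichotomy(1) g by blast
  next
    assume "\<eta> \<in> heis R P \<and> w \<eta> \<in> \<Phi>"
    then have h: "\<eta> \<in> heis R P" "w \<eta> \<in> \<Phi>" by auto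
    let ?g = "\<theta> - \<eta>"
    have g: "?g \<in> heis R P" "?g \<noteq> \<theta>" using heis_pair h False by blast+
    have "\<theta> - ?g = \<eta>" by simp
    then have "- w ?g \<in> \<Phi>" using heis_dichotomy(1)[OF g] h by simp
    then show "\<exists>\<gamma>. \<eta> = \<theta> - \<gamma> \<and> \<gamma> \<in> inv_set R P w"
      using g heis_pos by (intro exI[of _ ?g]) (auto simp: inv_set_def)
  qed
  then show ?thesis using False by (auto simp: I_min_def w_def)
qed (simp add: I_min_def)

lemma theta_I_min: "\<theta> \<in> I_min R P \<alpha>"
  by (simp add: mem_I_min_iff)

lemma I_min_heis: "I_min R P \<alpha> \<subseteq> heis R P"
  by (rule subsetI) (metis mem_I_min_iff theta_heis)

lemma I_min_pair: "\<eta> \<in> heis R P \<Longrightarrow> \<eta> \<noteq> \<theta> \<Longrightarrow> \<eta> \<in> I_min R P \<alpha> \<longleftrightarrow> \<theta> - \<eta> \<notin> I_min R P \<alpha>"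
  using mem_I_min_iff heis_pair heis_dichotomy(2) by blast

lemma w_I_min: "\<eta> \<in> I_min R P \<alpha> \<Longrightarrow> w \<eta> \<in> \<Phi>"
  using mem_I_min_iff w_theta alpha_props by auto

text \<open>When the sum \<open>\<rho> + \<eta>\<close> differs from \<open>\<theta>\<close>,
  comparing Cartan integers at \<open>\<theta>\<close> makes \<open>\<rho>\<close> orthogonal to
  \<open>\<theta>\<close>, so \<open>w \<rho>\<close> is positive.\<close>

lemma I_min_upper: "upper_ideal R P (I_min R P \<alpha>)"
  unfolding upper_ideal_def
proof (intro conjI ballI impI)
  show "I_min R P \<alpha> \<subseteq> \<Phi>" using I_min_heis heis_pos by blast
  fix \<eta> \<rho> assume e: "\<eta> \<in> I_min R P \<alpha>" and r: "\<rho> \<in> \<Phi>" and s: "\<rho> + \<eta> \<in> \<Phi>"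
  have ne: "\<eta> \<noteq> \<theta>" using s r highest_add_notin pos_R by (metis add.commute)
  have h: "\<eta> \<in> heis R P" using e I_min_heis by blast
  then have sh: "\<rho> + \<eta> \<in> heis R P" using highest_inner_nonneg[OF r] s by (simp add: heis_def inner_add_left)
  show "\<rho> + \<eta> \<in> I_min R P \<alpha>"
  proof (cases "\<rho> + \<eta> = \<theta>")
    case False
    then have "cartan \<rho> \<theta> = 0" using heis_cartan[OF sh False] heis_cartan[OF h ne] by (simp add: cartan_add)
    then have "w \<rho> \<in> \<Phi>" using w_pos r cartan_0_iff highest_R by blast
    then have "w (\<rho> + \<eta>) \<in> \<Phi>" using pos_add w_I_min[OF e] weyl_root[OF w_weyl pos_R[OF s]] by (simp add: w_add)
    then show ?thesis using mem_I_min_iff sh by blast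
  qed (simp add: theta_I_min)
qed

text \<open>A root that is the sum of two members has Cartan integer 2 at \<open>\<theta>\<close>,
  so it is \<open>\<theta>\<close>; applying \<open>w\<close> would decompose the simple root
  \<open>\<alpha>\<close>.\<close>

lemma I_min_abelian: "\<eta>1 \<in> I_min R P \<alpha> \<Longrightarrow> \<eta>2 \<in> I_min R P \<alpha> \<Longrightarrow> \<eta>1 + \<eta>2 \<notin> R"
proof
  assume e: "\<eta>1 \<in> I_min R P \<alpha>" "\<eta>2 \<in> I_min R P \<alpha>" and s: "\<eta>1 + \<eta>2 \<in> R"
  have ne: "\<eta>1 \<noteq> \<theta>" "\<eta>2 \<noteq> \<theta>"
    using s highest_add_notin e I_min_heis heis_pos by (metis subsetD, metis add.commute subsetD)
  then have c: "cartan (\<eta>1 + \<eta>2) \<theta> = 2" using heis_cartan[of \<eta>1] heis_cartan[of \<eta>2] subsetD[OF I_min_heis] e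
    by (simp add: cartan_add)
  then have "\<eta>1 + \<eta>2 \<in> heis R P" using s cartan_pos_iff[OF highest_R, of "\<eta>1 + \<eta>2"] by (simp add: heis_iff)
  then have "\<eta>1 + \<eta>2 = \<theta>" using heis_cartan c by fastforce
  then have "\<alpha> = w \<eta>1 + w \<eta>2" using w_add w_theta by metis
  then show False using simple_not_sum alpha_props(1) w_I_min e by blast
qed

end

end

context irreducible_based_root_system
begin

section \<open>The maximal ideals\<close>

text \<open>Otherwise the roots in the span of \<open>?N\<close> and the roots orthogonal to
  \<open>?N\<close> would decompose \<open>R\<close>, with \<open>\<alpha>\<close> in the first
  class and \<open>u\<close> in the second.\<close>

lemma ex_common_neighbour:
  assumes "\<alpha> \<in> R" "u \<in> R"
  shows "\<exists>\<beta>\<in>R. \<beta> \<bullet> \<alpha> \<noteq> 0 \<and> \<beta> \<bullet> u \<noteq> 0"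
proof (rule ccontr)
  assume no: "\<not> ?thesis"
  let ?N = "{\<beta>\<in>R. \<beta> \<bullet> \<alpha> \<noteq> 0}"
  let ?R1 = "{\<gamma>\<in>R. \<gamma> \<in> span ?N}" and ?R2 = "{\<gamma>\<in>R. \<forall>\<beta>\<in>?N. \<gamma> \<bullet> \<beta> = 0}"
  have "\<gamma> \<in> ?R1 \<union> ?R2" if g: "\<gamma> \<in> R" for \<gamma>
  proof (cases "\<gamma> \<in> ?N \<or> \<gamma> \<in> ?R2")
    case False
    then obtain \<beta> where b: "\<beta> \<in> ?N" "\<gamma> \<bullet> \<beta> \<noteq> 0" and ga: "\<gamma> \<bullet> \<alpha> = 0" using g by blast
    \<comment> \<open>Reflecting \<open>\<beta>\<close> in \<open>\<gamma>\<close> stays inside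
      \<open>?N\<close>, and the difference of the two is a nonzero multiple of
      \<open>\<gamma>\<close>.\<close>
    have "refl \<gamma> \<beta> \<bullet> \<alpha> = \<beta> \<bullet> \<alpha>" using ga by (simp add: refl_cartan inner_diff_left)
    then have N: "refl \<gamma> \<beta> \<in> ?N" using b refl_closed g by simp
    have c: "cartan \<beta> \<gamma> \<noteq> 0" using cartan_0_iff[OF g] b by (simp add: inner_commute)
    have "cartan \<beta> \<gamma> *\<^sub>R \<gamma> = \<beta> - refl \<gamma> \<beta>" by (simp add: refl_cartan)
    then have "cartan \<beta> \<gamma> *\<^sub>R \<gamma> \<in> span ?N" using span_diff[OF span_base[OF b(1)] span_base[OF N]] by simp
    then have "(1 / cartan \<beta> \<gamma>) *\<^sub>R (cartan \<beta> \<gamma> *\<^sub>R \<gamma>) \<in> span ?N" by (rule span_scale)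
    then show ?thesis using g c by simp
  qed (use g span_base in auto)
  then have un: "?R1 \<union> ?R2 = R" by blast
  have orth: "x \<bullet> y = 0" if "x \<in> ?R1" "y \<in> ?R2" for x y
  proof -
    have "span ?N \<subseteq> {x. y \<bullet> x = 0}"
      using that(2) by (intro span_minimal) (auto simp: subspace_def inner_add_right)
    then show ?thesis using that(1) by (auto simp: inner_commute)
  qed
  have "\<alpha> \<in> ?R1" using assms inner_pos[of \<alpha>] by (auto intro!: span_base)
  moreover have "u \<in> ?R2" using assms no by (auto simp: inner_commute)
  ultimately have ne: "?R1 \<noteq> {}" "?R2 \<noteq> {}" by blast+
  have "\<exists>R1 R2. R1 \<noteq> {} \<and> R2 \<noteq> {} \<and> R1 \<union> R2 = R \<and> (\<forall>\<alpha>\<in>R1. \<forall>\<beta>\<in>R2. \<alpha> \<bullet> \<beta> = 0)"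
    by (intro exI[of _ ?R1] exI[of _ ?R2] conjI ballI ne un orth)
  then show False using irr unfolding irreducible_rs_def by (elim conjE notE)
qed

section \<open>Roots orthogonal to a long simple root\<close>

context
  fixes \<alpha>
  assumes a: "\<alpha> \<in> P" "\<alpha> \<bullet> \<alpha> = \<theta> \<bullet> \<theta>"
begin

text \<open>For \<open>u = w \<nu>\<close> with \<open>w = w_mu R P \<alpha>\<close> and \<open>\<nu>\<close> orthogonal to \<open>\<theta>\<close>, the hypothesis on \<open>u\<close> says that \<open>\<nu>\<close> plus
  an element of \<open>I_min R P \<alpha>\<close> is never a root. If \<open>\<alpha>\<close> were missing from the support of \<open>u\<close>, then a root
  \<open>\<beta>\<close> with \<open>cartan \<beta> \<alpha> = 1\<close> and \<open>\<beta> \<bullet> u < 0\<close>, or else the root \<open>refl u (\<alpha> - \<beta>)\<close>, would be positive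
  and violate it.\<close>
lemma centralizer_support:
  assumes u: "u \<in> \<Phi>" "u \<bullet> \<alpha> = 0" and no: "\<And>\<beta>. \<beta> \<in> \<Phi> \<Longrightarrow> cartan \<beta> \<alpha> = 1 \<Longrightarrow> u + \<beta> \<notin> R"
  shows "cf u \<alpha> > 0"
proof (rule ccontr)
  assume "\<not> cf u \<alpha> > 0"
  then have cu: "cf u \<alpha> = 0" using pos_cf[OF u(1), of \<alpha>] by simp
  have aR: "\<alpha> \<in> R" and uR: "u \<in> R" using a u P_subset pos_R by auto
  obtain \<beta>0 where b0: "\<beta>0 \<in> R" "\<beta>0 \<bullet> \<alpha> \<noteq> 0" "\<beta>0 \<bullet> u \<noteq> 0" using ex_common_neighbour[OF aR uR] by blast
  have "\<beta>0 \<noteq> \<alpha>" "\<beta>0 \<noteq> - \<alpha>" using b0(3) u(2) by (auto simp: inner_commute)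
  then have "cartan \<beta>0 \<alpha> = 1 \<or> cartan (- \<beta>0) \<alpha> = 1"
    using cartan_long[OF aR a(2) b0(1)] cartan_0_iff[OF aR, of \<beta>0] b0(2) by (auto simp: cartan_uminus)
  then obtain \<beta>1 where b1: "\<beta>1 \<in> R" "cartan \<beta>1 \<alpha> = 1" "\<beta>1 \<bullet> u \<noteq> 0"
    using b0 uminus_root[OF b0(1)] by (metis inner_minus_left neg_equal_0_iff_equal)
  \<comment> \<open>The map from \<open>x\<close> to \<open>\<alpha> - x\<close> keeps the Cartan
    integer 1 and reverses the sign of the pairing with \<open>u\<close>.\<close>
  have d: "\<alpha> - x \<in> R \<and> cartan (\<alpha> - x) \<alpha> = 1 \<and> (\<alpha> - x) \<bullet> u = - (x \<bullet> u)"
    if x: "x \<in> R" "cartan x \<alpha> = 1" for x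
  proof -
    have "\<alpha> \<bullet> x > 0" using cartan_pos_iff[OF aR, of x] x(2) by (simp add: inner_commute)
    moreover have "\<alpha> \<noteq> x" using cartan_self[OF aR] x(2) by auto
    ultimately have "\<alpha> - x \<in> R" using root_diff[OF aR x(1)] by blast
    then show ?thesis using x(2) cartan_self[OF aR] u(2)
      by (simp add: cartan_diff inner_diff_left inner_commute[of \<alpha> u])
  qed
  obtain \<beta> where b: "\<beta> \<in> R" "cartan \<beta> \<alpha> = 1" "\<beta> \<bullet> u < 0"
  proof (cases "\<beta>1 \<bullet> u < 0")
    case False
    then show ?thesis using that[of "\<alpha> - \<beta>1"] d[OF b1(1,2)] b1(3) by simp
  qed (use that b1 in blast)
  have plus: "u + x \<in> R" if x: "x \<in> R" "cartan x \<alpha> = 1" "x \<bullet> u < 0" for x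
  proof -
    have "cartan (u + x) \<alpha> = 1" using cartan_0_iff[OF aR, of u] u(2) x(2) by (simp add: cartan_add)
    then have "u + x \<noteq> 0" by (auto simp: cartan_def)
    then show ?thesis using root_add[OF uR x(1)] x(3) by (simp add: inner_commute)
  qed
  have "\<beta> \<notin> \<Phi>" using no plus b by blast
  then have "cf \<beta> \<alpha> \<le> 0" using root_cases[OF b(1)] pos_cf[of "- \<beta>" \<alpha>] by auto
  \<comment> \<open>The reflection in \<open>u\<close> makes the pairing with \<open>u\<close>
    negative again. As \<open>cf u \<alpha>\<close> is 0, it leaves the coefficient at
    \<open>\<alpha>\<close> at \<open>1 - cf \<beta> \<alpha>\<close>, which is positive.\<close>
  let ?x = "\<alpha> - \<beta>" and ?d = "refl u (\<alpha> - \<beta>)"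
  have x: "?x \<in> R" "cartan ?x \<alpha> = 1" "?x \<bullet> u = - (\<beta> \<bullet> u)" using d[OF b(1,2)] by auto
  have dR: "?d \<in> R" using refl_closed uR x by blast
  have "cf ?d \<alpha> > 0" using cu a \<open>cf \<beta> \<alpha> \<le> 0\<close> by (simp add: refl_cartan cf_basis)
  then have "?d \<in> \<Phi>" using pos_if_cf dR by blast
  moreover have dc: "cartan ?d \<alpha> = 1"
    using x(2) u(2) by (simp add: refl_cartan cartan_diff) (simp add: cartan_def)
  moreover have "?d \<bullet> u = - (?x \<bullet> u)"
    using inner_pos[OF uR] by (simp add: refl_def inner_diff_left)
  then have "?d \<bullet> u < 0" using x(3) b(3) by simp
  ultimately show False using no plus dR by blast
qed

text \<open>Take a simple root \<open>\<sigma>\<close> off \<open>u\<close>. If it is orthogonal to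
  \<open>\<alpha>\<close>, one part of the splitting of \<open>u - \<sigma>\<close> absorbs it by
  \<open>root_triple\<close>; otherwise \<open>u - \<sigma>\<close> and \<open>\<sigma>\<close> are
  the two parts.\<close>

lemma orthogonal_split:
  assumes "u \<in> \<Phi>" "u \<bullet> \<alpha> = 0" "cf u \<alpha> > 0"
  shows "\<exists>c\<in>\<Phi>. \<exists>d\<in>\<Phi>. u = c + d \<and> cartan c \<alpha> = 1 \<and> cartan d \<alpha> = -1"
  using assms
proof (induction rule: pos_ht_induct)
  case (less u)
  have aR: "\<alpha> \<in> R" using a P_subset by auto
  obtain \<sigma> where s: "\<sigma> \<in> P" "u \<bullet> \<sigma> > 0" using pos_ex_simple less.hyps by blast
  have sa: "\<sigma> \<noteq> \<alpha>" using s less.prems by auto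
  have "u \<noteq> \<sigma>" using less.prems(2) s sa by (auto simp: cf_basis)
  then have v: "u - \<sigma> \<in> \<Phi>"
    using pos_diff_simple[OF less.hyps s(1)] root_diff[of u \<sigma>] s less.hyps P_subset pos_R by blast
  have cfv: "cf (u - \<sigma>) \<alpha> > 0" using less.prems(2) s sa by (simp add: cf_basis)
  have sp: "\<sigma> \<in> \<Phi>" "\<sigma> \<in> R" using s P_pos P_subset by auto
  show ?case
  proof (cases "\<sigma> \<bullet> \<alpha> = 0")
    case True
    then have cs: "cartan \<sigma> \<alpha> = 0" by (simp add: cartan_def)
    obtain c d where cd: "c \<in> \<Phi>" "d \<in> \<Phi>" "u - \<sigma> = c + d" "cartan c \<alpha> = 1" "cartan d \<alpha> = -1"
      using less.IH[OF v] s True cfv less.prems(1) by (auto simp: ht_simple inner_diff_left)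
    have ue: "u = c + d + \<sigma>" using cd(3) by (simp add: algebra_simps)
    have "c + \<sigma> \<in> R \<or> d + \<sigma> \<in> R"
      using root_triple[of c d \<sigma>] cd sp v ue less.hyps pos_R pos_add_ne_0 by metis
    then show ?thesis
    proof
      assume "c + \<sigma> \<in> R"
      then have "c + \<sigma> \<in> \<Phi>" using pos_add cd sp by blast
      then show ?thesis using cd cs ue by (intro bexI[of _ "c + \<sigma>"] bexI[of _ d]) (auto simp: cartan_add)
    next
      assume "d + \<sigma> \<in> R"
      then have "d + \<sigma> \<in> \<Phi>" using pos_add cd sp by blast
      then show ?thesis using cd cs ue by (intro bexI[of _ c] bexI[of _ "d + \<sigma>"]) (auto simp: cartan_add)
    qed
  next
    case False
    have "cartan \<sigma> \<alpha> \<noteq> 1" using simple_inner_le_0[OF s(1) a(1) sa] cartan_pos_iff[OF aR, of \<sigma>] by auto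
    moreover have "\<sigma> \<noteq> - \<alpha>" using sp(1) pos_not_neg a(1) P_pos by auto
    ultimately have "cartan \<sigma> \<alpha> = -1"
      using cartan_long[OF aR a(2) sp(2) sa] False cartan_0_iff[OF aR, of \<sigma>] by auto
    moreover then have "cartan (u - \<sigma>) \<alpha> = 1" using less.prems(1) cartan_0_iff[OF aR, of u] by (simp add: cartan_diff)
    ultimately show ?thesis using v sp by (intro bexI[of _ "u - \<sigma>"] bexI[of _ \<sigma>]) auto
  qed
qed

text \<open>Split \<open>v\<close> as \<open>c + d\<close>. If \<open>u + v\<close> were a root,
  \<open>root_triple\<close> would make \<open>d + u\<close> a root, since \<open>c + u\<close> is
  excluded. Adding \<open>\<alpha>\<close> gives a root \<open>u + (d + \<alpha>)\<close>, where
  \<open>d + \<alpha>\<close> has Cartan integer 1 at \<open>\<alpha>\<close>, contrary to the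
  hypothesis on \<open>u\<close>.\<close>

lemma centralizer_abelian:
  assumes u: "u \<in> \<Phi>" "u \<bullet> \<alpha> = 0" and no: "\<And>\<beta>. \<beta> \<in> \<Phi> \<Longrightarrow> cartan \<beta> \<alpha> = 1 \<Longrightarrow> u + \<beta> \<notin> R"
    and v: "v \<in> \<Phi>" "v \<bullet> \<alpha> = 0" and nov: "\<And>\<beta>. \<beta> \<in> \<Phi> \<Longrightarrow> cartan \<beta> \<alpha> = 1 \<Longrightarrow> v + \<beta> \<notin> R"
  shows "u + v \<notin> R"
proof
  assume uv: "u + v \<in> R"
  have aR: "\<alpha> \<in> R" and ap: "\<alpha> \<in> \<Phi>" using a P_subset P_pos by auto
  obtain c d where cd: "c \<in> \<Phi>" "d \<in> \<Phi>" "v = c + d" "cartan c \<alpha> = 1" "cartan d \<alpha> = -1"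
    using orthogonal_split[OF v centralizer_support[OF v nov]] by blast
  have "c + u \<in> R \<or> d + u \<in> R"
    using root_triple[of c d u] cd uv u v pos_R pos_add_ne_0 by (metis add.commute)
  then have du: "d + u \<in> R" using no cd by (metis add.commute)
  have "cartan (d + u) \<alpha> = -1" using cd cartan_0_iff[OF aR, of u] u by (simp add: cartan_add)
  then have "(d + u) \<bullet> \<alpha> < 0" using cartan_neg_iff[OF aR, of "d + u"] by simp
  then have "(d + u) + \<alpha> \<in> R" using root_add[OF du aR] pos_add_ne_0[OF pos_add[OF cd(2) u(1) du] ap] by blast
  moreover have "d \<bullet> \<alpha> < 0" using cartan_neg_iff[OF aR, of d] cd by simp
  then have "d + \<alpha> \<in> R" using root_add[of d \<alpha>] aR cd pos_add_ne_0[OF cd(2) ap] pos_R by blast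
  then have "d + \<alpha> \<in> \<Phi>" using pos_add cd ap by blast
  moreover have "cartan (d + \<alpha>) \<alpha> = 1" using cd cartan_self[OF aR] by (simp add: cartan_add)
  ultimately show False using no[of "d + \<alpha>"] by (simp add: algebra_simps)
qed

end

text \<open>A positive root outside \<open>heis R P\<close> is orthogonal to
  \<open>\<theta>\<close>, and in an abelian ideal it must be compatible with \<open>?M\<close>;
  hence every candidate lies in \<open>?M \<union> ?K\<close>. It remains to see that this union is
  itself a candidate.\<close>

lemma I_max_eq:
  assumes alpha: "\<alpha> \<in> long_simple R P"
  shows "I_max R P \<alpha> = I_min R P \<alpha> \<union> {\<nu>\<in>\<Phi>. \<nu> \<bullet> \<theta> = 0 \<and> (\<forall>\<eta>\<in>I_min R P \<alpha>. \<nu> + \<eta> \<notin> R)}"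
    (is "_ = ?M \<union> ?K")
proof -
  define w where "w = w_mu R P \<alpha>"
  note A = alpha_props[OF alpha w_def]
  have aP: "\<alpha> \<in> P" "\<alpha> \<bullet> \<alpha> = \<theta> \<bullet> \<theta>" using A by auto
  note weyl = w_weyl[OF alpha w_def] and wpos = w_pos[OF alpha w_def]
  have Mh: "?M \<subseteq> heis R P" using I_min_heis[OF alpha w_def] .
  have Mpos: "?M \<subseteq> \<Phi>" using Mh heis_pos by blast
  have up: "upper_ideal R P ?M" using I_min_upper[OF alpha w_def] .
  have K1: "\<rho> + \<nu> \<in> ?M \<union> ?K" if n: "\<nu> \<in> ?K" and r: "\<rho> \<in> \<Phi>" "\<rho> + \<nu> \<in> \<Phi>" for \<nu> \<rho>
  proof -
    have np: "\<nu> \<in> \<Phi>" using n by blast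
    have c: "\<rho> + \<nu> + \<eta> \<notin> R" if e: "\<eta> \<in> ?M" for \<eta>
    proof
      assume s: "\<rho> + \<nu> + \<eta> \<in> R"
      have ep: "\<eta> \<in> \<Phi>" using e Mpos by blast
      have "\<rho> + \<eta> \<in> R \<or> \<nu> + \<eta> \<in> R"
        using root_triple[of \<rho> \<nu> \<eta>] s r np ep pos_R pos_add_ne_0 by blast
      then have re: "\<rho> + \<eta> \<in> R" using n e by blast
      then have "\<rho> + \<eta> \<in> ?M" using up e r(1) pos_add[OF r(1) ep] unfolding upper_ideal_def by blast
      then have "\<nu> + (\<rho> + \<eta>) \<notin> R" using n by blast
      then show False using s by (simp add: algebra_simps)
    qed
    show ?thesis
    proof (cases "(\<rho> + \<nu>) \<bullet> \<theta> = 0")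
      case True
      then show ?thesis using c r by blast
    next
      case False
      then have h: "\<rho> + \<nu> \<in> heis R P" using r highest_inner_nonneg[OF r(2)] by (simp add: heis_def)
      show ?thesis
      proof (cases "\<rho> + \<nu> = \<theta>")
        case True
        then show ?thesis using theta_I_min[OF alpha w_def] by simp
      next
        case False
        \<comment> \<open>The partner of \<open>\<rho> + \<nu>\<close> gives the root
          \<open>\<theta>\<close> when added to it, so compatibility keeps the partner out of
          \<open>?M\<close> and the pairing puts \<open>\<rho> + \<nu>\<close> in.\<close>
        have "\<rho> + \<nu> + (\<theta> - (\<rho> + \<nu>)) \<in> R" using highest_R by simp
        then have "\<theta> - (\<rho> + \<nu>) \<notin> ?M" using c by blast
        then show ?thesis using I_min_pair[OF alpha w_def h False] by blast
      qed
    qed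
  qed
  have upper: "upper_ideal R P (?M \<union> ?K)"
    unfolding upper_ideal_def
  proof (intro conjI ballI impI)
    show "?M \<union> ?K \<subseteq> \<Phi>" using Mpos by blast
    fix \<gamma> \<rho> assume "\<gamma> \<in> ?M \<union> ?K" "\<rho> \<in> \<Phi>" "\<rho> + \<gamma> \<in> \<Phi>"
    then show "\<rho> + \<gamma> \<in> ?M \<union> ?K" using K1 up unfolding upper_ideal_def by blast
  qed
  have K2: "\<nu>1 + \<nu>2 \<notin> R" if n: "\<nu>1 \<in> ?K" "\<nu>2 \<in> ?K" for \<nu>1 \<nu>2
  proof -
    have *: "w \<nu> \<in> \<Phi> \<and> w \<nu> \<bullet> \<alpha> = 0 \<and> (\<forall>\<beta>\<in>\<Phi>. cartan \<beta> \<alpha> = 1 \<longrightarrow> w \<nu> + \<beta> \<notin> R)" if nu: "\<nu> \<in> ?K" for \<nu>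
    proof (intro conjI ballI impI)
      show "w \<nu> \<in> \<Phi>" using wpos nu by blast
      show "w \<nu> \<bullet> \<alpha> = 0" using weyl_inner[OF weyl, of \<nu> \<theta>] w_theta[OF alpha w_def] nu by simp
      fix \<beta> assume b: "\<beta> \<in> \<Phi>" "cartan \<beta> \<alpha> = 1"
      obtain v where v: "v \<in> weyl R" "\<And>x. v (w x) = x" "\<And>x. w (v x) = x" using weyl_inverse[OF weyl] by blast
      \<comment> \<open>Pulled back by the inverse of \<open>w\<close>, the positive root
        \<open>\<beta>\<close> becomes a member of \<open>?M\<close>, so the defining condition of
        \<open>?K\<close> applies.\<close>
      have "cartan (v \<beta>) \<theta> = 1" using w_cartan[OF alpha w_def, of "v \<beta>"] v b by simp
      then have "v \<beta> \<in> heis R P"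
        using weyl_root[OF v(1) pos_R[OF b(1)]] cartan_pos_iff[OF highest_R, of "v \<beta>"] by (simp add: heis_iff)
      then have "v \<beta> \<in> ?M" using mem_I_min_iff[OF alpha w_def] v(3) b by simp
      then have no: "\<nu> + v \<beta> \<notin> R" using nu by blast
      show "w \<nu> + \<beta> \<notin> R"
      proof
        assume "w \<nu> + \<beta> \<in> R"
        then have "v (w \<nu> + \<beta>) \<in> R" using weyl_root v(1) by blast
        moreover have "v (w \<nu> + \<beta>) = \<nu> + v \<beta>" using weyl_linear[OF v(1)] v(2) by (simp add: linear_add)
        ultimately show False using no by simp
      qed
    qed
    have "w \<nu>1 + w \<nu>2 \<notin> R"
      by (rule centralizer_abelian[OF aP]) (use *[OF n(1)] *[OF n(2)] in blast)+
    then show ?thesis using weyl_root[OF weyl, of "\<nu>1 + \<nu>2"] unfolding w_add[OF alpha w_def] by blast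
  qed
  have ab: "\<gamma>1 + \<gamma>2 \<notin> R" if g: "\<gamma>1 \<in> ?M \<union> ?K" "\<gamma>2 \<in> ?M \<union> ?K" for \<gamma>1 \<gamma>2
  proof -
    have sym: "x + y \<notin> R" if "x \<in> ?M" "y \<in> ?K" for x y using that
      by (simp add: add.commute[of x y])
    consider "\<gamma>1 \<in> ?M" "\<gamma>2 \<in> ?M" | "\<gamma>1 \<in> ?M" "\<gamma>2 \<in> ?K" | "\<gamma>1 \<in> ?K" "\<gamma>2 \<in> ?M" | "\<gamma>1 \<in> ?K" "\<gamma>2 \<in> ?K"
      using g by blast
    then show ?thesis
    proof cases
      case 3
      then show ?thesis using sym[of \<gamma>2 \<gamma>1] by (simp add: add.commute)
    qed (rule I_min_abelian[OF alpha w_def] sym K2; assumption)+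
  qed
  have "?K \<inter> heis R P = {}" by (auto simp: heis_def)
  then have int: "(?M \<union> ?K) \<inter> heis R P = ?M" using Mh by blast
  have cand: "I_max_cand R P \<alpha> (?M \<union> ?K)"
    unfolding I_max_cand_def abelian_ideal_def
    using upper ab int theta_I_min[OF alpha w_def] pos_R by blast
  have sub: "J \<subseteq> ?M \<union> ?K" if J: "I_max_cand R P \<alpha> J" for J
  proof
    fix \<nu> assume n: "\<nu> \<in> J"
    have Jp: "J \<subseteq> \<Phi>" and Jh: "J \<inter> heis R P = ?M"
      and Ja: "\<And>x y. x \<in> J \<Longrightarrow> y \<in> J \<Longrightarrow> x + y \<notin> \<Phi>"
      using J unfolding I_max_cand_def abelian_ideal_def upper_ideal_def by blast+
    show "\<nu> \<in> ?M \<union> ?K"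
    proof (cases "\<nu> \<in> heis R P")
      case False
      then have "\<nu> \<bullet> \<theta> = 0" using n Jp highest_inner_nonneg[of \<nu>] by (auto simp: heis_def)
      moreover have "\<nu> + \<eta> \<notin> R" if "\<eta> \<in> ?M" for \<eta>
        using Ja[of \<nu> \<eta>] n Jh that pos_add[of \<nu> \<eta>] Jp Mpos by blast
      ultimately show ?thesis using n Jp by blast
    qed (use n Jh in blast)
  qed
  show ?thesis
    unfolding I_max_def
  proof (rule the_equality)
    show "I_max_cand R P \<alpha> (?M \<union> ?K) \<and> (\<forall>J. I_max_cand R P \<alpha> J \<and> ?M \<union> ?K \<subseteq> J \<longrightarrow> J = ?M \<union> ?K)"
      using cand sub by blast
  qed (use cand sub in blast)
qed

end

section \<open>Induced paths and connectedness\<close>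

text \<open>Induced paths: non-consecutive vertices are not adjacent.\<close>
fun ipath :: "'a::euclidean_space list \<Rightarrow> bool" where
  "ipath (x # y # zs) \<longleftrightarrow> x \<noteq> y \<and> x \<bullet> y \<noteq> 0 \<and> (\<forall>z\<in>set zs. x \<bullet> z = 0) \<and> ipath (y # zs)"
| "ipath _ \<longleftrightarrow> True"

lemma ipath_suffix: "ipath (xs @ ys) \<Longrightarrow> ipath ys"
proof (induction xs)
  case (Cons x xs)
  then show ?case by (cases "xs @ ys") auto
qed simp

text \<open>To prepend \<open>x\<close>, cut the given induced path at its last vertex not
  orthogonal to \<open>x\<close>; all later vertices are then orthogonal to \<open>x\<close>. If
  this vertex is \<open>x\<close> itself, the remaining path already starts there.\<close>

lemma ipath_exists:
  assumes "dynkin_connected T" "0 \<notin> T" "a \<in> T" "b \<in> T"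
  obtains xs where "ipath xs" "xs \<noteq> []" "hd xs = a" "last xs = b" "set xs \<subseteq> T"
proof -
  let ?E = "{(x, y). x \<in> T \<and> y \<in> T \<and> x \<noteq> y \<and> x \<bullet> y \<noteq> 0}"
  have "(a, b) \<in> ?E\<^sup>*" using assms unfolding dynkin_connected_def by blast
  then have "\<exists>xs. ipath xs \<and> xs \<noteq> [] \<and> hd xs = a \<and> last xs = b \<and> set xs \<subseteq> T"
  proof (induction rule: converse_rtrancl_induct)
    case base
    show ?case using assms by (intro exI[of _ "[b]"]) simp
  next
    case (step x y)
    then obtain xs where xs: "ipath xs" "xs \<noteq> []" "hd xs = y" "last xs = b" "set xs \<subseteq> T" by blast
    have "\<exists>z\<in>set xs. x \<bullet> z \<noteq> 0" using xs step(1) by (intro bexI[of _ y]) auto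
    then obtain us z vs where s: "xs = us @ z # vs" "x \<bullet> z \<noteq> 0" "\<forall>v\<in>set vs. \<not> x \<bullet> v \<noteq> 0"
      by (rule split_list_last_propE) blast
    have p: "ipath (z # vs)" "last (z # vs) = b" "set (z # vs) \<subseteq> T"
      using xs ipath_suffix[of us "z # vs"] unfolding s(1) by auto
    show ?case
    proof (cases "z = x")
      case True
      then show ?thesis using p by (intro exI[of _ "z # vs"]) simp
    next
      case False
      then show ?thesis using p s step(1) by (intro exI[of _ "x # z # vs"]) auto
    qed
  qed
  then show ?thesis using that by blast
qed

lemma dynkin_connectedI_ipath:
  assumes "\<And>a b. a \<in> T \<Longrightarrow> b \<in> T \<Longrightarrow> \<exists>xs. ipath xs \<and> xs \<noteq> [] \<and> hd xs = a \<and> last xs = b \<and> set xs \<subseteq> T"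
  shows "dynkin_connected T"
proof -
  let ?E = "{(x, y). x \<in> T \<and> y \<in> T \<and> x \<noteq> y \<and> x \<bullet> y \<noteq> 0}"
  have *: "(hd xs, last xs) \<in> ?E\<^sup>*" if "ipath xs" "xs \<noteq> []" "set xs \<subseteq> T" for xs
    using that
  proof (induction xs rule: ipath.induct)
    case (1 x y zs)
    then have "(x, y) \<in> ?E" by simp
    moreover have "(hd (y # zs), last (y # zs)) \<in> ?E\<^sup>*" by (rule "1.IH") (use "1.prems" in simp_all)
    then have "(y, last (y # zs)) \<in> ?E\<^sup>*" by (simp only: list.sel)
    ultimately have "(x, last (y # zs)) \<in> ?E\<^sup>*" by (rule converse_rtrancl_into_rtrancl)
    then show ?case unfolding last_ConsR[OF list.distinct(2)] list.sel .
  qed auto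
  show ?thesis
    unfolding dynkin_connected_def
  proof (intro ballI)
    fix a b assume "a \<in> T" "b \<in> T"
    then obtain xs where xs: "ipath xs" "xs \<noteq> []" "hd xs = a" "last xs = b" "set xs \<subseteq> T" using assms by blast
    show "(a, b) \<in> ?E\<^sup>*" using *[OF xs(1,2,5)] unfolding xs(3,4) .
  qed
qed

section \<open>Long simple roots and paths in the Dynkin diagram\<close>

context irreducible_based_root_system
begin

text \<open>The long root \<open>r\<close> arises from a long simple root by reflecting along the path; its Cartan
  integer at the next vertex stays \<open>\<le> -2\<close>, which is impossible at a long vertex.\<close>
lemma short_path:
  assumes "ipath (y # zs)" "set (y # zs) \<subseteq> P" "r \<in> \<Phi>" "r \<bullet> r = \<theta> \<bullet> \<theta>" "cartan r y \<le> -2" "\<forall>z\<in>set zs. r \<bullet> z = 0"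
  shows "\<forall>z\<in>set (y # zs). z \<bullet> z \<noteq> \<theta> \<bullet> \<theta>"
  using assms
proof (induction zs arbitrary: y r)
  case (Cons z zs)
  have y: "y \<in> P" "y \<in> R" "y \<in> \<Phi>" and z: "z \<in> P" "z \<in> R" using Cons.prems P_subset P_pos by auto
  have ry: "r \<noteq> y" using Cons.prems(5) cartan_self[OF y(2)] by auto
  have "r \<noteq> - y" using Cons.prems(3) y(3) pos_not_neg by auto
  then have "y \<bullet> y \<noteq> \<theta> \<bullet> \<theta>"
    using cartan_long[OF y(2) _ pos_R[OF Cons.prems(3)] ry] Cons.prems(5) by auto
  moreover have "\<forall>v\<in>set (z # zs). v \<bullet> v \<noteq> \<theta> \<bullet> \<theta>"
  proof (rule Cons.IH[of _ "refl y r"])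
    show "refl y r \<in> \<Phi>" using refl_simple_pos Cons.prems(3) y ry by blast
    show "refl y r \<bullet> refl y r = \<theta> \<bullet> \<theta>"
      using orthogonal_transformation_refl[of y] Cons.prems(4) by (simp add: orthogonal_transformation_def)
    have "y \<bullet> z < 0" using simple_inner_le_0[of y z] y z Cons.prems(1) by auto
    then have "cartan y z < 0" using cartan_neg_iff z by blast
    moreover obtain n :: int where n: "cartan y z = of_int n" using cartan_Ints y z by (metis Ints_cases)
    ultimately have "cartan y z \<le> -1" by simp
    then have "2 * 1 \<le> (- cartan r y) * (- cartan y z)" using Cons.prems(5) by (intro mult_mono) auto
    moreover have "cartan (refl y r) z = - (cartan r y * cartan y z)"
      using Cons.prems(6) by (simp add: cartan_def refl_def inner_diff_left)
    ultimately show "cartan (refl y r) z \<le> -2" by simp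
    show "\<forall>v\<in>set zs. refl y r \<bullet> v = 0" using Cons.prems by (auto simp: refl_def inner_diff_left)
  qed (use Cons.prems in auto)
  ultimately show ?case by simp
next
  case Nil
  have y: "y \<in> P" "y \<in> R" "y \<in> \<Phi>" using Nil.prems P_subset P_pos by auto
  have ry: "r \<noteq> y" using Nil.prems(5) cartan_self[OF y(2)] by auto
  have "r \<noteq> - y" using Nil.prems(3) y(3) pos_not_neg by auto
  then show ?case using cartan_long[OF y(2) _ pos_R[OF Nil.prems(3)] ry] Nil.prems(5) by auto
qed

lemma adjacent_long_cartan:
  assumes "x \<in> P" "y \<in> P" "x \<noteq> y" "x \<bullet> y \<noteq> 0" "x \<bullet> x = \<theta> \<bullet> \<theta>"
  shows "cartan y x = -1"
proof -
  have R: "x \<in> R" "y \<in> R" using assms P_subset by auto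
  have "y \<bullet> x < 0" using simple_inner_le_0[of x y] assms by (simp add: inner_commute)
  then have "cartan y x < 0" using cartan_neg_iff R by blast
  moreover have "y \<noteq> - x" using pos_not_neg[of x] assms(1,2) P_pos by blast
  ultimately show ?thesis using cartan_long[OF R(1) assms(5) R(2)] assms(3) by auto
qed

text \<open>At a step from a long \<open>x\<close> to a shorter \<open>y\<close> the integer
  \<open>cartan x y\<close> is at most -2, and \<open>short_path\<close> then excludes long vertices
  from there on, including the last one.\<close>

lemma long_path:
  assumes "ipath xs" "xs \<noteq> []" "set xs \<subseteq> P" "hd xs \<bullet> hd xs = \<theta> \<bullet> \<theta>" "last xs \<bullet> last xs = \<theta> \<bullet> \<theta>"
  shows "\<forall>x\<in>set xs. x \<bullet> x = \<theta> \<bullet> \<theta>"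
  using assms
proof (induction xs rule: ipath.induct)
  case (1 x y zs)
  have xy: "x \<in> P" "y \<in> P" "x \<in> R" "y \<in> R" "x \<noteq> y" "x \<bullet> y \<noteq> 0" "x \<bullet> x = \<theta> \<bullet> \<theta>"
    using "1.prems" P_subset by auto
  show ?case
  proof (cases "y \<bullet> y = \<theta> \<bullet> \<theta>")
    case True
    have "\<forall>z\<in>set (y # zs). z \<bullet> z = \<theta> \<bullet> \<theta>" by (rule "1.IH") (use "1.prems" True in simp_all)
    then show ?thesis using xy by simp
  next
    case False
    then have less: "y \<bullet> y < x \<bullet> x" using highest_long[of y] xy by auto
    have "cartan y x = -1" by (rule adjacent_long_cartan) (rule xy)+
    then have "2 * (x \<bullet> y) = - (x \<bullet> x)"
      using inner_pos[OF xy(3)] by (simp add: cartan_def inner_commute divide_eq_eq)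
    then have "cartan x y = - (x \<bullet> x) / (y \<bullet> y)" by (simp add: cartan_def)
    also have "\<dots> < -1" using less inner_pos[OF xy(4)] by (simp add: divide_simps)
    finally have lt: "cartan x y < -1" .
    obtain n :: int where n: "cartan x y = of_int n" using cartan_Ints xy by (metis Ints_cases)
    with lt have "n < -1" by (metis of_int_less_iff of_int_minus of_int_1)
    then have "cartan x y \<le> -2" using n by simp
    then have "\<forall>z\<in>set (y # zs). z \<bullet> z \<noteq> \<theta> \<bullet> \<theta>"
      using short_path[of y zs x] "1.prems" xy P_pos by auto
    moreover have "last (y # zs) \<bullet> last (y # zs) = \<theta> \<bullet> \<theta>" using "1.prems" by simp
    ultimately show ?thesis using last_in_set[of "y # zs"] by blast
  qed
qed auto

lemma long_simple_subset: "long_simple R P \<subseteq> P"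
  by (auto simp: long_simple_def)

lemma long_simple_connected: "dynkin_connected (long_simple R P)"
proof (rule dynkin_connectedI_ipath)
  fix a b assume ab: "a \<in> long_simple R P" "b \<in> long_simple R P"
  then have abP: "a \<in> P" "b \<in> P" "0 \<notin> P" using long_simple_subset P_subset zero_notin_R by blast+
  obtain xs where xs: "ipath xs" "xs \<noteq> []" "hd xs = a" "last xs = b" "set xs \<subseteq> P"
    by (rule ipath_exists[OF P_connected abP(3,1,2)])
  have "\<forall>x\<in>set xs. x \<bullet> x = \<theta> \<bullet> \<theta>"
    by (rule long_path[OF xs(1,2,5)]) (use ab xs(3,4) in \<open>simp_all add: long_simple_iff\<close>)
  then have "set xs \<subseteq> long_simple R P" using xs(5) by (auto simp: long_simple_iff)
  then show "\<exists>xs. ipath xs \<and> xs \<noteq> [] \<and> hd xs = a \<and> last xs = b \<and> set xs \<subseteq> long_simple R P" using xs by blast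
qed

text \<open>Connected sets of simple roots are closed under intersection, so one of least
  cardinality among those containing \<open>S\<close> is the smallest.\<close>

lemma conn_hull:
  assumes "S \<subseteq> long_simple R P"
  shows "S \<subseteq> conn_hull R P S" "conn_hull R P S \<subseteq> long_simple R P"
    and "S \<subseteq> T \<Longrightarrow> T \<subseteq> long_simple R P \<Longrightarrow> dynkin_connected T \<Longrightarrow> conn_hull R P S \<subseteq> T"
proof -
  let ?Q = "\<lambda>T. S \<subseteq> T \<and> T \<subseteq> long_simple R P \<and> dynkin_connected T"
  have fin: "finite (long_simple R P)" using finite_P long_simple_subset finite_subset by blast
  have "?Q (long_simple R P)" using assms long_simple_connected by blast
  then obtain T0 where T0: "?Q T0" "\<And>T. ?Q T \<Longrightarrow> card T0 \<le> card T"
    using ex_has_least_nat[of ?Q "long_simple R P" card] by blast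
  have min: "T0 \<subseteq> T" if T: "?Q T" for T
  proof -
    have "?Q (T0 \<inter> T)" using T T0(1) dynkin_connected_Int[of T0 T] long_simple_subset by blast
    then have "card T0 \<le> card (T0 \<inter> T)" using T0(2) by blast
    moreover have "finite T0" using T0(1) fin finite_subset by blast
    ultimately have "T0 \<inter> T = T0" by (meson Int_lower1 card_seteq)
    then show ?thesis by blast
  qed
  have "conn_hull R P S = T0"
    unfolding conn_hull_def
    by (rule the_equality) (use T0(1) min in \<open>blast, meson subset_antisym\<close>)
  then show "S \<subseteq> conn_hull R P S" "conn_hull R P S \<subseteq> long_simple R P"
    and "S \<subseteq> T \<Longrightarrow> T \<subseteq> long_simple R P \<Longrightarrow> dynkin_connected T \<Longrightarrow> conn_hull R P S \<subseteq> T"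
    using T0(1) min by blast+
qed

text \<open>The product \<open>refl x \<circ> refl y\<close> sends \<open>x\<close> to
  \<open>y\<close> by way of \<open>x + y\<close>, and the only positive roots it makes negative are
  \<open>y\<close> and \<open>x + y\<close>. Neither is orthogonal to \<open>x\<close>, while the
  image under \<open>w_mu R P x\<close> of a root orthogonal to \<open>\<theta>\<close> is; so
  admissibility is inherited.\<close>

lemma w_mu_step:
  assumes x: "x \<in> long_simple R P" and y: "y \<in> long_simple R P" and xy: "x \<noteq> y" "x \<bullet> y \<noteq> 0"
  shows "w_mu R P y v = refl x (refl y (w_mu R P x v))"
proof -
  note X = alpha_props[OF x refl] and Y = alpha_props[OF y refl]
  let ?w = "w_mu R P x"
  have c: "cartan y x = -1" "cartan x y = -1"
    using adjacent_long_cartan[OF X(1) Y(1)] adjacent_long_cartan[OF Y(1) X(1)] xy X(4) Y(4)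
    by (auto simp: inner_commute)
  have ryx: "refl y x = x + y" using c by (simp add: refl_cartan)
  have "admissible y (refl x \<circ> (refl y \<circ> ?w))"
    unfolding admissible_def
  proof (intro conjI ballI impI)
    show "refl x \<circ> (refl y \<circ> ?w) \<in> weyl R"
      by (intro weyl_comp weyl_refl X Y w_weyl[OF x refl])
    show "(refl x \<circ> (refl y \<circ> ?w)) \<theta> = y"
      using w_theta[OF x refl] c cartan_self[OF X(2)] by (simp add: ryx) (simp add: refl_cartan cartan_add)
    fix \<gamma> assume g: "\<gamma> \<in> \<Phi>" "\<gamma> \<bullet> \<theta> = 0"
    let ?u = "?w \<gamma>"
    have u: "?u \<in> \<Phi>" using w_pos[OF x refl] g by blast
    have ux: "cartan ?u x = 0" using w_cartan[OF x refl, of \<gamma>] g(2) by (simp add: cartan_def)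
    have "?u \<noteq> y" using ux c by auto
    then have ru: "refl y ?u \<in> \<Phi>" using refl_simple_pos u Y by blast
    have "refl y ?u \<noteq> x"
    proof
      assume "refl y ?u = x"
      then have "?u = x + y" using ryx by (metis refl_refl)
      then show False using ux c cartan_self[OF X(2)] by (simp add: cartan_add)
    qed
    then show "(refl x \<circ> (refl y \<circ> ?w)) \<gamma> \<in> \<Phi>" using refl_simple_pos ru X by simp
  qed
  then show ?thesis using w_mu_eq[OF Y(2,4)] by (metis comp_apply)
qed

text \<open>The invariant is passed on with \<open>m + x\<close> in place of \<open>m\<close>, so a path that has left the set of \<open>\<alpha>\<close> with
  \<open>\<eta> \<in> I_min R P \<alpha>\<close> never enters it again.\<close>
lemma negative_path:
  assumes "ipath (x # zs)" "set (x # zs) \<subseteq> long_simple R P" "w_mu R P x \<eta> = - m" "m \<in> \<Phi>"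
    "cartan m x = -1" "\<forall>z\<in>set zs. m \<bullet> z = 0"
  shows "\<forall>z\<in>set (x # zs). w_mu R P z \<eta> \<notin> \<Phi>"
  using assms
proof (induction zs arbitrary: x m)
  case Nil
  then show ?case using pos_not_neg by simp
next
  case (Cons y zs)
  have xy: "x \<in> long_simple R P" "y \<in> long_simple R P" "x \<noteq> y" "x \<bullet> y \<noteq> 0" using Cons.prems by auto
  note X = alpha_props[OF xy(1) refl] and Y = alpha_props[OF xy(2) refl]
  have "\<forall>z\<in>set (y # zs). w_mu R P z \<eta> \<notin> \<Phi>"
  proof (rule Cons.IH)
    have rl: "refl v (- u) = - refl v u" for u v :: 'a
      using orthogonal_transformation_refl[of v] by (simp add: orthogonal_transformation_def linear_neg)
    have rx: "refl x m = m + x" using Cons.prems(5) by (simp add: refl_cartan)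
    have "refl y m = m" using Cons.prems(6) by (simp add: refl_orthogonal_vec)
    then show "w_mu R P y \<eta> = - (m + x)" using w_mu_step[OF xy, of \<eta>] Cons.prems(3) rx by (simp add: rl)
    have "m \<noteq> x" using Cons.prems(5) cartan_self[OF X(2)] by auto
    then show "m + x \<in> \<Phi>" using refl_simple_pos[OF Cons.prems(4) X(1)] rx by simp
    have "cartan x y = -1" using adjacent_long_cartan[OF Y(1) X(1)] xy Y(4) by (auto simp: inner_commute)
    then show "cartan (m + x) y = -1" using Cons.prems(6) by (simp add: cartan_add) (simp add: cartan_def)
    show "\<forall>z\<in>set zs. (m + x) \<bullet> z = 0" using Cons.prems(1,6) by (auto simp: inner_add_left)
  qed (use Cons.prems in auto)
  then show ?case using Cons.prems(3,4) pos_not_neg by simp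
qed

text \<open>Where \<open>\<eta>\<close> leaves the set, its image \<open>?u\<close> at
  \<open>x\<close> is not \<open>y\<close>, since their Cartan integers at \<open>x\<close> are 1
  and -1. Thus \<open>refl y ?u\<close> is positive and can only become negative by being
  \<open>x\<close>. The image at \<open>y\<close> is \<open>- x\<close>, from which
  \<open>negative_path\<close> takes over.\<close>

lemma I_min_path:
  assumes "ipath xs" "xs \<noteq> []" "set xs \<subseteq> long_simple R P" "\<eta> \<in> I_min R P (hd xs)" "\<eta> \<in> I_min R P (last xs)"
  shows "\<forall>x\<in>set xs. \<eta> \<in> I_min R P x"
  using assms
proof (induction xs rule: ipath.induct)
  case (1 x y zs)
  have xy: "x \<in> long_simple R P" "y \<in> long_simple R P" "x \<noteq> y" "x \<bullet> y \<noteq> 0" using "1.prems" by auto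
  note X = alpha_props[OF xy(1) refl] and Y = alpha_props[OF xy(2) refl]
  have mem: "\<eta> \<in> I_min R P z \<longleftrightarrow> \<eta> = \<theta> \<or> (\<eta> \<in> heis R P \<and> w_mu R P z \<eta> \<in> \<Phi>)" if "z \<in> long_simple R P" for z
    using mem_I_min_iff[OF that refl] .
  show ?case
  proof (cases "\<eta> \<in> I_min R P y")
    case True
    have "\<forall>z\<in>set (y # zs). \<eta> \<in> I_min R P z" by (rule "1.IH") (use "1.prems" True in simp_all)
    then show ?thesis using "1.prems" by simp
  next
    case False
    then have ne: "\<eta> \<noteq> \<theta>" using mem xy by blast
    then have h: "\<eta> \<in> heis R P" and p: "w_mu R P x \<eta> \<in> \<Phi>"
      using "1.prems"(4) mem[OF xy(1)] by simp_all
    let ?u = "w_mu R P x \<eta>"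
    have n: "refl x (refl y ?u) \<notin> \<Phi>" using False h mem[OF xy(2)] w_mu_step[OF xy] by simp
    have c: "cartan y x = -1" "cartan x y = -1"
      using adjacent_long_cartan[OF X(1) Y(1)] adjacent_long_cartan[OF Y(1) X(1)] xy X(4) Y(4)
      by (auto simp: inner_commute)
    have "?u \<noteq> y" using w_cartan[OF xy(1) refl, of \<eta>] heis_cartan[OF h ne] c by auto
    then have "refl y ?u \<in> \<Phi>" using refl_simple_pos p Y by blast
    then have "refl y ?u = x" using n refl_simple_neg X by blast
    then have "w_mu R P y \<eta> = - x" using w_mu_step[OF xy] refl_self pos_ne_0[OF X(3)] by simp
    then have "\<forall>z\<in>set (y # zs). w_mu R P z \<eta> \<notin> \<Phi>"
      using negative_path[of y zs \<eta> x] "1.prems" X c by simp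
    moreover have "w_mu R P (last (y # zs)) \<eta> \<in> \<Phi>"
    proof -
      have "last (y # zs) \<in> set (y # zs)" by (rule last_in_set) simp
      then have "last (y # zs) \<in> long_simple R P" using "1.prems"(3) by auto
      then show ?thesis using mem[of "last (y # zs)"] ne "1.prems"(5) by simp
    qed
    ultimately show ?thesis using last_in_set[of "y # zs"] by blast
  qed
qed auto

lemma I_min_set_connected: "dynkin_connected {\<alpha> \<in> long_simple R P. \<eta> \<in> I_min R P \<alpha>}" (is "dynkin_connected ?T")
proof (rule dynkin_connectedI_ipath)
  fix a b assume ab: "a \<in> ?T" "b \<in> ?T"
  then have abL: "a \<in> long_simple R P" "b \<in> long_simple R P" "0 \<notin> long_simple R P"
    using long_simple_subset P_subset zero_notin_R by blast+
  obtain xs where xs: "ipath xs" "xs \<noteq> []" "hd xs = a" "last xs = b" "set xs \<subseteq> long_simple R P"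
    by (rule ipath_exists[OF long_simple_connected abL(3,1,2)])
  have "\<forall>x\<in>set xs. \<eta> \<in> I_min R P x"
    by (rule I_min_path[OF xs(1,2,5)]) (use ab xs(3,4) in simp_all)
  then show "\<exists>xs. ipath xs \<and> xs \<noteq> [] \<and> hd xs = a \<and> last xs = b \<and> set xs \<subseteq> ?T"
    using xs by blast
qed

lemma Inter_I_min:
  assumes "S \<subseteq> long_simple R P"
  shows "(\<Inter>\<alpha>\<in>S. I_min R P \<alpha>) = (\<Inter>\<alpha>\<in>conn_hull R P S. I_min R P \<alpha>)"
proof
  show "(\<Inter>\<alpha>\<in>S. I_min R P \<alpha>) \<subseteq> (\<Inter>\<alpha>\<in>conn_hull R P S. I_min R P \<alpha>)"
  proof
    fix \<eta> assume "\<eta> \<in> (\<Inter>\<alpha>\<in>S. I_min R P \<alpha>)"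
    then have "conn_hull R P S \<subseteq> {\<alpha> \<in> long_simple R P. \<eta> \<in> I_min R P \<alpha>}"
      using conn_hull(3)[OF assms _ _ I_min_set_connected[of \<eta>]] assms by blast
    then show "\<eta> \<in> (\<Inter>\<alpha>\<in>conn_hull R P S. I_min R P \<alpha>)" by blast
  qed
qed (use conn_hull(1)[OF assms] in blast)

end

section \<open>Type A and unions of maximal ideals\<close>

lemma ipath_connected: "ipath xs \<Longrightarrow> dynkin_connected (set xs)"
proof (induction xs rule: ipath.induct)
  case (1 x y zs)
  then have "dynkin_connected (set (y # zs))" "x \<bullet> y \<noteq> 0" by simp_all
  then have "dynkin_connected ({x} \<union> set (y # zs))"
    by (intro dynkin_connected_Un[of _ _ x y]) simp_all
  then show ?case by (simp add: insert_commute)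
qed simp_all

lemma ipath_nth:
  assumes "ipath xs" "i < j" "j < length xs"
  shows "xs ! i \<bullet> xs ! j \<noteq> 0 \<longleftrightarrow> j = i + 1"
  using assms
proof (induction xs arbitrary: i j rule: ipath.induct)
  case (1 x y zs)
  obtain k where k: "j = Suc k" using "1.prems" by (cases j) auto
  show ?case
  proof (cases i)
    case 0
    then show ?thesis
    proof (cases k)
      case (Suc l)
      then have "zs ! l \<in> set zs" using k "1.prems" by simp
      then show ?thesis using Suc k 0 "1.prems"(1) by simp
    qed (use k "1.prems" in simp)
  next
    case (Suc h)
    have "(y # zs) ! h \<bullet> (y # zs) ! k \<noteq> 0 \<longleftrightarrow> k = h + 1"
      by (rule "1.IH") (use "1.prems" Suc k in simp_all)
    then show ?thesis using Suc k by simp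
  qed
qed simp_all

section \<open>Two simple roots not orthogonal to the highest root\<close>

context irreducible_based_root_system
begin

lemma cartan_sum_left: "cartan (\<Sum>C) z = (\<Sum>x\<in>C. cartan x z)"
  by (simp add: cartan_def inner_sum_left sum_divide_distrib sum_distrib_left)

text \<open>Any connected set of simple roots containing \<open>a\<close> and \<open>b\<close> sums to a root whose Cartan integer
  with \<open>\<theta>\<close> is at least 2, and \<open>\<theta>\<close> is the only such root.\<close>
lemma highest_two_simple:
  assumes a: "a \<in> P" "\<theta> \<bullet> a > 0" and b: "b \<in> P" "\<theta> \<bullet> b > 0" and ab: "a \<noteq> b"
  shows "C \<subseteq> P \<Longrightarrow> dynkin_connected C \<Longrightarrow> a \<in> C \<Longrightarrow> b \<in> C \<Longrightarrow> \<Sum>C = \<theta>"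
    and "cartan a \<theta> = 1"
proof -
  have one: "cartan x \<theta> = 1" if x: "x \<in> P" "\<theta> \<bullet> x > 0" and y: "y \<in> P" "\<theta> \<bullet> y > 0" "x \<noteq> y" for x y
  proof -
    \<comment> \<open>The highest root pairs positively with \<open>y\<close>, whereas
      \<open>x\<close> does not.\<close>
    have "x \<noteq> \<theta>" using simple_inner_le_0[of x y] x y by auto
    moreover have "x \<in> heis R P" using x P_subset by (auto simp: heis_iff inner_commute)
    ultimately show ?thesis using heis_cartan by blast
  qed
  show ca: "cartan a \<theta> = 1" using one a b ab by blast
  have cb: "cartan b \<theta> = 1" using one[of b a] a b ab by blast
  assume C: "C \<subseteq> P" "dynkin_connected C" "a \<in> C" "b \<in> C"
  have finC: "finite C" using C(1) finite_P finite_subset by blast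
  have s: "\<Sum>C \<in> \<Phi>" using sum_connected_root C by blast
  have "cartan x \<theta> \<ge> 0" if "x \<in> P" for x
    using highest_dominant[OF that] by (simp add: cartan_def inner_commute)
  then have "(\<Sum>x\<in>{a, b}. cartan x \<theta>) \<le> (\<Sum>x\<in>C. cartan x \<theta>)"
    using C finC by (intro sum_mono2) auto
  then have "cartan (\<Sum>C) \<theta> \<ge> 2" using ca cb ab by (simp add: cartan_sum_left)
  moreover have "\<Sum>C \<noteq> - \<theta>" using pos_not_neg[OF highest_root(1)] s by auto
  ultimately show "\<Sum>C = \<theta>" using cartan_long[OF highest_R refl pos_R[OF s]] by auto
qed

text \<open>As \<open>\<theta>\<close> is the sum of all simple roots and \<open>a\<close> has a
  neighbour, \<open>cartan \<theta> a\<close> is at most 2 - 1. Together with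
  \<open>cartan a \<theta> = 1\<close> this makes \<open>a\<close> at least as long as
  \<open>\<theta>\<close>.\<close>

lemma highest_two_simple_long:
  assumes a: "a \<in> P" "\<theta> \<bullet> a > 0" and b: "b \<in> P" "\<theta> \<bullet> b > 0" and ab: "a \<noteq> b"
  shows "a \<bullet> a = \<theta> \<bullet> \<theta>"
proof -
  have aR: "a \<in> R" using a P_subset by blast
  have th: "\<Sum>P = \<theta>" using highest_two_simple(1)[OF assms _ P_connected] a b by blast
  obtain x y where xy: "x \<in> {a}" "y \<in> P" "y \<notin> {a}" "x \<bullet> y \<noteq> 0"
    using dynkin_connected_cut[OF P_connected, of "{a}" a b] a b ab by blast
  then have y: "y \<in> P" "y \<noteq> a" "y \<bullet> a \<noteq> 0" by (auto simp: inner_commute)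
  have neg: "cartan z a \<le> 0" if "z \<in> P" "z \<noteq> a" for z
    using simple_inner_le_0[OF that(1) a(1) that(2)] inner_pos[OF aR] by (simp add: cartan_def divide_nonpos_pos)
  have "cartan y a < 0" using neg[OF y(1,2)] cartan_0_iff[OF aR, of y] y(3) by simp
  moreover obtain n :: int where n: "cartan y a = of_int n" using cartan_Ints[OF aR, of y] y P_subset by (metis Ints_cases subsetD)
  ultimately have cy: "cartan y a \<le> -1" by simp
  have "cartan \<theta> a = (\<Sum>x\<in>P. cartan x a)" using th cartan_sum_left by metis
  also have "\<dots> = (\<Sum>x\<in>{a, y}. cartan x a) + (\<Sum>x\<in>P - {a, y}. cartan x a)"
    by (rule sum.subset_diff[THEN trans, OF _ finite_P add.commute]) (use y a in auto)
  also have "\<dots> \<le> 1 + 0"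
  proof (rule add_mono)
    show "(\<Sum>x\<in>{a, y}. cartan x a) \<le> 1" using y cy cartan_self[OF aR] by simp
    show "(\<Sum>x\<in>P - {a, y}. cartan x a) \<le> 0" using neg by (intro sum_nonpos) auto
  qed
  finally have "cartan \<theta> a \<le> 1" by simp
  moreover have "2 * (\<theta> \<bullet> a) = \<theta> \<bullet> \<theta>"
    using highest_two_simple(2)[OF assms] inner_pos[OF highest_R] by (simp add: cartan_def inner_commute divide_eq_eq)
  ultimately have "\<theta> \<bullet> \<theta> \<le> a \<bullet> a" using inner_pos[OF aR] by (simp add: cartan_def divide_le_eq)
  then show ?thesis using highest_long[OF aR] by simp
qed

text \<open>The vertices of an induced path from \<open>a\<close> to \<open>b\<close> and all of
  \<open>P\<close> both sum to \<open>\<theta>\<close>, so the path exhausts \<open>P\<close>. Both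
  ends are long, hence so are all vertices, and every edge has Cartan integers -1.\<close>

lemma type_A_if_highest_two_simple:
  assumes a: "a \<in> P" "\<theta> \<bullet> a > 0" and b: "b \<in> P" "\<theta> \<bullet> b > 0" and ab: "a \<noteq> b"
  shows "type_A P"
proof -
  have P0: "0 \<notin> P" using P_subset zero_notin_R by blast
  obtain xs where xs: "ipath xs" "xs \<noteq> []" "hd xs = a" "last xs = b" "set xs \<subseteq> P"
    by (rule ipath_exists[OF P_connected P0 a(1) b(1)])
  have "\<Sum>P = \<theta>" using highest_two_simple(1)[OF assms _ P_connected] a b by blast
  moreover have "\<Sum>(set xs) = \<theta>"
    using highest_two_simple(1)[OF assms xs(5) ipath_connected[OF xs(1)]] xs(2-4) by auto
  ultimately have eq: "cf (\<Sum>P) x = cf (\<Sum>(set xs)) x" for x by simp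
  have setP: "set xs = P"
  proof
    show "P \<subseteq> set xs"
    proof
      fix x assume "x \<in> P"
      then show "x \<in> set xs" using eq[of x] xs(5) by (simp add: cf_sum_set split: if_splits)
    qed
  qed (rule xs(5))
  have long: "x \<bullet> x = \<theta> \<bullet> \<theta>" if "x \<in> P" for x
    using long_path[OF xs(1,2,5)] highest_two_simple_long[OF assms] highest_two_simple_long[OF b a ab[symmetric]]
      xs(3,4) that setP by simp
  have elem: "xs ! i \<in> P" if "i < length xs" for i using that setP by auto
  have adj: "cartan (xs ! i) (xs ! j) = (if j = i + 1 \<or> i = j + 1 then -1 else 0)"
    if ij: "i < length xs" "j < length xs" "i \<noteq> j" and ne: "xs ! i \<noteq> xs ! j" for i j
  proof -
    have iff: "xs ! i \<bullet> xs ! j \<noteq> 0 \<longleftrightarrow> j = i + 1 \<or> i = j + 1"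
    proof (cases "i < j")
      case False
      then have "j < i" using ij by simp
      then show ?thesis using ipath_nth[OF xs(1), of j i] ij by (auto simp: inner_commute)
    qed (use ipath_nth[OF xs(1), of i j] ij in auto)
    show ?thesis
    proof (cases "xs ! i \<bullet> xs ! j = 0")
      case True
      then show ?thesis using iff by (auto simp: cartan_def)
    next
      case False
      then have "xs ! j \<bullet> xs ! i \<noteq> 0" by (simp add: inner_commute)
      then have "cartan (xs ! i) (xs ! j) = -1"
        using adjacent_long_cartan[OF elem[OF ij(2)] elem[OF ij(1)]] ne long[OF elem[OF ij(2)]] by simp
      then show ?thesis using iff False by simp
    qed
  qed
  have dist: "distinct xs"
  proof -
    have "distinct xs" if "ipath xs" "0 \<notin> set xs" for xs :: "'a list"
      using that
    proof (induction xs rule: ipath.induct)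
      case (1 x y zs)
      have "distinct (y # zs)" by (rule "1.IH") (use "1.prems" in simp_all)
      moreover have "x \<notin> set zs" using "1.prems" by force
      ultimately show ?case using "1.prems" by simp
    qed simp_all
    then show ?thesis using xs(1) setP P0 by simp
  qed
  define n where "n = length xs"
  \<comment> \<open>The ordering in \<open>type_A\<close> starts at 1, list positions at 0.\<close>
  define f where "f = (\<lambda>i. xs ! (i - 1))"
  have "n \<ge> 1" using xs(2) by (cases xs) (simp_all add: n_def)
  moreover have "bij_betw f {1..n} P"
  proof -
    have "bij_betw (\<lambda>i. i - 1) {1..n} {..<n}"
      by (rule bij_betw_byWitness[where f' = Suc]) auto
    moreover have "bij_betw ((!) xs) {..<n} P" using bij_betw_nth[OF dist] n_def setP by blast
    ultimately have "bij_betw ((!) xs \<circ> (\<lambda>i. i - 1)) {1..n} P" by (rule bij_betw_trans)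
    then show ?thesis by (simp add: f_def comp_def)
  qed
  moreover have "cartan (f i) (f j) = (if i = j then 2 else if i = j + 1 \<or> j = i + 1 then -1 else 0)"
    if ij: "i \<in> {1..n}" "j \<in> {1..n}" for i j
  proof (cases "i = j")
    case True
    have "f i \<in> R" using elem[of "i - 1"] ij P_subset by (auto simp: f_def n_def)
    then show ?thesis using True cartan_self by simp
  next
    case False
    have l: "i - 1 < length xs" "j - 1 < length xs" "i - 1 \<noteq> j - 1" using ij False by (auto simp: n_def)
    then have "xs ! (i - 1) \<noteq> xs ! (j - 1)" using dist nth_eq_iff_index_eq by blast
    moreover have "(j - 1 = i - 1 + 1 \<or> i - 1 = j - 1 + 1) \<longleftrightarrow> (i = j + 1 \<or> j = i + 1)" using ij by auto
    ultimately show ?thesis using adj[OF l] False by (simp add: f_def)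
  qed
  ultimately show ?thesis unfolding type_A_def by blast
qed

lemma int_pos_ge_1: "x \<in> \<int> \<Longrightarrow> x > 0 \<Longrightarrow> x \<ge> (1::real)"
  by (metis Ints_cases int_one_le_iff_zero_less of_int_0_less_iff of_int_1_le_iff)

section \<open>A single simple root not orthogonal to the highest root\<close>

context
  fixes a\<^sub>0
  assumes a0: "a\<^sub>0 \<in> P" "\<theta> \<bullet> a\<^sub>0 > 0" and a0_unique: "\<And>\<sigma>. \<sigma> \<in> P \<Longrightarrow> \<sigma> \<noteq> a\<^sub>0 \<Longrightarrow> \<theta> \<bullet> \<sigma> = 0"
begin

lemma inner_highest: "v \<bullet> \<theta> = cf v a\<^sub>0 * (a\<^sub>0 \<bullet> \<theta>)"
proof -
  have "(\<Sum>b\<in>P. cf v b * (b \<bullet> \<theta>)) = (\<Sum>b\<in>{a\<^sub>0}. cf v b * (b \<bullet> \<theta>))"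
    using a0(1) a0_unique finite_P by (intro sum.mono_neutral_right) (auto simp: inner_commute)
  then show ?thesis unfolding inner_expand[of v] by simp
qed

lemma heis_iff_supp:
  assumes "\<eta> \<in> \<Phi>"
  shows "\<eta> \<in> heis R P \<longleftrightarrow> a\<^sub>0 \<in> supp \<eta>"
proof -
  have "a\<^sub>0 \<bullet> \<theta> > 0" using a0(2) by (simp add: inner_commute)
  then have "\<eta> \<bullet> \<theta> > 0 \<longleftrightarrow> cf \<eta> a\<^sub>0 > 0" unfolding inner_highest[of \<eta>] by (simp add: zero_less_mult_iff)
  then show ?thesis using assms a0(1) pos_cf[OF assms, of a\<^sub>0] by (auto simp: heis_def supp_def)
qed

text \<open>The least partner is the sum of a minimal connected set of simple roots that links \<open>a\<^sub>0\<close> to the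
  support of \<open>\<nu>\<close>.\<close>
lemma least_heis_partner:
  assumes nu: "\<nu> \<in> \<Phi>" "\<nu> \<bullet> \<theta> = 0"
  obtains \<eta>\<^sub>0 where "\<eta>\<^sub>0 \<in> heis R P" "\<nu> + \<eta>\<^sub>0 \<in> R"
    "\<And>\<eta>. \<eta> \<in> heis R P \<Longrightarrow> \<nu> + \<eta> \<in> R \<Longrightarrow> nonneg_comb P (\<eta> - \<eta>\<^sub>0)"
proof -
  have a0nu: "a\<^sub>0 \<notin> supp \<nu>" using heis_iff_supp[OF nu(1)] nu by (simp add: heis_def)
  obtain y0 where y0: "y0 \<in> supp \<nu>" using supp_pos_ne[OF nu(1)] by blast
  let ?B = "\<lambda>C. C \<subseteq> P \<and> dynkin_connected C \<and> a\<^sub>0 \<in> C \<and> C \<inter> supp \<nu> = {}"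
  let ?Q = "\<lambda>C. ?B C \<and> (\<exists>x\<in>C. \<exists>y\<in>supp \<nu>. x \<bullet> y \<noteq> 0)"
  \<comment> \<open>A largest set satisfying \<open>?B\<close> touches the support of
    \<open>\<nu>\<close>: by connectedness of \<open>P\<close> it has a neighbour outside, and a
    neighbour not in the support could be added.\<close>
  have "\<exists>C. ?Q C"
  proof -
    define \<B> where "\<B> = {C. ?B C}"
    have "\<B> \<subseteq> Pow P" by (auto simp: \<B>_def)
    then have fin: "finite \<B>" using finite_P finite_subset by blast
    have mem: "{a\<^sub>0} \<in> \<B>" using a0(1) a0nu by (simp add: \<B>_def)
    obtain C where "C \<in> \<B>" and max: "\<And>D. D \<in> \<B> \<Longrightarrow> card D \<le> card C"
      by (rule finite_arg_max[OF fin mem, of card]) blast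
    then have C: "?B C" by (simp add: \<B>_def)
    have "y0 \<in> P" "y0 \<notin> C" using y0 C supp_subset[of \<nu>] by blast+
    then obtain x y where xy: "x \<in> C" "y \<in> P" "y \<notin> C" "x \<bullet> y \<noteq> 0"
      using dynkin_connected_cut[OF P_connected, of C a\<^sub>0 y0] C by blast
    have "y \<in> supp \<nu>"
    proof (rule ccontr)
      assume n: "y \<notin> supp \<nu>"
      have "dynkin_connected (C \<union> {y})"
        using dynkin_connected_Un[OF _ dynkin_connected_singleton, of C x y] C xy by simp
      then have "C \<union> {y} \<in> \<B>" using C xy n by (auto simp: \<B>_def)
      moreover have "card (C \<union> {y}) = Suc (card C)"
        using xy C finite_subset[OF _ finite_P, of C] by simp
      ultimately show False using max[of "C \<union> {y}"] by simp
    qed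
    then show ?thesis using C xy by blast
  qed
  then obtain C\<^sub>0 where "?Q C\<^sub>0" ..
  from ex_has_least_nat[of ?Q, OF this, of card]
  obtain C where C: "?Q C" "\<And>D. ?Q D \<Longrightarrow> card C \<le> card D" by (elim exE conjE) blast
  have CP: "C \<subseteq> P" and Cc: "dynkin_connected C" and aC: "a\<^sub>0 \<in> C" and Cnu: "C \<inter> supp \<nu> = {}" using C(1) by blast+
  obtain x y where xy: "x \<in> C" "y \<in> supp \<nu>" "x \<bullet> y \<noteq> 0" using C(1) by blast
  have finC: "finite C" using CP finite_P finite_subset by blast
  have s: "\<Sum>C \<in> \<Phi>" using sum_connected_root[OF CP Cc] aC by blast
  have "\<Sum>C \<in> heis R P" using heis_iff_supp[OF s] a0 aC CP by (simp add: supp_def cf_sum_set)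
  have le: "c \<bullet> b \<le> 0" if "c \<in> C" "b \<in> supp \<nu>" for b c
    using simple_inner_le_0[of c b] that CP Cnu supp_subset[of \<nu>] by blast
  have "\<Sum>C \<bullet> y < 0"
    by (rule sum_inner_neg[of _ _ x])
      (use xy CP le[OF _ xy(2)] in \<open>auto simp: cf_sum_set split: if_splits\<close>)
  then have y_neg: "y \<bullet> \<Sum>C < 0" by (simp add: inner_commute)
  have "\<nu> \<bullet> \<Sum>C < 0"
  proof (rule sum_inner_neg)
    show "b \<bullet> \<Sum>C \<le> 0" if "b \<in> P" "cf \<nu> b \<noteq> 0" for b
      unfolding inner_sum_right using le[of _ b] that by (intro sum_nonpos) (auto simp: supp_def inner_commute)
    show "y \<in> P" "cf \<nu> y \<noteq> 0" "y \<bullet> \<Sum>C \<noteq> 0" using xy(2) y_neg by (auto simp: supp_def)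
  qed (rule pos_cf[OF nu(1)])
  then have root: "\<nu> + \<Sum>C \<in> R" using root_add[of \<nu> "\<Sum>C"] nu s pos_R pos_add_ne_0 by blast
  have least: "nonneg_comb P (\<eta> - \<Sum>C)" if e: "\<eta> \<in> heis R P" "\<nu> + \<eta> \<in> R" for \<eta>
  proof -
    have ep: "\<eta> \<in> \<Phi>" using e heis_pos by blast
    have "supp (\<nu> + \<eta>) = supp \<nu> \<union> supp \<eta>" using supp_add[OF nu(1) ep] .
    then have c1: "dynkin_connected (supp \<nu> \<union> supp \<eta>)" using supp_root_connected[OF e(2)] by simp
    have c2: "dynkin_connected (C \<union> supp \<nu>)"
      using dynkin_connected_Un[OF Cc supp_connected[OF nu(1)] xy(1,2)] xy(3) by blast
    \<comment> \<open>Intersecting these connected sets shows that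
      \<open>C \<inter> supp \<eta>\<close> still links \<open>a\<^sub>0\<close> to the support of
      \<open>\<nu>\<close>; minimality of \<open>C\<close> then forces
      \<open>C \<subseteq> supp \<eta>\<close>.\<close>
    have "dynkin_connected ((C \<union> supp \<nu>) \<inter> (supp \<nu> \<union> supp \<eta>))"
      using dynkin_connected_Int[OF _ _ c2 c1] CP supp_subset by blast
    moreover have "(C \<union> supp \<nu>) \<inter> (supp \<nu> \<union> supp \<eta>) = C \<inter> supp \<eta> \<union> supp \<nu>" by blast
    ultimately have c3: "dynkin_connected (C \<inter> supp \<eta> \<union> supp \<nu>)" by simp
    have aD: "a\<^sub>0 \<in> C \<inter> supp \<eta>" using aC heis_iff_supp[OF ep] e by blast
    have "y0 \<notin> C \<inter> supp \<eta>" using y0 Cnu by blast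
    then obtain p q where "p \<in> C \<inter> supp \<eta>" "q \<in> supp \<nu>" "p \<bullet> q \<noteq> 0"
      using dynkin_connected_cut[OF c3, of "C \<inter> supp \<eta>" a\<^sub>0 y0] aD y0 by blast
    moreover have "dynkin_connected (C \<inter> supp \<eta>)"
      using dynkin_connected_Int[OF CP supp_subset Cc supp_connected[OF ep]] .
    ultimately have "?Q (C \<inter> supp \<eta>)" using aD CP Cnu by blast
    then have "card C \<le> card (C \<inter> supp \<eta>)" by (rule C(2))
    then have "C \<inter> supp \<eta> = C" using finC by (meson Int_lower1 card_seteq)
    then have sub: "C \<subseteq> supp \<eta>" by blast
    show ?thesis
      unfolding nonneg_iff
    proof
      fix c assume "c \<in> P"
      have int: "cf \<eta> c \<in> \<int>" using root_cf_Ints pos_R[OF ep] by blast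
      have "cf \<eta> c \<ge> 1" if "c \<in> C"
        using int_pos_ge_1[OF int] pos_cf[OF ep, of c] that sub by (force simp: supp_def)
      then show "cf (\<eta> - \<Sum>C) c \<in> \<int> \<and> cf (\<eta> - \<Sum>C) c \<ge> 0"
        using int pos_cf[OF ep, of c] CP by (simp add: cf_sum_set)
    qed
  qed
  show ?thesis using that \<open>\<Sum>C \<in> heis R P\<close> root least by blast
qed

text \<open>The root \<open>\<nu> + \<eta>\<close> lies in \<open>heis R P\<close> with Cartan
  integer 1 at \<open>\<theta>\<close>, so its complement to \<open>\<theta>\<close> lies there too;
  adding \<open>\<nu>\<close> to that complement gives the partner \<open>\<theta> - \<eta>\<close>
  of \<open>\<eta>\<close>.\<close>

lemma heis_partner_pair:
  assumes nu: "\<nu> \<in> \<Phi>" "\<nu> \<bullet> \<theta> = 0" and e: "\<eta> \<in> heis R P" "\<nu> + \<eta> \<in> R"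
  shows "\<theta> - \<nu> - \<eta> \<in> heis R P" "\<nu> + (\<theta> - \<nu> - \<eta>) \<in> R"
proof -
  have ne: "\<eta> \<noteq> \<theta>" using highest_add_notin[OF nu(1)] e(2) by (auto simp: add.commute)
  have h: "\<nu> + \<eta> \<in> heis R P" using e nu by (simp add: heis_iff inner_add_left)
  have "cartan (\<nu> + \<eta>) \<theta> = 1"
    using heis_cartan[OF e(1) ne] nu(2) by (simp add: cartan_add) (simp add: cartan_def)
  then have "\<nu> + \<eta> \<noteq> \<theta>" using cartan_self[OF highest_R] by auto
  then have "\<theta> - (\<nu> + \<eta>) \<in> heis R P" using heis_pair h by blast
  then show "\<theta> - \<nu> - \<eta> \<in> heis R P" by (simp add: diff_diff_eq)
  have "\<theta> - \<eta> \<in> heis R P" using heis_pair e ne by blast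
  then show "\<nu> + (\<theta> - \<nu> - \<eta>) \<in> R" by (simp add: heis_iff)
qed

text \<open>By \<open>I_max_eq\<close> the set is all of \<open>?L\<close> if \<open>\<nu>\<close>
  is no positive root, and empty for \<open>\<theta>\<close>. Otherwise it consists of the
  \<open>\<alpha>\<close> whose minimal ideal contains one fixed root:
  \<open>\<theta> - \<nu>\<close> if \<open>\<nu>\<close> is in \<open>heis R P\<close>, and
  \<open>?m\<close> if \<open>\<nu>\<close> is orthogonal to \<open>\<theta>\<close>.\<close>

lemma I_max_compl_connected:
  "dynkin_connected {\<alpha> \<in> long_simple R P. \<nu> \<notin> I_max R P \<alpha>}" (is "dynkin_connected ?T")
proof -
  let ?L = "long_simple R P"
  have M: "I_min R P \<alpha> \<subseteq> heis R P" if "\<alpha> \<in> ?L" for \<alpha> using I_min_heis[OF that refl] .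
  consider "\<nu> \<notin> \<Phi>" | "\<nu> = \<theta>" | "\<nu> \<in> heis R P" "\<nu> \<noteq> \<theta>" | "\<nu> \<in> \<Phi>" "\<nu> \<bullet> \<theta> = 0"
    using highest_inner_nonneg[of \<nu>] by (force simp: heis_def)
  then show ?thesis
  proof cases
    case 1
    then have "\<nu> \<notin> I_min R P \<alpha>" if "\<alpha> \<in> ?L" for \<alpha> using M[OF that] heis_pos by blast
    with 1 have "?T = ?L" by (auto simp: I_max_eq)
    then show ?thesis using long_simple_connected by simp
  next
    case 2
    then have "?T = {}" using theta_I_min[OF _ refl] by (auto simp: I_max_eq)
    then show ?thesis by (simp only: dynkin_connected_empty)
  next
    case 3
    have "\<nu> \<bullet> \<theta> \<noteq> 0" using 3 by (simp add: heis_def)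
    then have "?T = {\<alpha> \<in> ?L. \<theta> - \<nu> \<in> I_min R P \<alpha>}"
      using I_min_pair[OF _ refl 3] by (auto simp: I_max_eq)
    then show ?thesis using I_min_set_connected by simp
  next
    case 4
    obtain \<eta>\<^sub>0 where e0: "\<eta>\<^sub>0 \<in> heis R P" "\<nu> + \<eta>\<^sub>0 \<in> R"
      "\<And>\<eta>. \<eta> \<in> heis R P \<Longrightarrow> \<nu> + \<eta> \<in> R \<Longrightarrow> nonneg_comb P (\<eta> - \<eta>\<^sub>0)"
      using least_heis_partner[OF 4] by blast
    let ?m = "\<theta> - \<nu> - \<eta>\<^sub>0"
    have m: "?m \<in> heis R P" "\<nu> + ?m \<in> R" using heis_partner_pair[OF 4 e0(1,2)] by blast+
    have "\<nu> \<notin> I_max R P \<alpha> \<longleftrightarrow> ?m \<in> I_min R P \<alpha>" if al: "\<alpha> \<in> ?L" for \<alpha>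
    proof -
      have "\<nu> \<notin> heis R P" using 4 by (simp add: heis_def)
      then have "\<nu> \<notin> I_max R P \<alpha> \<longleftrightarrow> (\<exists>\<eta>\<in>I_min R P \<alpha>. \<nu> + \<eta> \<in> R)"
        using 4 M[OF al] by (auto simp: I_max_eq[OF al])
      also have "\<dots> \<longleftrightarrow> ?m \<in> I_min R P \<alpha>"
      proof
        assume "\<exists>\<eta>\<in>I_min R P \<alpha>. \<nu> + \<eta> \<in> R"
        then obtain \<eta> where e: "\<eta> \<in> I_min R P \<alpha>" "\<nu> + \<eta> \<in> R" by blast
        then have "\<eta> \<in> heis R P" using M[OF al] by blast
        \<comment> \<open>Leastness of \<open>\<eta>\<^sub>0\<close>, applied to the mirror image of
          \<open>\<eta>\<close>, says that \<open>\<eta>\<close> lies below \<open>?m\<close>, so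
          the upper ideal contains \<open>?m\<close>.\<close>
        then have "nonneg_comb P (\<theta> - \<nu> - \<eta> - \<eta>\<^sub>0)" using heis_partner_pair[OF 4 _ e(2)] e0(3) by blast
        moreover have "\<theta> - \<nu> - \<eta> - \<eta>\<^sub>0 = ?m - \<eta>" by simp
        ultimately show "?m \<in> I_min R P \<alpha>"
          using upper_ideal_mono[OF I_min_upper[OF al refl] e(1) heis_pos[OF m(1)]] by simp
      qed (use m(2) in blast)
      finally show ?thesis .
    qed
    then have "?T = {\<alpha> \<in> ?L. ?m \<in> I_min R P \<alpha>}" by blast
    then show ?thesis using I_min_set_connected by simp
  qed
qed

end

lemma Union_I_max:
  assumes S: "S \<subseteq> long_simple R P" and "\<not> type_A P"
  shows "(\<Union>\<alpha>\<in>S. I_max R P \<alpha>) = (\<Union>\<alpha>\<in>conn_hull R P S. I_max R P \<alpha>)"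
proof
  obtain a where a: "a \<in> P" "\<theta> \<bullet> a > 0" using highest_ex_simple by blast
  \<comment> \<open>A second simple root not orthogonal to \<open>\<theta>\<close> would force type
    A.\<close>
  have uniq: "\<theta> \<bullet> \<sigma> = 0" if s: "\<sigma> \<in> P" "\<sigma> \<noteq> a" for \<sigma>
  proof (rule ccontr)
    assume "\<theta> \<bullet> \<sigma> \<noteq> 0"
    then have "\<theta> \<bullet> \<sigma> > 0" using highest_dominant[OF s(1)] by simp
    then show False using type_A_if_highest_two_simple[OF s(1) _ a s(2)] assms(2) by blast
  qed
  show "(\<Union>\<alpha>\<in>conn_hull R P S. I_max R P \<alpha>) \<subseteq> (\<Union>\<alpha>\<in>S. I_max R P \<alpha>)"
  proof (rule ccontr)
    assume "\<not> ?thesis"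
    then obtain \<nu> \<alpha> where n: "\<alpha> \<in> conn_hull R P S" "\<nu> \<in> I_max R P \<alpha>" "\<nu> \<notin> (\<Union>\<alpha>\<in>S. I_max R P \<alpha>)" by blast
    then have "conn_hull R P S \<subseteq> {\<alpha> \<in> long_simple R P. \<nu> \<notin> I_max R P \<alpha>}"
      using conn_hull(3)[OF S _ _ I_max_compl_connected[OF a uniq, of \<nu>]] S by blast
    then show False using n by blast
  qed
qed (use conn_hull(1)[OF S] in blast)

end

theorem theorem4p5:
  fixes R P S :: "'a::euclidean_space set"
  assumes "reduced_root_system R" and "irreducible_rs R"
    and "simple_system R P"
    and "S \<subseteq> long_simple R P"
  shows "(\<Inter>\<alpha>\<in>S. I_min R P \<alpha>) = (\<Inter>\<alpha>\<in>conn_hull R P S. I_min R P \<alpha>) \<and>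
         (\<not> type_A P \<longrightarrow> (\<Union>\<alpha>\<in>S. I_max R P \<alpha>) = (\<Union>\<alpha>\<in>conn_hull R P S. I_max R P \<alpha>))"
proof -
  interpret irreducible_based_root_system R P
    using assms(1-3) by unfold_locales
  show ?thesis using Inter_I_min[OF assms(4)] Union_I_max[OF assms(4)] by blast
qed

end
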